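(* There is a polynomial-time algorithm which, given a linear hypergraph $H$ of rank 3, decides whether $H$ has outcome $\mathcal{A}$, i.e. whether $o(H)=\mathcal{A}$.
   Context: A hypergraph $H$ has a finite vertex set $V(H)$ and an edge set $E(H)\subseteq 2^{V(H)}$ (the empty edge is allowed). $H$ has rank 3 if all its edges have at most 3 vertices, and is linear if any two distinct edges share at most one vertex. In the Avoider-Enforcer game on $H$, two players, Avoider and Enforcer, alternately pick one previously unpicked vertex of $H$ until all vertices have been picked. Enforcer wins if at the end Avoider has picked all the vertices of some edge of $H$; otherwise Avoider wins (in particular Enforcer wins if $\varnothing\in E(H)$). The last player is the player who makes the last move of the game: this is the first player if $|V(H)|$ is odd and the second player if $|V(H)|$ is even; the other player is the second-to-last player. A player "wins on $H$ as last (resp. second-to-last) player" if that player has a winning strategy when they are the last (resp. second-to-last) player. The outcome satisfies $o(H)=\mathcal{A}$ if Avoider wins on $H$ both as last player and as second-to-last player. *)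

theory Defs
  imports "HOL-Computational_Algebra.Polynomial"
begin

section \<open>Hypergraphs\<close>

record 'a hypergraph =
  verts :: "'a set"
  edges :: "'a set set"

definition hypergraph :: "'a hypergraph \<Rightarrow> bool" where
  "hypergraph H \<longleftrightarrow> finite (verts H) \<and> edges H \<subseteq> Pow (verts H)"

definition rank3_hypergraph :: "'a hypergraph \<Rightarrow> bool" where
  "rank3_hypergraph H \<longleftrightarrow> (\<forall>e\<in>edges H. card e \<le> 3)"

definition linear_hypergraph :: "'a hypergraph \<Rightarrow> bool" where
  "linear_hypergraph H \<longleftrightarrow>
     (\<forall>e\<in>edges H. \<forall>f\<in>edges H. e \<noteq> f \<longrightarrow> card (e \<inter> f) \<le> 1)"


section \<open>The Avoider-Enforcer game\<close>

datatype player = Avoider | Enforcer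

fun opponent :: "player \<Rightarrow> player" where
  "opponent Avoider = Enforcer"
| "opponent Enforcer = Avoider"

text \<open>
  A complete play is the list of all vertices in the order in which they are picked.  Moves are
  numbered from 0, and \<open>f\<close> always denotes the player who makes move 0.
\<close>

definition play :: "'a hypergraph \<Rightarrow> 'a list \<Rightarrow> bool" where
  "play H xs \<longleftrightarrow> distinct xs \<and> set xs = verts H"

definition mover :: "player \<Rightarrow> nat \<Rightarrow> player" where
  "mover f i = (if even i then f else opponent f)"

definition picked :: "player \<Rightarrow> 'a list \<Rightarrow> player \<Rightarrow> 'a set" where
  "picked f xs P = {xs ! i | i. i < length xs \<and> mover f i = P}"

definition winner :: "'a hypergraph \<Rightarrow> player \<Rightarrow> 'a list \<Rightarrow> player" where
  "winner H f xs = (if \<exists>e\<in>edges H. e \<subseteq> picked f xs Avoider then Enforcer else Avoider)"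

text \<open>A strategy maps the list of all moves made so far to the next vertex to pick.\<close>

definition legal_strategy :: "'a hypergraph \<Rightarrow> ('a list \<Rightarrow> 'a) \<Rightarrow> bool" where
  "legal_strategy H \<sigma> \<longleftrightarrow>
     (\<forall>h. distinct h \<and> set h \<subset> verts H \<longrightarrow> \<sigma> h \<in> verts H - set h)"

definition follows :: "player \<Rightarrow> player \<Rightarrow> ('a list \<Rightarrow> 'a) \<Rightarrow> 'a list \<Rightarrow> bool" where
  "follows f P \<sigma> xs \<longleftrightarrow> (\<forall>i<length xs. mover f i = P \<longrightarrow> xs ! i = \<sigma> (take i xs))"

definition has_winning_strategy :: "'a hypergraph \<Rightarrow> player \<Rightarrow> player \<Rightarrow> bool" where
  "has_winning_strategy H f P \<longleftrightarrow>
     (\<exists>\<sigma>. legal_strategy H \<sigma> \<and> (\<forall>xs. play H xs \<and> follows f P \<sigma> xs \<longrightarrow> winner H f xs = P))"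

definition last_player :: "'a hypergraph \<Rightarrow> player \<Rightarrow> player" where
  "last_player H f = (if odd (card (verts H)) then f else opponent f)"

definition wins_as_last :: "'a hypergraph \<Rightarrow> player \<Rightarrow> bool" where
  "wins_as_last H P \<longleftrightarrow> (\<exists>f. last_player H f = P \<and> has_winning_strategy H f P)"

definition wins_as_second_to_last :: "'a hypergraph \<Rightarrow> player \<Rightarrow> bool" where
  "wins_as_second_to_last H P \<longleftrightarrow>
     (\<exists>f. opponent (last_player H f) = P \<and> has_winning_strategy H f P)"

definition outcome_Avoider :: "'a hypergraph \<Rightarrow> bool" where
  "outcome_Avoider H \<longleftrightarrow> wins_as_last H Avoider \<and> wins_as_second_to_last H Avoider"


section \<open>Deterministic multi-tape Turing machines\<close>

text \<open>
  States and tape symbols are initial segments of the natural numbers.  State 0 is initial, state 1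
  accepts and state 2 rejects.  Symbol 0 is the blank, and symbols 1, 2, 3 are the letters of the
  input alphabet.  The transition function maps a state and the symbols under the heads to the
  next state and, for each tape, the symbol to write and the direction in which to move afterwards.
  Only its values on the finite set of valid arguments matter.
\<close>

datatype direction = Move_Left | Stay | Move_Right

record turing_machine =
  num_tapes :: nat
  num_states :: nat
  num_symbols :: nat
  transition :: "nat \<Rightarrow> nat list \<Rightarrow> nat \<times> (nat \<times> direction) list"

abbreviation (input) start_state :: nat where "start_state \<equiv> 0"
abbreviation (input) accept_state :: nat where "accept_state \<equiv> 1"
abbreviation (input) reject_state :: nat where "reject_state \<equiv> 2"

abbreviation (input) blank :: nat where "blank \<equiv> 0"
abbreviation (input) letter_zero :: nat where "letter_zero \<equiv> 1"
abbreviation (input) letter_one :: nat where "letter_one \<equiv> 2"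
abbreviation (input) letter_sep :: nat where "letter_sep \<equiv> 3"

definition turing_machine :: "turing_machine \<Rightarrow> bool" where
  "turing_machine M \<longleftrightarrow>
     1 \<le> num_tapes M \<and> 3 \<le> num_states M \<and> 4 \<le> num_symbols M \<and>
     (\<forall>q ss. q < num_states M \<and> length ss = num_tapes M \<and> (\<forall>s\<in>set ss. s < num_symbols M) \<longrightarrow>
        fst (transition M q ss) < num_states M \<and>
        length (snd (transition M q ss)) = num_tapes M \<and>
        (\<forall>a\<in>set (snd (transition M q ss)). fst a < num_symbols M))"

text \<open>Tapes are infinite in both directions; a tape consists of its cells and the head position.\<close>

type_synonym tape = "(int \<Rightarrow> nat) \<times> int"

type_synonym config = "nat \<times> tape list"

fun read_tape :: "tape \<Rightarrow> nat" where
  "read_tape (c, p) = c p"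

fun move_head :: "direction \<Rightarrow> int \<Rightarrow> int" where
  "move_head Move_Left p = p - 1"
| "move_head Stay p = p"
| "move_head Move_Right p = p + 1"

fun act_tape :: "nat \<times> direction \<Rightarrow> tape \<Rightarrow> tape" where
  "act_tape (s, d) (c, p) = (c(p := s), move_head d p)"

fun step :: "turing_machine \<Rightarrow> config \<Rightarrow> config" where
  "step M (q, ts) =
     (if q = accept_state \<or> q = reject_state then (q, ts)
      else case transition M q (map read_tape ts) of (q', as) \<Rightarrow> (q', map2 act_tape as ts))"

definition blank_tape :: tape where
  "blank_tape = ((\<lambda>_. blank), 0)"

definition input_tape :: "nat list \<Rightarrow> tape" where
  "input_tape w = ((\<lambda>i. if 0 \<le> i \<and> i < int (length w) then w ! nat i else blank), 0)"

definition initial_config :: "turing_machine \<Rightarrow> nat list \<Rightarrow> config" where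
  "initial_config M w = (start_state, input_tape w # replicate (num_tapes M - 1) blank_tape)"

definition state_after :: "turing_machine \<Rightarrow> nat list \<Rightarrow> nat \<Rightarrow> nat" where
  "state_after M w t = fst ((step M ^^ t) (initial_config M w))"


section \<open>Hypergraphs as inputs\<close>

text \<open>
  A hypergraph is presented by its incidence matrix, for an arbitrary enumeration of the vertices
  and of the edges: the number of vertices in unary, followed by one separated row of bits for each
  edge.  With \<open>n\<close> vertices and \<open>m\<close> edges the word has length \<open>n + m * (n + 1)\<close>.
\<close>

definition incidence_word :: "'a list \<Rightarrow> 'a set list \<Rightarrow> nat list" where
  "incidence_word vs es =
     replicate (length vs) letter_one @
     concat (map (\<lambda>e. letter_sep # map (\<lambda>v. if v \<in> e then letter_one else letter_zero) vs) es)"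

definition encodes :: "nat list \<Rightarrow> 'a hypergraph \<Rightarrow> bool" where
  "encodes w H \<longleftrightarrow>
     (\<exists>vs es. distinct vs \<and> set vs = verts H \<and> distinct es \<and> set es = edges H \<and>
        w = incidence_word vs es)"

text \<open>
  Polynomial-time decidability of a property of hypergraphs satisfying a promise, with running time
  measured in the length of the input word.  The vertices are taken to be natural numbers so that
  one machine serves all hypergraphs; every finite hypergraph is isomorphic to one of these.
\<close>

definition poly_time_decides ::
  "turing_machine \<Rightarrow> (nat hypergraph \<Rightarrow> bool) \<Rightarrow> (nat hypergraph \<Rightarrow> bool) \<Rightarrow> bool" where
  "poly_time_decides M promise prop \<longleftrightarrow>
     (\<exists>p :: nat poly. \<forall>H w. promise H \<and> encodes w H \<longrightarrow>
        (\<exists>t \<le> poly p (length w).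
           state_after M w t = (if prop H then accept_state else reject_state)))"

end

theory Submission
  imports Defs
begin

text \<open>
  Suppose that Avoider has picked \<open>A\<close> and that the vertices in \<open>R\<close> are left. Call
  \<open>2 * card F - card (\<Union>F \<inter> R)\<close> the excess of a family \<open>F\<close> of edges that Enforcer has not touched. If Avoider is
  the last player and every family has excess at most 0 outside a packing of disjoint Pasch configurations, then he
  wins: inside the packing he answers with the opposite point, and otherwise with a vertex outside the largest
  family of excess 0, which exists by parity. Conversely, Enforcer wins if some minimal family of positive excess
  is not a Pasch configuration: he plays outside of a minimal family of excess 1, and a minimal family of excess 2
  is a Pasch configuration or contains an edge picked by Avoider. If all minimal families of positive excess are
  Pasch configurations, then these are disjoint and form a packing as above. Hence Avoider wins as last player if
  and only if every minimal family of positive excess is a Pasch configuration, and then he also wins as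
  second-to-last player.

  An edge with two private points belongs to no minimal family of positive excess and may be removed. When no such
  edge is left, double counting makes the condition local: every edge has three points, which lie on at most two
  edges each, and if three edges meet it, then these meet each other. A Turing machine tests this with
  nested loops over the rows of several copies of the incidence matrix, comparing rows by parallel sweeps.
\<close>

section \<open>The game as a recursion\<close>

text \<open>The factor 2 in the excess turns "excess at most 0 for all families" into Hall's
  condition for giving each edge two free points of its own. A pick of Avoider on a point of a
  family raises its excess by 1, while a pick of Enforcer deletes the edges through the vertex.
  Parity is the lever for both players: Enforcer moves with an even number of vertices left and
  Avoider with an odd number, so a family with excess 1 on Enforcer's turn, or excess 0 on Avoider's
  turn, cannot contain all of them. Dropping an edge lowers the excess by at most 2, hence a minimal
  family of positive excess has excess 1 or 2. The value 2 is the obstacle, since there positive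
  excess need not be lost: four lines have only the six points of a Pasch configuration, but any
  pick of Enforcer deletes two of the lines at once. Minimality and linearity show that this is the
  only exception. The excess condition ranges over exponentially many families. In a pruned
  hypergraph the counts of points and of incidences fit without slack, and this is what reduces it
  to a test on at most four edges.\<close>

text \<open>\<open>avoider_wins E k P A R\<close>: Avoider, who has picked \<open>A\<close>, wins when \<open>P\<close> is to move and the
  \<open>k\<close> vertices in \<open>R\<close> are still unpicked.\<close>

fun avoider_wins :: "'a set set \<Rightarrow> nat \<Rightarrow> player \<Rightarrow> 'a set \<Rightarrow> 'a set \<Rightarrow> bool" where
  "avoider_wins E 0 P A R \<longleftrightarrow> (\<forall>e\<in>E. \<not> e \<subseteq> A)"
| "avoider_wins E (Suc k) Avoider A R \<longleftrightarrow> (\<exists>x\<in>R. avoider_wins E k Enforcer (insert x A) (R - {x}))"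
| "avoider_wins E (Suc k) Enforcer A R \<longleftrightarrow> (\<forall>x\<in>R. avoider_wins E k Avoider A (R - {x}))"

lemma mover_Suc: "mover f (Suc i) = opponent (mover f i)"
  by (cases f) (simp_all add: mover_def)

lemma picked_append:
  "picked f (h @ [x]) P = (if mover f (length h) = P then insert x (picked f h P) else picked f h P)"
proof -
  have image: "picked f h P = (!) h ` {i. i < length h \<and> mover f i = P}" for h
    by (auto simp: picked_def)
  have "{i. i < length (h @ [x]) \<and> mover f i = P} =
    {i. i < length h \<and> mover f i = P} \<union> (if mover f (length h) = P then {length h} else {})"
    by (auto simp: less_Suc_eq)
  moreover have "(!) (h @ [x]) ` {i. i < length h \<and> mover f i = P} = (!) h ` {i. i < length h \<and> mover f i = P}"
    by (rule image_cong) (auto simp: nth_append)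
  ultimately show ?thesis by (simp add: image image_Un)
qed

lemma picked_Nil [simp]: "picked f [] P = {}"
  by (simp add: picked_def)

lemma follows_append:
  "follows f P \<sigma> (h @ [x]) \<longleftrightarrow> follows f P \<sigma> h \<and> (mover f (length h) = P \<longrightarrow> x = \<sigma> h)"
  by (auto simp: follows_def less_Suc_eq nth_append)

lemma strategy_imp_avoider_wins:
  assumes V: "finite (verts H)" and legal: "legal_strategy H \<sigma>"
    and win: "\<And>xs. play H xs \<Longrightarrow> follows f Avoider \<sigma> xs \<Longrightarrow> winner H f xs = Avoider"
  shows "distinct h \<Longrightarrow> set h \<subseteq> verts H \<Longrightarrow> follows f Avoider \<sigma> h \<Longrightarrow> k = card (verts H - set h) \<Longrightarrow>
    avoider_wins (edges H) k (mover f (length h)) (picked f h Avoider) (verts H - set h)"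
proof (induction k arbitrary: h)
  case 0
  then have "play H h" using V by (auto simp: play_def)
  with win 0 have "winner H f h = Avoider" by blast
  then show ?case by (auto simp: winner_def split: if_splits)
next
  case (Suc k)
  have step: "avoider_wins (edges H) k (opponent (mover f (length h))) (picked f (h @ [x]) Avoider) (verts H - set h - {x})"
    if "x \<in> verts H - set h" "mover f (length h) = Avoider \<longrightarrow> x = \<sigma> h" for x
  proof -
    have "verts H - set h - {x} = verts H - set (h @ [x])" by auto
    moreover have "k = card (verts H - set (h @ [x]))"
      using Suc.prems(4) that(1) V calculation by (metis card_Diff_singleton diff_Suc_1)
    ultimately show ?thesis
      using Suc.IH[of "h @ [x]"] Suc.prems that by (simp add: follows_append mover_Suc)
  qed
  show ?case
  proof (cases "mover f (length h)")
    case Avoider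
    have "set h \<noteq> verts H" using Suc.prems(4) by auto
    then have "\<sigma> h \<in> verts H - set h"
      using legal Suc.prems(1,2) by (auto simp: legal_strategy_def psubset_eq)
    then show ?thesis using step[of "\<sigma> h"] Avoider by (auto simp: picked_append)
  next
    case Enforcer
    then show ?thesis using step by (auto simp: picked_append)
  qed
qed

lemma avoider_wins_imp_strategy:
  assumes V: "finite (verts H)" and win: "avoider_wins (edges H) (card (verts H)) f {} (verts H)"
  shows "has_winning_strategy H f Avoider"
proof -
  define good where "good h x \<longleftrightarrow> x \<in> verts H - set h \<and>
    avoider_wins (edges H) (card (verts H - set h) - 1) Enforcer (insert x (picked f h Avoider)) (verts H - set h - {x})" for h x
  define \<sigma> where "\<sigma> h = (if \<exists>x. good h x then SOME x. good h x else SOME x. x \<in> verts H - set h)" for h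
  have \<sigma>_good: "good h (\<sigma> h)" if "\<exists>x. good h x" for h
    unfolding \<sigma>_def using that by (simp add: someI_ex)
  have "\<sigma> h \<in> verts H - set h" if "set h \<subset> verts H" for h
  proof (cases "\<exists>x. good h x")
    case True
    then show ?thesis using \<sigma>_good good_def by blast
  next
    case False
    have "\<exists>x. x \<in> verts H - set h" using that by auto
    then have "(SOME x. x \<in> verts H - set h) \<in> verts H - set h" by (rule someI_ex)
    then show ?thesis using False unfolding \<sigma>_def by presburger
  qed
  then have legal: "legal_strategy H \<sigma>" unfolding legal_strategy_def by blast
  have inv: "avoider_wins (edges H) (card (verts H) - length h) (mover f (length h)) (picked f h Avoider) (verts H - set h)"
    if "distinct h" "set h \<subseteq> verts H" "follows f Avoider \<sigma> h" for h
    using that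
  proof (induction h rule: rev_induct)
    case Nil
    then show ?case using win by (simp add: mover_def)
  next
    case (snoc x h)
    have x: "x \<in> verts H - set h" using snoc.prems by auto
    have card: "card (verts H - set h) = card (verts H) - length h"
      using snoc.prems V by (simp add: card_Diff_subset distinct_card)
    have "card (verts H - set h) \<noteq> 0" using x V by auto
    then obtain k where "card (verts H) - length h = Suc k"
      unfolding card using not0_implies_Suc by blast
    then have k: "card (verts H) - length h = Suc k" "card (verts H) - length (h @ [x]) = k" by auto
    have "avoider_wins (edges H) (card (verts H) - length h) (mover f (length h)) (picked f h Avoider) (verts H - set h)"
      by (rule snoc.IH) (use snoc.prems in \<open>auto simp: follows_append\<close>)
    then have IH: "avoider_wins (edges H) (Suc k) (mover f (length h)) (picked f h Avoider) (verts H - set h)"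
      unfolding k .
    have diff: "verts H - set (h @ [x]) = verts H - set h - {x}" by auto
    show ?case
    proof (cases "mover f (length h)")
      case Avoider
      then have "\<exists>x. good h x" using IH unfolding good_def card k(1) by auto
      from \<sigma>_good[OF this] have "good h x"
        using snoc.prems(3) Avoider by (simp add: follows_append)
      then show ?thesis
        using Avoider unfolding good_def card k diff by (simp add: mover_Suc picked_append)
    next
      case Enforcer
      then show ?thesis using IH x unfolding diff k by (simp add: mover_Suc picked_append)
    qed
  qed
  have "winner H f xs = Avoider" if "play H xs" "follows f Avoider \<sigma> xs" for xs
  proof -
    have "length xs = card (verts H)" using that(1) distinct_card by (fastforce simp: play_def)
    then show ?thesis using inv[of xs] that by (simp add: play_def winner_def)
  qed
  with legal show ?thesis unfolding has_winning_strategy_def by blast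
qed

lemma has_winning_strategy_Avoider_iff:
  assumes "finite (verts H)"
  shows "has_winning_strategy H f Avoider \<longleftrightarrow> avoider_wins (edges H) (card (verts H)) f {} (verts H)"
proof
  assume "has_winning_strategy H f Avoider"
  then obtain \<sigma> where "legal_strategy H \<sigma>"
      "\<And>xs. play H xs \<Longrightarrow> follows f Avoider \<sigma> xs \<Longrightarrow> winner H f xs = Avoider"
    unfolding has_winning_strategy_def by blast
  from strategy_imp_avoider_wins[OF assms this, of "[]"]
  show "avoider_wins (edges H) (card (verts H)) f {} (verts H)"
    by (simp add: follows_def mover_def)
qed (rule avoider_wins_imp_strategy[OF assms])

text \<open>Avoider imagines a game without the vertex \<open>b\<close>, in which he has picked at least as much: if Enforcer
  takes \<open>b\<close> in the real game, then an imagined move of Enforcer becomes the new missing vertex.\<close>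

lemma avoider_wins_reserve:
  assumes "avoider_wins E k Enforcer A' R" "even k" "finite R" "card R = k" "A \<subseteq> A'" "b \<notin> R"
  shows "avoider_wins E (Suc k) Enforcer A (insert b R)"
  using assms
proof (induction k arbitrary: A A' R b rule: less_induct)
  case (less k)
  show ?case
  proof (cases "k = 0")
    case True
    then show ?thesis using less.prems by auto
  next
    case False
    then obtain k' where k': "k = Suc k'" using not0_implies_Suc by blast
    with less.prems(2) have "k' \<noteq> 0" by (auto intro: odd_pos)
    then obtain l where l: "k = Suc (Suc l)" using k' not0_implies_Suc by blast
    \<comment> \<open>The missing vertex \<open>c\<close> is left open because it changes: it stays
      \<open>b\<close> as long as Enforcer picks some \<open>x\<close> in \<open>R\<close>, and
      becomes the imagined pick \<open>z\<close> when he takes \<open>b\<close> itself.\<close>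
    have reply: "\<exists>y\<in>R - {x}. \<forall>c. c \<notin> R - {x} - {y} \<longrightarrow>
        avoider_wins E (Suc l) Enforcer (insert y A) (insert c (R - {x} - {y}))" if x: "x \<in> R" for x
    proof -
      have "avoider_wins E (Suc l) Avoider A' (R - {x})" using less.prems(1) x l by simp
      then obtain y where y: "y \<in> R - {x}" "avoider_wins E l Enforcer (insert y A') (R - {x} - {y})" by auto
      have card: "card (R - {x} - {y}) = l" using y x less.prems l by simp
      have "avoider_wins E (Suc l) Enforcer (insert y A) (insert c (R - {x} - {y}))"
        if "c \<notin> R - {x} - {y}" for c
        by (rule less.IH[OF _ y(2)]) (use less.prems l that card in auto)
      with y show ?thesis by blast
    qed
    have "avoider_wins E k Avoider A (insert b R - {x})" if "x \<in> insert b R" for x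
    proof (cases "x = b")
      case True
      obtain z where z: "z \<in> R" using less.prems l by (metis card.empty ex_in_conv nat.distinct(1))
      from reply[OF z] obtain y where y: "y \<in> R - {z}"
        "avoider_wins E (Suc l) Enforcer (insert y A) (insert z (R - {z} - {y}))" by blast
      moreover have "insert z (R - {z} - {y}) = R - {y}" using y z by auto
      moreover have "insert b R - {x} = R" using True less.prems(6) by auto
      ultimately show ?thesis unfolding l avoider_wins.simps by auto
    next
      case False
      then have x: "x \<in> R" using that by simp
      from reply[OF x] less.prems(6) obtain y where y: "y \<in> R - {x}"
        "avoider_wins E (Suc l) Enforcer (insert y A) (insert b (R - {x} - {y}))" by blast
      moreover have "insert b (R - {x} - {y}) = insert b R - {x} - {y}" using y False less.prems(6) by auto
      ultimately show ?thesis unfolding l avoider_wins.simps by auto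
    qed
    then show ?thesis by simp
  qed
qed

section \<open>Reduction to the game with Avoider as last player\<close>

abbreviation last_first :: "'a hypergraph \<Rightarrow> player" where
  "last_first H \<equiv> if odd (card (verts H)) then Avoider else Enforcer"

text \<open>Being last is the harder role for Avoider. As second-to-last player he follows a
  last-player strategy in an imagined game with one vertex missing. If he would move first in that
  game, then the missing vertex is his own imagined pick \<open>y\<close>; if Enforcer would, then
  it is a vertex \<open>b\<close> that Enforcer is imagined to have picked.\<close>

lemma outcome_Avoider_iff:
  assumes V: "finite (verts H)"
  shows "outcome_Avoider H \<longleftrightarrow> avoider_wins (edges H) (card (verts H)) (last_first H) {} (verts H)"
proof -
  let ?n = "card (verts H)" let ?V = "verts H" let ?E = "edges H"
  have last: "wins_as_last H Avoider \<longleftrightarrow> avoider_wins ?E ?n (last_first H) {} ?V"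
  proof -
    have "last_player H f = Avoider \<longleftrightarrow> f = last_first H" for f
      by (cases f) (auto simp: last_player_def)
    then show ?thesis unfolding wins_as_last_def has_winning_strategy_Avoider_iff[OF V] by simp
  qed
  have second: "wins_as_second_to_last H Avoider \<longleftrightarrow> avoider_wins ?E ?n (opponent (last_first H)) {} ?V"
  proof -
    have "opponent (last_player H f) = Avoider \<longleftrightarrow> f = opponent (last_first H)" for f
      by (cases f) (auto simp: last_player_def)
    then show ?thesis unfolding wins_as_second_to_last_def has_winning_strategy_Avoider_iff[OF V] by simp
  qed
  have "avoider_wins ?E ?n (opponent (last_first H)) {} ?V" if w: "avoider_wins ?E ?n (last_first H) {} ?V"
  proof (cases "odd ?n")
    case True
    then obtain k where k: "?n = Suc k" by (metis even_zero not0_implies_Suc)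
    then obtain y where y: "y \<in> ?V" "avoider_wins ?E k Enforcer {y} (?V - {y})"
      using w True by auto
    have "avoider_wins ?E (Suc k) Enforcer {} (insert y (?V - {y}))"
      by (rule avoider_wins_reserve[OF y(2)]) (use True k V y in auto)
    then show ?thesis using k True y by (simp add: insert_absorb)
  next
    case even: False
    show ?thesis
    proof (cases "?n = 0")
      case True
      then show ?thesis using w by simp
    next
      case False
      then obtain k' where k': "?n = Suc k'" using not0_implies_Suc by blast
      with even have "k' \<noteq> 0" by (auto intro: odd_pos)
      then obtain k where k: "?n = Suc (Suc k)" using k' not0_implies_Suc by blast
      then obtain b where b: "b \<in> ?V" by (metis card.empty ex_in_conv nat.distinct(1))
      then have "avoider_wins ?E (Suc k) Avoider {} (?V - {b})" using w even k by simp
      then obtain y where y: "y \<in> ?V - {b}" "avoider_wins ?E k Enforcer {y} (?V - {b} - {y})" by auto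
      have "avoider_wins ?E (Suc k) Enforcer {y} (insert b (?V - {b} - {y}))"
        by (rule avoider_wins_reserve[OF y(2)]) (use even k V y b in auto)
      moreover have "insert b (?V - {b} - {y}) = ?V - {y}" using y b by auto
      ultimately show ?thesis using even k y by auto
    qed
  qed
  with last second show ?thesis unfolding outcome_Avoider_def by blast
qed

section \<open>Pasch configurations\<close>

definition linear_family :: "'a set set \<Rightarrow> bool" where
  "linear_family E \<longleftrightarrow> (\<forall>e\<in>E. finite e \<and> card e \<le> 3) \<and> (\<forall>e\<in>E. \<forall>f\<in>E. e \<noteq> f \<longrightarrow> card (e \<inter> f) \<le> 1)"

lemma linear_family_subset: "linear_family E \<Longrightarrow> F \<subseteq> E \<Longrightarrow> linear_family F"
  unfolding linear_family_def by blast

lemma linear_family_eq: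
  assumes "linear_family E" "e \<in> E" "f \<in> E" "v \<in> e" "v \<in> f" "w \<in> e" "w \<in> f" "v \<noteq> w"
  shows "e = f"
proof (rule ccontr)
  assume "e \<noteq> f"
  then have "card (e \<inter> f) \<le> 1" "finite (e \<inter> f)" using assms by (auto simp: linear_family_def)
  moreover have "card {v, w} \<le> card (e \<inter> f)" using assms calculation by (intro card_mono) auto
  ultimately show False using assms by simp
qed

text \<open>The six points are the intersections of the six pairs of lines.\<close>

definition pasch :: "'a set set \<Rightarrow> bool" where
  "pasch Q \<longleftrightarrow> (\<exists>a b c d e f. distinct [a, b, c, d, e, f] \<and>
     Q = {{a, b, c}, {a, d, e}, {b, d, f}, {c, e, f}})"

lemma pasch_card:
  assumes "pasch Q"
  shows "card Q = 4" "finite Q" "card (\<Union>Q) = 6" "finite (\<Union>Q)" "Q \<noteq> {}" "\<And>e. e \<in> Q \<Longrightarrow> card e = 3"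
    "\<And>e f. e \<in> Q \<Longrightarrow> f \<in> Q \<Longrightarrow> e \<inter> f \<noteq> {}"
proof -
  obtain a b c d e f where abc: "distinct [a, b, c, d, e, f]"
    "Q = {{a, b, c}, {a, d, e}, {b, d, f}, {c, e, f}}"
    using assms unfolding pasch_def by blast
  have neq: "{a, b, c} \<noteq> {a, d, e}" "{a, b, c} \<noteq> {b, d, f}" "{a, b, c} \<noteq> {c, e, f}"
     "{a, d, e} \<noteq> {b, d, f}" "{a, d, e} \<noteq> {c, e, f}" "{b, d, f} \<noteq> {c, e, f}"
    using abc(1) by (auto simp: set_eq_iff)
  show "card Q = 4" unfolding abc using neq by simp
  have U: "\<Union>Q = {a, b, c, d, e, f}" unfolding abc by auto
  show "card (\<Union>Q) = 6" unfolding U using abc(1) by simp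
  show "finite Q" "finite (\<Union>Q)" "Q \<noteq> {}" unfolding abc by auto
  show "card e = 3" if "e \<in> Q" for e using that abc(1) unfolding abc(2) by auto
  show "e \<inter> f \<noteq> {}" if "e \<in> Q" "f \<in> Q" for e f using that unfolding abc by auto
qed

lemma pasch_at:
  assumes "pasch Q" "x \<in> \<Union>Q"
  shows "\<exists>b c d e f. distinct [x, b, c, d, e, f] \<and> Q = {{x, b, c}, {x, d, e}, {b, d, f}, {c, e, f}}"
proof -
  obtain a b c d e f where abc: "distinct [a, b, c, d, e, f]"
    "Q = {{a, b, c}, {a, d, e}, {b, d, f}, {c, e, f}}"
    using assms unfolding pasch_def by blast
  have "x = a \<or> x = b \<or> x = c \<or> x = d \<or> x = e \<or> x = f" using assms(2) unfolding abc by auto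
  then consider "x = a" | "x = b" | "x = c" | "x = d" | "x = e" | "x = f" by blast
  then show ?thesis
  proof cases
    case 1
    have "distinct [x, b, c, d, e, f]" using abc(1) 1 by auto
    moreover have "Q = {{x, b, c}, {x, d, e}, {b, d, f}, {c, e, f}}"
      unfolding abc(2) 1 by (simp only: insert_commute)
    ultimately show ?thesis by blast
  next
    case 2
    have "distinct [x, a, c, d, f, e]" using abc(1) 2 by auto
    moreover have "Q = {{x, a, c}, {x, d, f}, {a, d, e}, {c, f, e}}"
      unfolding abc(2) 2 by (simp only: insert_commute)
    ultimately show ?thesis by blast
  next
    case 3
    have "distinct [x, a, b, e, f, d]" using abc(1) 3 by auto
    moreover have "Q = {{x, a, b}, {x, e, f}, {a, e, d}, {b, f, d}}"
      unfolding abc(2) 3 by (simp only: insert_commute)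
    ultimately show ?thesis by blast
  next
    case 4
    have "distinct [x, a, e, b, f, c]" using abc(1) 4 by auto
    moreover have "Q = {{x, a, e}, {x, b, f}, {a, b, c}, {e, f, c}}"
      unfolding abc(2) 4 by (simp only: insert_commute)
    ultimately show ?thesis by blast
  next
    case 5
    have "distinct [x, a, d, c, f, b]" using abc(1) 5 by auto
    moreover have "Q = {{x, a, d}, {x, c, f}, {a, c, b}, {d, f, b}}"
      unfolding abc(2) 5 by (simp only: insert_commute)
    ultimately show ?thesis by blast
  next
    case 6
    have "distinct [x, b, d, c, e, a]" using abc(1) 6 by auto
    moreover have "Q = {{x, b, d}, {x, c, e}, {b, c, a}, {d, e, a}}"
      unfolding abc(2) 6 by (simp only: insert_commute)
    ultimately show ?thesis by blast
  qed
qed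

lemma four_sets_split:
  assumes "v \<in> A" "v \<in> B" "v \<notin> C" "v \<notin> D"
  shows "{l\<in>{A, B, C, D}. v \<in> l} = {A, B}" "{l\<in>{A, B, C, D}. v \<notin> l} = {C, D}"
  using assms by auto

lemma pasch_two_lines:
  assumes "pasch Q" "v \<in> \<Union>Q"
  shows "\<exists>e f. e \<noteq> f \<and> {l\<in>Q. v \<in> l} = {e, f}"
proof -
  obtain b c d e f where Q: "distinct [v, b, c, d, e, f]" "Q = {{v, b, c}, {v, d, e}, {b, d, f}, {c, e, f}}"
    using pasch_at[OF assms] by blast
  have "{l\<in>Q. v \<in> l} = {{v, b, c}, {v, d, e}}"
    unfolding Q(2) by (rule four_sets_split) (use Q(1) in auto)
  moreover have "b \<notin> {v, d, e}" using Q(1) by auto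
  then have "{v, b, c} \<noteq> {v, d, e}" by blast
  ultimately show ?thesis by (intro exI conjI)
qed

text \<open>\<open>z\<close> is the point that shares no line with \<open>x\<close>. Once
  \<open>x\<close> belongs to Enforcer, only \<open>g\<close> and \<open>h\<close> survive, and a
  pick of their common point \<open>z\<close> costs each of them just one point.\<close>

lemma pasch_opposite:
  assumes "pasch Q" "x \<in> \<Union>Q"
  shows "\<exists>z g h. z \<in> \<Union>Q \<and> z \<noteq> x \<and> {l\<in>Q. x \<notin> l} = {g, h} \<and> g \<noteq> h \<and> g \<inter> h \<subseteq> {z} \<and>
    card (g - {z}) = 2 \<and> card (h - {z}) = 2"
proof -
  obtain b c d e f where Q: "distinct [x, b, c, d, e, f]" "Q = {{x, b, c}, {x, d, e}, {b, d, f}, {c, e, f}}"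
    using pasch_at[OF assms] by blast
  have "{l\<in>Q. x \<notin> l} = {{b, d, f}, {c, e, f}}"
    unfolding Q(2) by (rule four_sets_split) (use Q(1) in auto)
  moreover have "{b, d, f} \<noteq> {c, e, f}" "{b, d, f} \<inter> {c, e, f} \<subseteq> {f}"
    "card ({b, d, f} - {f}) = 2" "card ({c, e, f} - {f}) = 2"
  proof -
    have "b \<notin> {c, e, f}" using Q(1) by auto
    then show "{b, d, f} \<noteq> {c, e, f}" by blast
    show "{b, d, f} \<inter> {c, e, f} \<subseteq> {f}" using Q(1) by auto
    have "{b, d, f} - {f} = {b, d}" "{c, e, f} - {f} = {c, e}" "b \<noteq> d" "c \<noteq> e" using Q(1) by auto
    then show "card ({b, d, f} - {f}) = 2" "card ({c, e, f} - {f}) = 2" by simp_all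
  qed
  moreover have "f \<in> \<Union>Q" "f \<noteq> x" using Q by auto
  ultimately show ?thesis by (intro exI conjI)
qed

text \<open>Every point lies on exactly two of the four lines, so the points on exactly one of the
  other three lines are those of \<open>e\<close>. In \<open>pasch_eq\<close> three common lines
  thereby determine the fourth.\<close>

lemma pasch_line_unique:
  assumes "pasch Q" "e \<in> Q"
  shows "e = {v. \<exists>!l. l \<in> Q - {e} \<and> v \<in> l}"
proof (rule set_eqI)
  fix v
  have lin: "\<exists>l l'. l \<noteq> l' \<and> {l\<in>Q. v \<in> l} = {l, l'}" if "v \<in> \<Union>Q"
    using pasch_two_lines[OF assms(1) that] by blast
  show "v \<in> e \<longleftrightarrow> v \<in> {v. \<exists>!l. l \<in> Q - {e} \<and> v \<in> l}"
  proof (cases "v \<in> \<Union>Q")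
    case True
    then obtain l l' where l: "l \<noteq> l'" "{l\<in>Q. v \<in> l} = {l, l'}" using lin by blast
    then have *: "k \<in> Q \<and> v \<in> k \<longleftrightarrow> k = l \<or> k = l'" for k by blast
    have other: "(k \<in> Q - {e} \<and> v \<in> k) \<longleftrightarrow> (k = l \<or> k = l') \<and> k \<noteq> e" for k using * by blast
    have e: "v \<in> e \<longleftrightarrow> e = l \<or> e = l'" using * assms(2) by blast
    consider "e = l" | "e = l'" | "e \<noteq> l" "e \<noteq> l'" by blast
    then show ?thesis
    proof cases
      case 1
      then have "(k \<in> Q - {e} \<and> v \<in> k) \<longleftrightarrow> k = l'" for k using other l(1) by blast
      then show ?thesis using e 1 by simp
    next
      case 2
      then have "(k \<in> Q - {e} \<and> v \<in> k) \<longleftrightarrow> k = l" for k using other l(1) by blast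
      then show ?thesis using e 2 by simp
    next
      case 3
      then have "l \<in> Q - {e} \<and> v \<in> l" "l' \<in> Q - {e} \<and> v \<in> l'" using other by blast+
      then have "\<not> (\<exists>!k. k \<in> Q - {e} \<and> v \<in> k)" using l(1) by blast
      then show ?thesis using e 3 by simp
    qed
  next
    case False
    then have "v \<notin> e" "\<not> (\<exists>l. l \<in> Q - {e} \<and> v \<in> l)" using assms(2) by blast+
    then show ?thesis by blast
  qed
qed

lemma pasch_eq:
  assumes "pasch Q" "pasch Q'" "3 \<le> card (Q \<inter> Q')"
  shows "Q = Q'"
proof (rule ccontr)
  assume neq: "Q \<noteq> Q'"
  note c = pasch_card[OF assms(1)] pasch_card[OF assms(2)]
  have "\<not> Q \<subseteq> Q'"
    using neq card_subset_eq[of Q' Q] c(2,1,9,8) by auto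
  then have "Q \<inter> Q' \<subset> Q" by blast
  then have lt: "card (Q \<inter> Q') < 4"
    using psubset_card_mono[of Q "Q \<inter> Q'"] c by auto
  have "card (Q - Q') = 1" "card (Q' - Q) = 1"
    using card_Diff_subset_Int[of Q Q'] card_Diff_subset_Int[of Q' Q] c lt assms(3)
    by (auto simp: Int_commute)
  then obtain e e' where e: "Q - Q' = {e}" "Q' - Q = {e'}" by (meson card_1_singletonE)
  then have eq: "Q - {e} = Q' - {e'}" by blast
  have mem: "e \<in> Q" "e' \<in> Q'" using e by blast+
  have "e = {v. \<exists>!l. l \<in> Q - {e} \<and> v \<in> l}" by (rule pasch_line_unique[OF assms(1) mem(1)])
  also have "\<dots> = e'" unfolding eq by (rule pasch_line_unique[OF assms(2) mem(2), symmetric])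
  finally have "e = e'" .
  then show False using e by blast
qed

text \<open>No three lines are concurrent, so the six pairwise intersections give six different
  points, and the three of them on a line fill it.\<close>

lemma pasch_intro:
  assumes card3: "card k = 3" "card l = 3" "card p = 3" "card q = 3"
    and meet: "k \<inter> l \<noteq> {}" "k \<inter> p \<noteq> {}" "k \<inter> q \<noteq> {}" "l \<inter> p \<noteq> {}" "l \<inter> q \<noteq> {}" "p \<inter> q \<noteq> {}"
    and conc: "k \<inter> l \<inter> p = {}" "k \<inter> l \<inter> q = {}" "k \<inter> p \<inter> q = {}" "l \<inter> p \<inter> q = {}"
  shows "pasch {k, l, p, q}"
proof -
  obtain a b c d e f where v: "a \<in> k \<inter> l" "b \<in> k \<inter> p" "c \<in> k \<inter> q" "d \<in> l \<inter> p" "e \<in> l \<inter> q" "f \<in> p \<inter> q"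
    using meet by blast
  have dist: "distinct [a, b, c, d, e, f]" using v conc by auto
  have three: "s = {x, y, z}" if "card s = 3" "x \<in> s" "y \<in> s" "z \<in> s" "distinct [x, y, z]" for s :: "'a set" and x y z
  proof -
    have "finite s" using that(1) card_ge_0_finite by force
    then show ?thesis using that card_subset_eq[of s "{x, y, z}"] by auto
  qed
  have "k = {a, b, c}" "l = {a, d, e}" "p = {b, d, f}" "q = {c, e, f}"
    by (rule three; use card3 v dist in simp)+
  then show ?thesis unfolding pasch_def using dist by blast
qed

section \<open>Avoider's strategy\<close>

definition hall :: "'a set set \<Rightarrow> 'a set \<Rightarrow> bool" where
  "hall L W \<longleftrightarrow> (\<forall>F\<subseteq>L. 2 * card F \<le> card (\<Union>F \<inter> W))"

text \<open>The number of points is submodular in the family, so the union of two tight families is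
  tight and the largest tight family \<open>M\<close> contains all others. It has an even number of
  points, so some \<open>y\<close> lies outside. Removing \<open>y\<close> hurts only families
  through \<open>y\<close>; these are not tight and have a point to spare.\<close>

lemma hall_remove:
  assumes L: "finite L" and W: "finite W" "odd (card W)" and hall: "hall L W"
  shows "\<exists>y\<in>W. hall L (W - {y})"
proof -
  define tight where "tight F \<longleftrightarrow> F \<subseteq> L \<and> card (\<Union>F \<inter> W) = 2 * card F" for F
  have fin: "finite F" if "F \<subseteq> L" for F using that L finite_subset by blast
  have tight_Un: "tight (F \<union> M)" if F: "tight F" and M: "tight M" for F M
  proof -
    have s: "F \<subseteq> L" "M \<subseteq> L" using F M by (auto simp: tight_def)
    have "\<Union>(F \<union> M) \<inter> W = (\<Union>F \<inter> W) \<union> (\<Union>M \<inter> W)" by auto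
    then have "card (\<Union>(F \<union> M) \<inter> W) + card ((\<Union>F \<inter> W) \<inter> (\<Union>M \<inter> W)) = card (\<Union>F \<inter> W) + card (\<Union>M \<inter> W)"
      using W(1) by (metis card_Un_Int finite_Int)
    moreover have "card (\<Union>(F \<inter> M) \<inter> W) \<le> card ((\<Union>F \<inter> W) \<inter> (\<Union>M \<inter> W))"
      using W(1) by (intro card_mono) auto
    moreover have "2 * card (F \<inter> M) \<le> card (\<Union>(F \<inter> M) \<inter> W)" "2 * card (F \<union> M) \<le> card (\<Union>(F \<union> M) \<inter> W)"
      using hall[unfolded hall_def, rule_format, of "F \<inter> M"] hall[unfolded hall_def, rule_format, of "F \<union> M"] s
      by auto
    moreover have "card (F \<union> M) + card (F \<inter> M) = card F + card M"
      using card_Un_Int[of F M] fin s by simp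
    moreover have "card (\<Union>F \<inter> W) = 2 * card F" "card (\<Union>M \<inter> W) = 2 * card M"
      using F M by (simp_all add: tight_def)
    ultimately have "card (\<Union>(F \<union> M) \<inter> W) = 2 * card (F \<union> M)" by linarith
    with s show ?thesis by (simp add: tight_def)
  qed
  have "tight {}" by (simp add: tight_def)
  moreover have "\<forall>F. tight F \<longrightarrow> card F < Suc (card L)"
    using card_mono[OF L] by (simp add: tight_def less_Suc_eq_le)
  ultimately have "\<exists>M. tight M \<and> (\<forall>F. tight F \<longrightarrow> card F \<le> card M)"
    by (rule ex_has_greatest_nat)
  then obtain M where M: "tight M" "\<And>F. tight F \<Longrightarrow> card F \<le> card M" by blast
  have Msub: "M \<subseteq> L" using M(1) by (simp add: tight_def)
  have max: "F \<subseteq> M" if "tight F" for F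
  proof -
    have "card (F \<union> M) \<le> card M" using tight_Un[OF that M(1)] M(2) by blast
    moreover have "finite (F \<union> M)" using fin that Msub by (simp add: tight_def)
    ultimately have "M = F \<union> M" by (intro card_seteq) simp_all
    then show ?thesis by blast
  qed
  have "\<Union>M \<inter> W \<noteq> W"
  proof
    assume "\<Union>M \<inter> W = W"
    then have "card W = 2 * card M" using M(1) by (simp add: tight_def)
    then show False using W(2) by simp
  qed
  then obtain y where y: "y \<in> W" "y \<notin> \<Union>M" by blast
  have "2 * card F \<le> card (\<Union>F \<inter> (W - {y}))" if F: "F \<subseteq> L" for F
  proof (cases "y \<in> \<Union>F")
    case False
    then have "\<Union>F \<inter> (W - {y}) = \<Union>F \<inter> W" by blast
    then show ?thesis using hall F by (simp only: hall_def)
  next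
    case True
    then have "\<not> tight F" using max y by blast
    then have "card (\<Union>F \<inter> W) \<noteq> 2 * card F" using F by (simp add: tight_def)
    then have "2 * card F < card (\<Union>F \<inter> W)" using hall F unfolding hall_def by (simp add: le_neq_implies_less)
    moreover have "\<Union>F \<inter> (W - {y}) = (\<Union>F \<inter> W) - {y}" by blast
    moreover have "card ((\<Union>F \<inter> W) - {y}) = card (\<Union>F \<inter> W) - 1"
      using True y W(1) by (intro card_Diff_singleton) auto
    ultimately show ?thesis by simp
  qed
  then show ?thesis using y unfolding hall_def by blast
qed

section \<open>The invariant of Avoider's strategy\<close>

definition live :: "'a set set \<Rightarrow> 'a set \<Rightarrow> 'a set \<Rightarrow> 'a set set" where
  "live E A R = {e\<in>E. e \<subseteq> A \<union> R}"

definition pasch_packing :: "'a set set set \<Rightarrow> 'a set set \<Rightarrow> 'a set \<Rightarrow> bool" where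
  "pasch_packing PP L R \<longleftrightarrow> (\<forall>Q\<in>PP. pasch Q \<and> Q \<subseteq> L \<and> \<Union>Q \<subseteq> R) \<and>
     (\<forall>Q\<in>PP. \<forall>Q'\<in>PP. Q \<noteq> Q' \<longrightarrow> \<Union>Q \<inter> \<Union>Q' = {})"

text \<open>The packed configurations violate Hall's condition themselves. Their points are
  withdrawn from the remaining edges as well, so that the two parts of the board do not compete for
  points and can be answered separately.\<close>

definition avoider_invariant :: "'a set set \<Rightarrow> 'a set \<Rightarrow> 'a set \<Rightarrow> bool" where
  "avoider_invariant E A R \<longleftrightarrow> (\<exists>PP. pasch_packing PP (live E A R) R \<and>
     hall (live E A R - \<Union>PP) (R - \<Union>(\<Union>PP)))"

lemma pasch_packing_finite:
  assumes "pasch_packing PP L R" "finite L"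
  shows "finite PP"
  using assms finite_subset[of PP "Pow L"] by (auto simp: pasch_packing_def)

lemma pasch_packing_card:
  assumes "pasch_packing PP L R" "finite L"
  shows "card (\<Union>(\<Union>PP)) = 6 * card PP"
proof -
  have "\<Union>(\<Union>PP) = (\<Union>Q\<in>PP. \<Union>Q)" by auto
  also have "card \<dots> = (\<Sum>Q\<in>PP. card (\<Union>Q))"
    using assms pasch_packing_finite[OF assms] pasch_card(4)
    by (intro card_UN_disjoint) (auto simp: pasch_packing_def)
  also have "\<dots> = (\<Sum>Q\<in>PP. 6)"
    by (rule sum.cong) (use assms pasch_card(3) in \<open>auto simp: pasch_packing_def\<close>)
  also have "\<dots> = 6 * card PP" by simp
  finally show ?thesis .
qed

text \<open>Packed points come in sixes, so the board outside the packing has the parity of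
  \<open>R\<close>, and \<open>hall_remove\<close> finds a pick there that does not touch the
  packing.\<close>

lemma avoider_reply_outside:
  assumes "finite E" "finite R" "odd (card R)" "avoider_invariant E A R"
  shows "\<exists>y\<in>R. avoider_invariant E (insert y A) (R - {y})"
proof -
  let ?L = "live E A R"
  have L: "finite ?L" using assms(1) by (simp add: live_def)
  obtain PP where PP: "pasch_packing PP ?L R" and hall: "hall (?L - \<Union>PP) (R - \<Union>(\<Union>PP))"
    using assms(4) unfolding avoider_invariant_def by blast
  let ?U = "\<Union>(\<Union>PP)"
  have U: "?U \<subseteq> R" using PP by (auto simp: pasch_packing_def)
  have "card (R - ?U) = card R - 6 * card PP"
    using pasch_packing_card[OF PP L] U assms(2) by (metis card_Diff_subset finite_subset)
  moreover have "6 * card PP \<le> card R"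
    using pasch_packing_card[OF PP L] U assms(2) by (metis card_mono)
  ultimately have "odd (card (R - ?U))" using assms(3) by simp
  from hall_remove[OF _ _ this hall] obtain y where y: "y \<in> R - ?U" "hall (?L - \<Union>PP) (R - ?U - {y})"
    using L assms(2) by auto
  have "live E (insert y A) (R - {y}) = ?L" using y by (auto simp: live_def)
  moreover have "R - {y} - ?U = R - ?U - {y}" by blast
  moreover have "pasch_packing PP ?L (R - {y})" using PP y by (auto simp: pasch_packing_def)
  ultimately have "avoider_invariant E (insert y A) (R - {y})"
    unfolding avoider_invariant_def using y(2) by auto
  then show ?thesis using y by blast
qed

lemma subset_pair_cases: "K \<subseteq> {g, h} \<Longrightarrow> K = {} \<or> K = {g} \<or> K = {h} \<or> K = {g, h}"
  by auto

lemma live_Diff: "x \<in> R \<Longrightarrow> A \<inter> R = {} \<Longrightarrow> live E A (R - {x}) = {e \<in> live E A R. x \<notin> e}"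
  by (auto simp: live_def)

lemma live_insert: "y \<in> R \<Longrightarrow> live E (insert y A) (R - {y}) = live E A R"
  by (auto simp: live_def)

text \<open>A pick of Enforcer off the packing only deletes edges: the surviving ones avoid
  \<open>x\<close> and lose no point.\<close>

lemma avoider_invariant_after_outside:
  assumes PP: "pasch_packing PP (live E A R) R"
    and hall: "hall (live E A R - \<Union>PP) (R - \<Union>(\<Union>PP))"
    and x: "x \<in> R" "x \<notin> \<Union>(\<Union>PP)" and AR: "A \<inter> R = {}"
  shows "avoider_invariant E A (R - {x})"
proof -
  let ?L = "{e \<in> live E A R. x \<notin> e}"
  have "pasch_packing PP ?L (R - {x})"
  proof -
    have "Q \<subseteq> ?L" "\<Union>Q \<subseteq> R - {x}" if Q: "Q \<in> PP" for Q
    proof -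
      have "Q \<subseteq> live E A R" "\<Union>Q \<subseteq> R" using PP Q by (simp_all add: pasch_packing_def)
      moreover have "x \<notin> \<Union>Q" using x(2) Q by blast
      ultimately show "Q \<subseteq> ?L" "\<Union>Q \<subseteq> R - {x}" by blast+
    qed
    then show ?thesis using PP by (simp add: pasch_packing_def)
  qed
  moreover have "hall (?L - \<Union>PP) (R - {x} - \<Union>(\<Union>PP))"
    unfolding hall_def
  proof (intro allI impI)
    fix F assume F: "F \<subseteq> ?L - \<Union>PP"
    then have "\<Union>F \<inter> (R - {x} - \<Union>(\<Union>PP)) = \<Union>F \<inter> (R - \<Union>(\<Union>PP))" by blast
    moreover have "F \<subseteq> live E A R - \<Union>PP" using F by blast
    ultimately show "2 * card F \<le> card (\<Union>F \<inter> (R - {x} - \<Union>(\<Union>PP)))"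
      using hall unfolding hall_def by simp
  qed
  ultimately show ?thesis
    unfolding avoider_invariant_def live_Diff[OF x(1) AR] by (intro exI[of _ PP] conjI)
qed

text \<open>Against a move inside a packed Pasch configuration Avoider takes the opposite point; the two
  lines through it are left with two private points each.\<close>

lemma avoider_invariant_after_inside:
  assumes fin: "finite E" "finite R" and PP: "pasch_packing PP (live E A R) R"
    and hall: "hall (live E A R - \<Union>PP) (R - \<Union>(\<Union>PP))"
    and Q: "Q \<in> PP" "x \<in> \<Union>Q" and AR: "A \<inter> R = {}"
  shows "\<exists>z\<in>R - {x}. avoider_invariant E (insert z A) (R - {x} - {z})"
proof -
  let ?L = "live E A R" let ?PP = "PP - {Q}"
  let ?W = "R - \<Union>(\<Union>PP)"
  have Q': "pasch Q" "Q \<subseteq> ?L" "\<Union>Q \<subseteq> R" using PP Q(1) by (simp_all add: pasch_packing_def)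
  have disj: "\<Union>Q \<inter> \<Union>Q' = {}" if "Q' \<in> ?PP" for Q' using PP Q that unfolding pasch_packing_def by blast
  obtain z g h where z: "z \<in> \<Union>Q" "z \<noteq> x" and gh: "{l\<in>Q. x \<notin> l} = {g, h}" "g \<noteq> h" "g \<inter> h \<subseteq> {z}"
    "card (g - {z}) = 2" "card (h - {z}) = 2"
    using pasch_opposite[OF Q'(1) Q(2)] by metis
  have xR: "x \<in> R" using Q Q' by blast
  have zR: "z \<in> R - {x}" using z Q' by blast
  have "g \<in> {l\<in>Q. x \<notin> l}" "h \<in> {l\<in>Q. x \<notin> l}" unfolding gh(1) by simp_all
  then have gQ: "g \<in> Q" "h \<in> Q" "x \<notin> g" "x \<notin> h" by simp_all
  let ?L' = "{e \<in> ?L. x \<notin> e}" let ?W' = "R - {x} - {z} - \<Union>(\<Union>?PP)"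
  have live: "live E (insert z A) (R - {x} - {z}) = ?L'"
    using live_insert[OF zR] live_Diff[OF xR AR] by simp
  have pack: "pasch_packing ?PP ?L' (R - {x} - {z})"
  proof -
    have "pasch Q' \<and> Q' \<subseteq> ?L' \<and> \<Union>Q' \<subseteq> R - {x} - {z}" if "Q' \<in> ?PP" for Q'
    proof (intro conjI)
      have xz: "x \<notin> \<Union>Q'" "z \<notin> \<Union>Q'" using disj[OF that] Q(2) z(1) by blast+
      have Q': "pasch Q'" "Q' \<subseteq> ?L" "\<Union>Q' \<subseteq> R" using PP that by (simp_all add: pasch_packing_def)
      show "pasch Q'" by (rule Q')
      show "Q' \<subseteq> ?L'" using Q'(2) xz(1) by blast
      show "\<Union>Q' \<subseteq> R - {x} - {z}" using Q'(3) xz by blast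
    qed
    moreover have "\<forall>Q\<in>?PP. \<forall>Q'\<in>?PP. Q \<noteq> Q' \<longrightarrow> \<Union>Q \<inter> \<Union>Q' = {}"
      using PP by (simp add: pasch_packing_def)

    ultimately show ?thesis unfolding pasch_packing_def by simp
  qed
  have "hall (?L' - \<Union>?PP) ?W'"
    unfolding hall_def
  proof (intro allI impI)
    fix F assume F: "F \<subseteq> ?L' - \<Union>?PP"
    \<comment> \<open>\<open>F\<close> splits into edges outside the old packing, paid for by points
      off that packing, and survivors among \<open>g\<close> and \<open>h\<close>, paid for by
      points of \<open>Q\<close>. These two supplies are disjoint.\<close>
    define G where "G = F - \<Union>PP"
    define K where "K = F \<inter> \<Union>PP"
    have Kgh: "K \<subseteq> {g, h}"
    proof
      fix k assume "k \<in> K"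
      then have "k \<in> F" "k \<in> \<Union>PP" by (simp_all add: K_def)
      then have "k \<in> {l\<in>Q. x \<notin> l}" using F by blast
      then show "k \<in> {g, h}" by (simp only: gh(1))
    qed
    have "F \<subseteq> E" using F by (auto simp: live_def)
    then have finF: "finite F" using fin(1) finite_subset by blast
    have cardF: "card F = card G + card K"
    proof -
      have "F = G \<union> K" "G \<inter> K = {}" unfolding G_def K_def by blast+
      then show ?thesis using finF card_Un_disjoint[of G K] by simp
    qed
    have G: "2 * card G \<le> card (\<Union>G \<inter> ?W)"
    proof -
      have "G \<subseteq> ?L - \<Union>PP" using F unfolding G_def by blast
      then show ?thesis using hall unfolding hall_def by blast
    qed
    have K: "2 * card K \<le> card (\<Union>K - {z})"
    proof -
      have fgh: "finite (g - {z})" "finite (h - {z})" by (rule card_ge_0_finite, simp add: gh)+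
      have "(g - {z}) \<inter> (h - {z}) = {}" using gh(3) by blast
      from card_Un_disjoint[OF fgh this] have "card ((g - {z}) \<union> (h - {z})) = 4" using gh by simp
      moreover have "(g - {z}) \<union> (h - {z}) = g \<union> h - {z}" by blast
      ultimately have gh4: "card (g \<union> h - {z}) = 4" by simp
      have "K = {} \<or> K = {g} \<or> K = {h} \<or> K = {g, h}"
        using Kgh by (rule subset_pair_cases)
      then consider "K = {}" | "K = {g}" | "K = {h}" | "K = {g, h}" by (elim disjE)
      then show ?thesis by cases (use gh gh4 in simp_all)
    qed
    have KQ: "\<Union>K \<subseteq> \<Union>Q - {x}"
    proof
      fix v assume "v \<in> \<Union>K"
      then obtain k where "k \<in> K" "v \<in> k" by blast
      moreover from this have "k = g \<or> k = h" using Kgh by blast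
      ultimately show "v \<in> \<Union>Q - {x}" using gQ by blast
    qed
    have "(\<Union>G \<inter> ?W) \<union> (\<Union>K - {z}) \<subseteq> \<Union>F \<inter> ?W'"
    proof (intro Un_least subsetI)
      fix v assume v: "v \<in> \<Union>G \<inter> ?W"
      then have "v \<noteq> x" "v \<noteq> z" using Q z by blast+
      moreover have "v \<in> \<Union>F" using v unfolding G_def by blast
      moreover have "v \<in> R" "v \<notin> \<Union>(\<Union>?PP)" using v by blast+
      ultimately show "v \<in> \<Union>F \<inter> ?W'" by simp
    next
      fix v assume v: "v \<in> \<Union>K - {z}"
      then have vQ: "v \<in> \<Union>Q" "v \<noteq> x" "v \<noteq> z" using KQ by auto
      have "v \<notin> \<Union>Q'" if "Q' \<in> ?PP" for Q' using disj[OF that] vQ(1) by blast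
      then have "v \<notin> \<Union>(\<Union>?PP)" by blast
      moreover have "v \<in> \<Union>F" using v unfolding K_def by blast
      moreover have "v \<in> R" using vQ(1) Q'(3) by blast
      ultimately show "v \<in> \<Union>F \<inter> ?W'" using vQ by simp
    qed
    then have "card ((\<Union>G \<inter> ?W) \<union> (\<Union>K - {z})) \<le> card (\<Union>F \<inter> ?W')"
      using fin(2) by (intro card_mono) auto
    moreover have "card ((\<Union>G \<inter> ?W) \<union> (\<Union>K - {z})) = card (\<Union>G \<inter> ?W) + card (\<Union>K - {z})"
    proof (rule card_Un_disjoint)
      show "finite (\<Union>G \<inter> ?W)" using fin(2) by simp
      have "\<Union>K - {z} \<subseteq> R" using KQ Q'(3) by blast
      then show "finite (\<Union>K - {z})" using fin(2) finite_subset by blast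
      show "(\<Union>G \<inter> ?W) \<inter> (\<Union>K - {z}) = {}" using KQ Q(1) by blast
    qed
    ultimately show "2 * card F \<le> card (\<Union>F \<inter> ?W')" using G K cardF by linarith
  qed
  with pack have "avoider_invariant E (insert z A) (R - {x} - {z})"
    unfolding avoider_invariant_def live by (intro exI[of _ ?PP] conjI)
  then show ?thesis using zR by (rule rev_bexI[rotated])
qed

text \<open>The induction is strong because Enforcer's move is taken together with Avoider's reply,
  which depends on whether the move was inside the packing. The parity of \<open>k\<close> decides
  who is to move; this is where Avoider being last enters.\<close>

lemma avoider_invariant_wins:
  assumes "finite E" "finite R" "A \<inter> R = {}" "avoider_invariant E A R" "k = card R"
  shows "avoider_wins E k (if even k then Enforcer else Avoider) A R"
  using assms
proof (induction k arbitrary: A R rule: less_induct)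
  case (less k)
  show ?case
  proof (cases k)
    case 0
    then have R: "R = {}" using less.prems by simp
    have "\<not> e \<subseteq> A" if "e \<in> E" for e
    proof
      assume e: "e \<subseteq> A"
      obtain PP where PP: "pasch_packing PP (live E A R) R" and hall: "hall (live E A R - \<Union>PP) (R - \<Union>(\<Union>PP))"
        using less.prems(4) unfolding avoider_invariant_def by blast
      \<comment> \<open>A packed configuration has six unpicked points, so none is left when
        \<open>R\<close> is empty. A completed edge would now be a family of one edge without free
        points.\<close>
      have "PP = {}"
      proof (rule ccontr)
        assume "PP \<noteq> {}"
        then obtain Q where "Q \<in> PP" by blast
        then have Q: "pasch Q" "\<Union>Q = {}" using PP R unfolding pasch_packing_def by blast+
        show False using pasch_card(3)[OF Q(1)] unfolding Q(2) by simp
      qed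
      then have "{e} \<subseteq> live E A R - \<Union>PP" using that e by (auto simp: live_def)
      then have "2 * card {e} \<le> card (\<Union>{e} \<inter> (R - \<Union>(\<Union>PP)))" using hall unfolding hall_def by blast
      then show False using R by simp
    qed
    then show ?thesis using 0 by simp
  next
    case (Suc l)
    have rep: "avoider_wins E l Avoider A R'"
      if "odd l" "R' \<subseteq> R" "card R' = l" "y \<in> R'" "avoider_invariant E (insert y A) (R' - {y})" for R' y
    proof -
      have R': "finite R'" "A \<inter> R' = {}" using that less.prems finite_subset by blast+
      have "l \<noteq> 0" using that(1) by (auto intro: odd_pos)
      then obtain i where i: "l = Suc i" using not0_implies_Suc by blast
      have "avoider_wins E i (if even i then Enforcer else Avoider) (insert y A) (R' - {y})"
        by (rule less.IH) (use less.prems R' that i Suc in auto)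
      then show ?thesis using that i by auto
    qed
    show ?thesis
    proof (cases "even k")
      case False
      then have "odd (card R)" using less.prems by simp
      from avoider_reply_outside[OF less.prems(1,2) this less.prems(4)]
      obtain y where y: "y \<in> R" "avoider_invariant E (insert y A) (R - {y})" by blast
      have "avoider_wins E l (if even l then Enforcer else Avoider) (insert y A) (R - {y})"
        by (rule less.IH) (use less.prems y Suc in auto)
      then show ?thesis using False Suc y(1) by auto
    next
      case True
      have "avoider_wins E l Avoider A (R - {x})" if x: "x \<in> R" for x
      proof -
        have "card (R - {x}) = l" using less.prems(2,5) x Suc by simp
        moreover have "odd l" using True Suc by simp
        ultimately have l: "card (R - {x}) = l" "odd l" by blast+
        obtain PP where PP: "pasch_packing PP (live E A R) R" and hall: "hall (live E A R - \<Union>PP) (R - \<Union>(\<Union>PP))"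
          using less.prems(4) unfolding avoider_invariant_def by blast
        have "\<exists>y\<in>R - {x}. avoider_invariant E (insert y A) (R - {x} - {y})"
        proof (cases "x \<in> \<Union>(\<Union>PP)")
          case True
          then obtain Q where "Q \<in> PP" "x \<in> \<Union>Q" by blast
          from avoider_invariant_after_inside[OF less.prems(1,2) PP hall this less.prems(3)]
          show ?thesis .
        next
          case False
          have "avoider_invariant E A (R - {x})"
            by (rule avoider_invariant_after_outside[OF PP hall x False less.prems(3)])
          then show ?thesis
            by (rule avoider_reply_outside[rotated -1]) (use less.prems(1,2) l in simp_all)
        qed
        then show ?thesis using rep[OF l(2) _ l(1)] by blast
      qed
      then show ?thesis using True Suc by simp
    qed
  qed
qed

section \<open>Enforcer's strategy\<close>

text \<open>The second alternative is a minimal family of excess 1, stated without subtraction.\<close>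

definition threat :: "'a set set \<Rightarrow> 'a set \<Rightarrow> 'a set \<Rightarrow> bool" where
  "threat E A R \<longleftrightarrow> (\<exists>e\<in>E. e \<subseteq> A) \<or> (\<exists>F\<subseteq>live E A R. card (\<Union>F \<inter> R) + 1 = 2 * card F \<and>
     (\<forall>G. G \<subset> F \<longrightarrow> 2 * card G \<le> card (\<Union>G \<inter> R)))"

text \<open>Sending each free point of \<open>e\<close> to another edge through it is injective,
  since by linearity that edge shares only one point with \<open>e\<close>.\<close>

lemma card_meeting_edges:
  assumes lin: "linear_family F" and e: "e \<in> F" and fin: "finite F"
    and two: "\<And>v. v \<in> e \<inter> R \<Longrightarrow> \<exists>f\<in>F - {e}. v \<in> f"
  shows "card (e \<inter> R) \<le> card {f \<in> F - {e}. e \<inter> f \<noteq> {}}"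
proof -
  obtain g where g: "\<And>v. v \<in> e \<inter> R \<Longrightarrow> g v \<in> F - {e} \<and> v \<in> g v" using two by metis
  have "inj_on g (e \<inter> R)"
  proof (rule inj_onI, rule ccontr)
    fix v w assume v: "v \<in> e \<inter> R" and w: "w \<in> e \<inter> R" and eq: "g v = g w" and neq: "v \<noteq> w"
    have "e = g v"
      by (rule linear_family_eq[OF lin, of _ _ v w]) (use g[OF v] g[OF w] e v w eq neq in auto)
    then show False using g[OF v] by simp
  qed
  moreover have "g ` (e \<inter> R) \<subseteq> {f \<in> F - {e}. e \<inter> f \<noteq> {}}" using g by blast
  ultimately show ?thesis using fin by (auto intro: card_inj_on_le)
qed

lemma double_count:
  assumes "finite F" "finite R"
  shows "(\<Sum>v\<in>\<Union>F \<inter> R. card {e\<in>F. v \<in> e}) = (\<Sum>e\<in>F. card (e \<inter> R))"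
proof -
  have "(\<Sum>v\<in>\<Union>F \<inter> R. card {e\<in>F. v \<in> e}) = (\<Sum>v\<in>\<Union>F \<inter> R. \<Sum>e\<in>F. if v \<in> e then 1 else 0)"
    using assms(1) by (intro sum.cong refl) (simp add: sum.If_cases Int_def)
  also have "\<dots> = (\<Sum>e\<in>F. \<Sum>v\<in>\<Union>F \<inter> R. if v \<in> e then 1 else 0)" by (rule sum.swap)
  also have "\<dots> = (\<Sum>e\<in>F. card (e \<inter> R))"
  proof (rule sum.cong[OF refl])
    fix e assume "e \<in> F"
    then have "{v \<in> \<Union>F \<inter> R. v \<in> e} = e \<inter> R" by blast
    then show "(\<Sum>v\<in>\<Union>F \<inter> R. if v \<in> e then 1 else 0) = card (e \<inter> R)"
      using assms(2) by (simp add: sum.If_cases Int_def conj_commute)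
  qed
  finally show ?thesis .
qed

text \<open>By minimality each point lies on two edges, so that linearity bounds the number of points of an edge by
  \<open>card F - 1\<close>. Double counting then leaves only \<open>card F = 4\<close>, with equality everywhere.\<close>

lemma excess_two:
  assumes lin: "linear_family F" and fin: "finite F" "finite R"
    and two: "card (\<Union>F \<inter> R) + 2 = 2 * card F"
    and min: "\<And>G. G \<subset> F \<Longrightarrow> 2 * card G \<le> card (\<Union>G \<inter> R)"
    and nonempty: "\<And>e. e \<in> F \<Longrightarrow> e \<inter> R \<noteq> {}"
  shows "pasch F \<and> \<Union>F \<subseteq> R"
proof -
  have covered: "\<exists>f\<in>F - {e}. v \<in> f" if "e \<in> F" "v \<in> e \<inter> R" for e v
  proof -
    \<comment> \<open>Dropping \<open>e\<close> lowers \<open>2 * card F\<close> by 2, which is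
      exactly the excess, so by minimality no point may disappear with it.\<close>
    have "2 * card (F - {e}) \<le> card (\<Union>(F - {e}) \<inter> R)" by (rule min) (use that in blast)
    then have "card (\<Union>F \<inter> R) \<le> card (\<Union>(F - {e}) \<inter> R)" using two fin that by simp
    moreover have "\<Union>(F - {e}) \<inter> R \<subseteq> \<Union>F \<inter> R" by blast
    ultimately have "\<Union>(F - {e}) \<inter> R = \<Union>F \<inter> R" using fin(2) by (intro card_seteq) auto
    then show ?thesis using that by blast
  qed
  have meeting: "card (e \<inter> R) \<le> card {f \<in> F - {e}. e \<inter> f \<noteq> {}}" if "e \<in> F" for e
    by (rule card_meeting_edges[OF lin that fin(1)]) (use covered that in blast)
  have meeting_le: "card {f \<in> F - {e}. e \<inter> f \<noteq> {}} \<le> card F - 1" if "e \<in> F" for e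
    using card_mono[of "F - {e}" "{f \<in> F - {e}. e \<inter> f \<noteq> {}}"] fin(1) that by auto
  have le3: "card (e \<inter> R) \<le> 3" if "e \<in> F" for e
  proof -
    have "card (e \<inter> R) \<le> card e" using lin that by (intro card_mono) (auto simp: linear_family_def)
    then show ?thesis using lin that unfolding linear_family_def by (meson order_trans)
  qed
  have deg: "2 \<le> card {e\<in>F. v \<in> e}" if v: "v \<in> \<Union>F \<inter> R" for v
  proof -
    obtain e where e: "e \<in> F" "v \<in> e" using v by blast
    then obtain f where f: "f \<in> F - {e}" "v \<in> f" using covered v by blast
    have "card {e, f} \<le> card {e\<in>F. v \<in> e}" using fin(1) e f by (intro card_mono) auto
    moreover have "e \<noteq> f" using f by blast
    ultimately show ?thesis by simp
  qed
  note dc = double_count[OF fin]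
  have "(\<Sum>v\<in>\<Union>F \<inter> R. 2) \<le> (\<Sum>v\<in>\<Union>F \<inter> R. card {e\<in>F. v \<in> e})" by (rule sum_mono) (rule deg)
  then have lower: "2 * (2 * card F - 2) \<le> (\<Sum>e\<in>F. card (e \<inter> R))" using two dc by simp
  have "(\<Sum>e\<in>F. card (e \<inter> R)) \<le> (\<Sum>e\<in>F. 3)" by (rule sum_mono) (rule le3)
  then have upper: "(\<Sum>e\<in>F. card (e \<inter> R)) \<le> 3 * card F" by simp
  have "(\<Sum>e\<in>F. card (e \<inter> R)) \<le> (\<Sum>e\<in>F. card F - 1)"
    by (rule sum_mono) (use meeting meeting_le le_trans in blast)
  then have upper2: "(\<Sum>e\<in>F. card (e \<inter> R)) \<le> card F * (card F - 1)" by simp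
  \<comment> \<open>\<open>4 * card F - 4 \<le> 3 * card F\<close> allows at most four edges, and
    the bound \<open>card F * (card F - 1)\<close> excludes two and three. The counts do not exclude
    a single edge: it would have no point in \<open>R\<close>, against
    \<open>nonempty\<close>.\<close>
  have card4: "card F = 4"
  proof -
    have "card F \<noteq> 0" using two by linarith
    moreover have "card F \<le> 4" using lower upper by linarith
    moreover have "card F \<noteq> 1"
    proof
      assume "card F = 1"
      then obtain e where "F = {e}" using card_1_singletonE by blast
      then show False using two nonempty[of e] fin(2) by simp
    qed
    moreover have "card F \<noteq> 2" using lower upper2 by auto
    moreover have "card F \<noteq> 3" using lower upper2 by auto
    ultimately show ?thesis by linarith
  qed
  have size3: "card (e \<inter> R) = 3" if "e \<in> F" for e
  proof (rule ccontr)
    assume "card (e \<inter> R) \<noteq> 3"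
    then have "card (e \<inter> R) < 3" using le3[OF that] by simp
    then have "(\<Sum>e\<in>F. card (e \<inter> R)) < (\<Sum>e\<in>F. 3)"
      by (intro sum_strict_mono_ex1) (use fin le3 that in auto)
    then show False using lower card4 by simp
  qed
  have inR: "e \<subseteq> R" "card e = 3" if "e \<in> F" for e
  proof -
    have "finite e" "card e \<le> 3" using lin that by (auto simp: linear_family_def)
    then have "e \<inter> R = e" by (intro card_seteq) (use size3[OF that] in auto)
    then show "e \<subseteq> R" "card e = 3" using size3[OF that] by auto
  qed
  have deg2: "card {e\<in>F. v \<in> e} = 2" if "v \<in> \<Union>F \<inter> R" for v
  proof (rule ccontr)
    assume "card {e\<in>F. v \<in> e} \<noteq> 2"
    then have "2 < card {e\<in>F. v \<in> e}" using deg[OF that] by simp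
    then have "(\<Sum>v\<in>\<Union>F \<inter> R. 2) < (\<Sum>v\<in>\<Union>F \<inter> R. card {e\<in>F. v \<in> e})"
      by (intro sum_strict_mono_ex1) (use fin deg that in auto)
    then show False using upper card4 dc two by simp
  qed
  have meet: "e \<inter> f \<noteq> {}" if "e \<in> F" "f \<in> F" "e \<noteq> f" for e f
  proof -
    have "3 \<le> card {f \<in> F - {e}. e \<inter> f \<noteq> {}}" using meeting[OF that(1)] size3[OF that(1)] by simp
    then have "{f \<in> F - {e}. e \<inter> f \<noteq> {}} = F - {e}"
      using card4 fin(1) that(1) by (intro card_seteq) auto
    then show ?thesis using that by blast
  qed
  have conc: "e \<inter> f \<inter> g = {}" if "e \<in> F" "f \<in> F" "g \<in> F" "distinct [e, f, g]" for e f g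
  proof (rule ccontr)
    assume "e \<inter> f \<inter> g \<noteq> {}"
    then obtain v where v: "v \<in> e" "v \<in> f" "v \<in> g" by blast
    then have "card {e, f, g} \<le> card {e\<in>F. v \<in> e}" using fin(1) that by (intro card_mono) auto
    moreover have "v \<in> \<Union>F \<inter> R" using v that inR by blast
    ultimately show False using deg2 that(4) by auto
  qed
  obtain k l p q where F: "F = {k, l, p, q}" "distinct [k, l, p, q]"
  proof -
    obtain xs where "set xs = F" "distinct xs" using finite_distinct_list[OF fin(1)] by blast
    moreover from this have "length xs = 4" using distinct_card card4 by metis
    ultimately show ?thesis using that by (auto simp: numeral_eq_Suc length_Suc_conv)
  qed
  have mem: "k \<in> F" "l \<in> F" "p \<in> F" "q \<in> F" using F(1) by blast+
  have "pasch {k, l, p, q}"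
    by (rule pasch_intro) (use F(2) inR(2)[OF mem(1)] inR(2)[OF mem(2)] inR(2)[OF mem(3)] inR(2)[OF mem(4)]
      meet mem conc in \<open>simp_all add: F(1)[symmetric]\<close>)
  then show ?thesis using F(1) inR by blast
qed

text \<open>A pick \<open>y\<close> on a point of \<open>F\<close> raises the excess of
  \<open>F\<close> to 2 and that of a proper subfamily to at most 1. If some proper subfamily
  reaches 1, then a smallest such one is the new threat. Otherwise \<open>F\<close> is minimal with
  excess 2. It cannot be a Pasch configuration of unpicked points because \<open>y\<close> is one of
  its points, so by \<open>excess_two\<close> some edge has no unpicked point left and belongs to
  Avoider.\<close>

lemma threat_after_avoider:
  assumes E: "finite E" "linear_family E" and R: "finite R" "y \<in> R" and t: "threat E A R"
  shows "threat E (insert y A) (R - {y})"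
proof (cases "\<exists>e\<in>E. e \<subseteq> A")
  case True
  then show ?thesis unfolding threat_def by blast
next
  case False
  then obtain F where F: "F \<subseteq> live E A R" "card (\<Union>F \<inter> R) + 1 = 2 * card F"
    and min: "\<And>G. G \<subset> F \<Longrightarrow> 2 * card G \<le> card (\<Union>G \<inter> R)"
    using t unfolding threat_def by blast
  have FE: "F \<subseteq> E" using F(1) by (auto simp: live_def)
  have finF: "finite F" using FE E(1) finite_subset by blast
  let ?R = "R - {y}"
  have diff: "\<Union>G \<inter> ?R = (\<Union>G \<inter> R) - {y}" for G by blast
  have card_le: "card (\<Union>G \<inter> R) \<le> card (\<Union>G \<inter> ?R) + 1" for G
    unfolding diff using card_Diff1_le[of "\<Union>G \<inter> R" y] R(1) by (cases "y \<in> \<Union>G \<inter> R") auto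
  show ?thesis
  proof (cases "y \<in> \<Union>F")
    case False
    have "\<Union>G \<inter> ?R = \<Union>G \<inter> R" if "G \<subseteq> F" for G using that False by blast
    then show ?thesis
      unfolding threat_def live_insert[OF R(2)] using F min by (intro disjI2 exI[of _ F]) auto
  next
    case True
    then have "card (\<Union>F \<inter> ?R) = card (\<Union>F \<inter> R) - 1" "0 < card (\<Union>F \<inter> R)"
      unfolding diff using R by (auto simp: card_gt_0_iff)
    then have two: "card (\<Union>F \<inter> ?R) + 2 = 2 * card F" using F(2) by linarith
    define P where "P G \<longleftrightarrow> G \<subset> F \<and> card (\<Union>G \<inter> ?R) + 1 = 2 * card G" for G
    have min': "2 * card G \<le> card (\<Union>G \<inter> ?R)" if "G \<subset> F" "\<not> P G" for G
      using min[OF that(1)] card_le[of G] that unfolding P_def by linarith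
    show ?thesis
    proof (cases "\<exists>G. P G")
      case True
      then obtain G0 where "P G0" by blast
      from ex_has_least_nat[of P G0 card, OF this]
      obtain G where G: "P G" "\<And>H. P H \<Longrightarrow> card G \<le> card H" by blast
      have GF: "G \<subset> F" using G(1) by (simp add: P_def)
      have "2 * card H \<le> card (\<Union>H \<inter> ?R)" if H: "H \<subset> G" for H
      proof (rule min')
        show "H \<subset> F" using H GF by (rule psubset_trans)
        have "finite G" using finF GF by (meson finite_subset psubset_imp_subset)
        then have "card H < card G" using H by (rule psubset_card_mono)
        then show "\<not> P H" using G(2)[of H] by linarith
      qed
      moreover have "G \<subseteq> live E A R" using GF F(1) by (meson psubset_imp_subset subset_trans)
      ultimately show ?thesis
        unfolding threat_def live_insert[OF R(2)] using G(1) unfolding P_def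
        by (intro disjI2 exI[of _ G]) simp
    next
      case noP: False
      have "\<exists>e\<in>F. e \<inter> ?R = {}"
      proof (rule ccontr)
        assume "\<not> (\<exists>e\<in>F. e \<inter> ?R = {})"
        then have "pasch F \<and> \<Union>F \<subseteq> ?R"
          by (intro excess_two[OF linear_family_subset[OF E(2) FE] finF _ two])
            (use R(1) min' noP in auto)
        then show False using True by blast
      qed
      then obtain e where e: "e \<in> F" "e \<inter> ?R = {}" by blast
      have "e \<in> live E A R" using e(1) F(1) by blast
      then have "e \<in> E" "e \<subseteq> A \<union> R" by (simp_all add: live_def)
      moreover from this have "e \<subseteq> insert y A" using e(2) by blast
      ultimately show ?thesis unfolding threat_def by blast
    qed
  qed
qed

text \<open>Excess 1 makes the number of free points of \<open>F\<close> odd, so with an even number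
  of vertices left one of them is off \<open>F\<close>. Enforcer spends his move there and keeps all
  edges of \<open>F\<close> alive.\<close>

lemma threat_after_enforcer:
  assumes R: "finite R" "even (card R)" "R \<noteq> {}" and t: "threat E A R"
  shows "\<exists>x\<in>R. threat E A (R - {x})"
proof (cases "\<exists>e\<in>E. e \<subseteq> A")
  case True
  then show ?thesis using R(3) unfolding threat_def by blast
next
  case False
  then obtain F where F: "F \<subseteq> live E A R" "card (\<Union>F \<inter> R) + 1 = 2 * card F"
    and min: "\<And>G. G \<subset> F \<Longrightarrow> 2 * card G \<le> card (\<Union>G \<inter> R)"
    using t unfolding threat_def by blast
  have "odd (card (\<Union>F \<inter> R))" using F(2) by presburger
  then have "\<Union>F \<inter> R \<noteq> R" using R(2) by auto
  then obtain x where x: "x \<in> R" "x \<notin> \<Union>F" by blast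
  have eq: "\<Union>G \<inter> (R - {x}) = \<Union>G \<inter> R" if "G \<subseteq> F" for G using that x(2) by blast
  have "F \<subseteq> live E A (R - {x})"
  proof
    fix e assume e: "e \<in> F"
    then have "e \<in> live E A R" "x \<notin> e" using F(1) x(2) by blast+
    then show "e \<in> live E A (R - {x})" by (auto simp: live_def)
  qed
  then have "threat E A (R - {x})"
    unfolding threat_def using F(2) min eq by (intro disjI2 exI[of _ F]) auto
  then show ?thesis using x(1) by blast
qed

lemma threat_avoider_loses:
  assumes "finite E" "linear_family E" "finite R" "threat E A R" "k = card R"
  shows "\<not> avoider_wins E k (if even k then Enforcer else Avoider) A R"
  using assms
proof (induction k arbitrary: A R)
  case 0
  then have "R = {}" by simp
  then have "\<exists>e\<in>E. e \<subseteq> A" using 0(4) unfolding threat_def by auto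
  then show ?case by simp
next
  case (Suc k)
  have card: "card (R - {x}) = k" if "x \<in> R" for x using Suc.prems that by simp
  show ?case
  proof (cases "even (Suc k)")
    case True
    have "R \<noteq> {}" using Suc.prems by auto
    then obtain x where x: "x \<in> R" "threat E A (R - {x})"
      using threat_after_enforcer[of R E A] Suc.prems True by auto
    have "\<not> avoider_wins E k (if even k then Enforcer else Avoider) A (R - {x})"
      by (rule Suc.IH) (use Suc.prems x card in simp_all)
    then show ?thesis using True x(1) by auto
  next
    case False
    have "\<not> avoider_wins E k (if even k then Enforcer else Avoider) (insert y A) (R - {y})" if y: "y \<in> R" for y
      by (rule Suc.IH) (use Suc.prems y card threat_after_avoider in simp_all)
    then show ?thesis using False by auto
  qed
qed

section \<open>Families with positive excess\<close>

definition minimal_positive :: "'a set set \<Rightarrow> bool" where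
  "minimal_positive F \<longleftrightarrow> card (\<Union>F) < 2 * card F \<and> (\<forall>G. G \<subset> F \<longrightarrow> 2 * card G \<le> card (\<Union>G))"

definition only_pasch :: "'a set set \<Rightarrow> bool" where
  "only_pasch E \<longleftrightarrow> (\<forall>F\<subseteq>E. minimal_positive F \<longrightarrow> pasch F)"

lemma only_pasch_subset: "only_pasch E \<Longrightarrow> K \<subseteq> E \<Longrightarrow> only_pasch K"
  unfolding only_pasch_def by (meson subset_trans)

lemma minimal_positive_exists:
  assumes "finite F" "card (\<Union>F) < 2 * card F"
  shows "\<exists>T\<subseteq>F. minimal_positive T"
proof -
  define P where "P G \<longleftrightarrow> G \<subseteq> F \<and> card (\<Union>G) < 2 * card G" for G
  have "P F" using assms by (simp add: P_def)
  from ex_has_least_nat[of P F card, OF this]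
  obtain T where T: "P T" "\<And>H. P H \<Longrightarrow> card T \<le> card H" by blast
  have TF: "T \<subseteq> F" using T(1) by (simp add: P_def)
  have "2 * card G \<le> card (\<Union>G)" if G: "G \<subset> T" for G
  proof -
    have "finite T" using TF assms(1) by (rule finite_subset)
    then have "card G < card T" using G by (rule psubset_card_mono)
    then have "\<not> P G" using T(2)[of G] by linarith
    moreover have "G \<subseteq> F" using G TF by (meson psubset_imp_subset subset_trans)
    ultimately show ?thesis unfolding P_def by linarith
  qed
  then have "minimal_positive T" using T(1) by (simp add: minimal_positive_def P_def)
  then show ?thesis using TF by blast
qed

text \<open>A minimal family of positive excess has excess 1 or 2. The first is a threat by
  definition. In the second case \<open>excess_two\<close> leaves, for a family that is not Pasch,
  only an edge without vertices, which Avoider owns from the start.\<close>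

lemma only_pasch_or_threat:
  assumes V: "finite V" "E \<subseteq> Pow V" and lin: "linear_family E" and no: "\<not> only_pasch E"
  shows "threat E {} V"
proof -
  obtain F where F: "F \<subseteq> E" "card (\<Union>F) < 2 * card F" "\<not> pasch F"
    and min: "\<And>G. G \<subset> F \<Longrightarrow> 2 * card G \<le> card (\<Union>G)"
    using no unfolding only_pasch_def minimal_positive_def by blast
  have finE: "finite E" using V finite_subset by blast
  have finF: "finite F" using F(1) finE by (rule finite_subset)
  have int: "\<Union>G \<inter> V = \<Union>G" if "G \<subseteq> F" for G using that F(1) V(2) by blast
  have live: "live E {} V = E" using V(2) by (auto simp: live_def)
  have finU: "finite (\<Union>F)" using int[of F] V(1) finite_Int by (metis order_refl)
  have "F \<noteq> {}" using F(2) by auto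
  then obtain e where e: "e \<in> F" by blast
  have "2 * card (F - {e}) \<le> card (\<Union>(F - {e}))" by (rule min) (use e in blast)
  also have "\<dots> \<le> card (\<Union>F)" by (rule card_mono[OF finU]) blast
  finally have ge: "2 * card F \<le> card (\<Union>F) + 2" using e finF by simp
  have min': "2 * card G \<le> card (\<Union>G \<inter> V)" if "G \<subset> F" for G
    using min[OF that] int[OF psubset_imp_subset[OF that]] by simp
  consider "card (\<Union>F) + 1 = 2 * card F" | "card (\<Union>F) + 2 = 2 * card F"
    using F(2) ge by linarith
  then show ?thesis
  proof cases
    case 1
    then show ?thesis unfolding threat_def live using F(1) min' int[of F] by (intro disjI2 exI[of _ F]) simp
  next
    case 2
    have "\<exists>e\<in>F. e \<inter> V = {}"
    proof (rule ccontr)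
      assume *: "\<not> (\<exists>e\<in>F. e \<inter> V = {})"
      have "pasch F \<and> \<Union>F \<subseteq> V"
      proof (rule excess_two)
        show "linear_family F" using lin F(1) by (rule linear_family_subset)
        show "card (\<Union>F \<inter> V) + 2 = 2 * card F" using 2 int[of F] by simp
      qed (use finF V(1) min' * in auto)
      then show False using F(3) by blast
    qed
    then obtain e where e: "e \<in> F" "e \<inter> V = {}" by blast
    then have "e \<in> E" "e \<subseteq> {}" using F(1) V(2) by blast+
    then show ?thesis unfolding threat_def by blast
  qed
qed

section \<open>Disjointness of Pasch configurations\<close>

lemma pasch_linear:
  assumes "pasch Q" "e \<in> Q" "f \<in> Q" "e \<noteq> f"
  shows "card (e \<inter> f) \<le> 1"
proof (rule ccontr)
  assume "\<not> card (e \<inter> f) \<le> 1"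
  then obtain v where v: "v \<in> e \<inter> f" by (metis card.empty ex_in_conv zero_le_one)
  then have "v \<in> \<Union>Q" using assms(2) by blast
  from pasch_at[OF assms(1) this] obtain b c d k l where
    Q: "distinct [v, b, c, d, k, l]" "Q = {{v, b, c}, {v, d, k}, {b, d, l}, {c, k, l}}" by metis
  have "{x\<in>Q. v \<in> x} = {{v, b, c}, {v, d, k}}"
    unfolding Q(2) by (rule four_sets_split) (use Q(1) in auto)
  moreover have "e \<in> {x\<in>Q. v \<in> x}" "f \<in> {x\<in>Q. v \<in> x}" using v assms by simp_all
  ultimately have "e \<in> {{v, b, c}, {v, d, k}}" "f \<in> {{v, b, c}, {v, d, k}}" by (simp_all only:)
  then have "e = {v, b, c} \<and> f = {v, d, k} \<or> e = {v, d, k} \<and> f = {v, b, c}"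
    using assms(4) by (simp only: insert_iff empty_iff) metis
  then have "e \<inter> f = {v, b, c} \<inter> {v, d, k}" by (elim disjE conjE) (simp_all only: Int_commute)
  also have "\<dots> = {v}" using Q(1) by auto
  finally show False using \<open>\<not> card (e \<inter> f) \<le> 1\<close> by simp
qed

text \<open>Suppose that \<open>Q\<close> and \<open>Q'\<close> overlap. Leave out a line
  \<open>e\<close> of \<open>Q\<close> only and a line \<open>g\<close> of \<open>Q'\<close> only.
  With \<open>c\<close> common lines and \<open>p\<close> common points, \<open>6 - c\<close> lines
  on at most \<open>12 - p\<close> points remain; as \<open>p > 2 * c\<close>, the excess is
  positive and the rest contains a Pasch configuration \<open>T\<close>. It shares a line with
  \<open>Q\<close> or \<open>Q'\<close>, say \<open>Q\<close>, and differs from \<open>Q\<close>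
  because it lacks \<open>e\<close>. As \<open>T \<union> Q\<close> lacks \<open>g\<close>, it is
  smaller than \<open>Q \<union> Q'\<close>, against the induction hypothesis.\<close>

lemma pasch_disjoint:
  assumes K: "finite K" "only_pasch K"
  shows "Q \<subseteq> K \<Longrightarrow> Q' \<subseteq> K \<Longrightarrow> pasch Q \<Longrightarrow> pasch Q' \<Longrightarrow> Q \<noteq> Q' \<Longrightarrow> \<Union>Q \<inter> \<Union>Q' = {}"
proof (induction "card (Q \<union> Q')" arbitrary: Q Q' rule: less_induct)
  case less
  note c = pasch_card[OF less.prems(3)] and c' = pasch_card[OF less.prems(4)]
  show ?case
  proof (rule ccontr)
    assume overlap: "\<Union>Q \<inter> \<Union>Q' \<noteq> {}"
    have "\<not> Q \<subseteq> Q'" using card_subset_eq[OF c'(2)] c(1) c'(1) less.prems(5) by auto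
    then obtain e where e: "e \<in> Q" "e \<notin> Q'" by blast
    have "\<not> Q' \<subseteq> Q" using card_subset_eq[OF c(2)] c(1) c'(1) less.prems(5) by auto
    then obtain g where g: "g \<in> Q'" "g \<notin> Q" by blast
    have eg: "e \<noteq> g" using e g by blast
    let ?F = "Q \<union> Q' - {e, g}"
    have fin: "finite (Q \<union> Q')" using c(2) c'(2) by simp
    have card_lines: "card (Q \<union> Q') + card (Q \<inter> Q') = 8"
      using card_Un_Int[OF c(2) c'(2)] c(1) c'(1) by simp
    have card_points: "card (\<Union>Q \<union> \<Union>Q') + card (\<Union>Q \<inter> \<Union>Q') = 12"
      using card_Un_Int[OF c(4) c'(4)] c(3) c'(3) by simp
    \<comment> \<open>No common line leaves the assumed common point, one gives 3 common points and
      two give at least 5. Three common lines would force \<open>Q = Q'\<close>.\<close>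
    have common: "2 * card (Q \<inter> Q') < card (\<Union>Q \<inter> \<Union>Q')"
    proof -
      have finI: "finite (\<Union>Q \<inter> \<Union>Q')" using c(4) by simp
      have "card (Q \<inter> Q') < 3" using pasch_eq[OF less.prems(3,4)] less.prems(5) by linarith
      then consider "card (Q \<inter> Q') = 0" | "card (Q \<inter> Q') = 1" | "card (Q \<inter> Q') = 2" by linarith
      then show ?thesis
      proof cases
        case 1
        then show ?thesis using overlap finI by (simp add: card_gt_0_iff)
      next
        case 2
        then obtain l where "Q \<inter> Q' = {l}" using card_1_singletonE by blast
        then have l: "l \<in> Q" "l \<in> Q'" by blast+
        have "l \<subseteq> \<Union>Q \<inter> \<Union>Q'" using l by blast
        from card_mono[OF finI this] show ?thesis using c(6)[OF l(1)] 2 by simp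
      next
        case 3
        then obtain l k where lk: "Q \<inter> Q' = {l, k}" "l \<noteq> k" by (meson card_2_iff)
        have "l \<in> Q \<inter> Q'" "k \<in> Q \<inter> Q'" unfolding lk by simp_all
        then have l: "l \<in> Q" "l \<in> Q'" and k: "k \<in> Q" "k \<in> Q'" by simp_all
        have three: "card l = 3" "card k = 3" using c(6) l k by simp_all
        have fl: "finite l" "finite k" using three by (auto intro: card_ge_0_finite)
        have "card (l \<inter> k) \<le> 1" by (rule pasch_linear[OF less.prems(3) l(1) k(1) lk(2)])
        then have "5 \<le> card (l \<union> k)" using card_Un_Int[OF fl] three by linarith
        moreover have "l \<union> k \<subseteq> \<Union>Q \<inter> \<Union>Q'" using l k by blast
        ultimately show ?thesis using card_mono[OF finI, of "l \<union> k"] 3 by linarith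
      qed
    qed
    have "card ?F = card (Q \<union> Q') - 2"
      using fin e g eg by (subst card_Diff_subset) auto
    moreover have "card (\<Union>?F) \<le> card (\<Union>Q \<union> \<Union>Q')"
      by (rule card_mono) (use c(4) c'(4) in \<open>simp, blast\<close>)
    ultimately have "card (\<Union>?F) < 2 * card ?F"
      using card_lines card_points common by linarith
    from minimal_positive_exists[OF _ this] fin
    obtain T where T: "T \<subseteq> ?F" "minimal_positive T" by auto
    have TK: "T \<subseteq> K" using T(1) less.prems(1,2) by blast
    then have pT: "pasch T" using K(2) T(2) unfolding only_pasch_def by blast
    obtain t where t: "t \<in> T" using pasch_card(5)[OF pT] by blast
    have t0: "t \<noteq> {}" using pasch_card(6)[OF pT t] by auto
    have contra: False if "X \<in> {Q, Q'}" "t \<in> X" "k \<in> Q \<union> Q'" "k \<notin> T \<union> X" "\<not> X \<subseteq> T" for X k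
    proof -
      have X: "X \<subseteq> K" "pasch X" "X \<subseteq> Q \<union> Q'" using that(1) less.prems by blast+
      have "T \<union> X \<subset> Q \<union> Q'" using T(1) X(3) that(3,4) by blast
      then have "card (T \<union> X) < card (Q \<union> Q')" by (rule psubset_card_mono[OF fin])
      moreover have "T \<noteq> X" using that(5) by blast
      ultimately have "\<Union>T \<inter> \<Union>X = {}" using less.hyps[of T X] TK X(1,2) pT by blast
      then show False using t that(2) t0 by blast
    qed
    have "e \<notin> T" "g \<notin> T" using T(1) by blast+
    moreover have "t \<in> Q \<or> t \<in> Q'" using T(1) t by blast
    ultimately show False using contra[of Q g] contra[of Q' e] e g by blast
  qed
qed

lemma live_Pow: "E \<subseteq> Pow V \<Longrightarrow> live E {} V = E"
  by (auto simp: live_def)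

text \<open>If the edges outside all Pasch configurations violated the Hall condition, then they would still have
  positive excess together with all but one edge of each Pasch configuration.\<close>

lemma only_pasch_invariant:
  assumes V: "finite V" "K \<subseteq> Pow V" and K: "only_pasch K"
  shows "avoider_invariant K {} V"
proof -
  define PP where "PP = {Q. Q \<subseteq> K \<and> pasch Q}"
  have finK: "finite K" using V finite_subset by blast
  have pack: "pasch_packing PP K V"
    unfolding pasch_packing_def
  proof (intro conjI ballI impI)
    fix Q assume "Q \<in> PP"
    then show "pasch Q" "Q \<subseteq> K" by (simp_all add: PP_def)
    then show "\<Union>Q \<subseteq> V" using V(2) by blast
  next
    fix Q Q' assume "Q \<in> PP" "Q' \<in> PP" "Q \<noteq> Q'"
    then show "\<Union>Q \<inter> \<Union>Q' = {}" using pasch_disjoint[OF finK K] by (simp add: PP_def)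
  qed
  have finPP: "finite PP" by (rule pasch_packing_finite[OF pack finK])
  have sub: "Q \<subseteq> K" "pasch Q" if "Q \<in> PP" for Q using that by (simp_all add: PP_def)
  have disj: "Q \<inter> Q' = {}" if "Q \<in> PP" "Q' \<in> PP" "Q \<noteq> Q'" for Q Q'
  proof (rule ccontr)
    assume "Q \<inter> Q' \<noteq> {}"
    then obtain l where l: "l \<in> Q" "l \<in> Q'" by blast
    have "l \<noteq> {}" using pasch_card(6)[OF sub(2)[OF that(1)] l(1)] by auto
    moreover have "\<Union>Q \<inter> \<Union>Q' = {}" using pack that by (simp add: pasch_packing_def)
    ultimately show False using l by blast
  qed
  \<comment> \<open>\<open>h Q\<close> is the line of \<open>Q\<close> to be left out. The other
    three lines have at most six points, so adding them for all \<open>Q\<close> in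
    \<open>PP\<close> keeps the excess of a violating \<open>F\<close> positive. The resulting
    family contains a minimal one, which is some \<open>T\<close> in \<open>PP\<close> by
    hypothesis, although its line \<open>h T\<close> was left out.\<close>
  define h where "h Q = (SOME e. e \<in> Q)" for Q :: "'a set set"
  have h: "h Q \<in> Q" if "Q \<in> PP" for Q
    unfolding h_def using pasch_card(5)[OF sub(2)[OF that]] by (rule some_in_eq[THEN iffD2])
  have inj: "inj_on h PP"
  proof (rule inj_onI, rule ccontr)
    fix Q Q' assume "Q \<in> PP" "Q' \<in> PP" "h Q = h Q'" "Q \<noteq> Q'"
    then show False using h[of Q] h[of Q'] disj[of Q Q'] by auto
  qed
  have "hall (K - \<Union>PP) (V - \<Union>(\<Union>PP))"
    unfolding hall_def
  proof (intro allI impI, rule ccontr)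
    fix F assume F: "F \<subseteq> K - \<Union>PP" and "\<not> 2 * card F \<le> card (\<Union>F \<inter> (V - \<Union>(\<Union>PP)))"
    then have less: "card (\<Union>F \<inter> (V - \<Union>(\<Union>PP))) < 2 * card F" by simp
    have FK: "F \<subseteq> K" using F by blast
    have finF: "finite F" using FK finK by (rule finite_subset)
    let ?F = "F \<union> (\<Union>PP - h ` PP)"
    have PPK: "\<Union>PP \<subseteq> K" using sub(1) by blast
    have finUPP: "finite (\<Union>PP)" using PPK finK by (rule finite_subset)
    have "card (\<Union>PP) = (\<Sum>Q\<in>PP. card Q)"
    proof (rule card_Union_disjoint)
      show "pairwise disjnt PP" using disj by (simp add: pairwise_def disjnt_def)
      show "finite Q" if "Q \<in> PP" for Q by (rule pasch_card(2)[OF sub(2)[OF that]])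
    qed
    also have "\<dots> = (\<Sum>Q\<in>PP. 4)" by (rule sum.cong) (use sub(2) pasch_card(1) in auto)
    finally have card_lines: "card (\<Union>PP) = 4 * card PP" by simp
    have "h ` PP \<subseteq> \<Union>PP" using h by blast
    then have "card (\<Union>PP - h ` PP) = 3 * card PP"
      using card_lines card_image[OF inj] finPP by (subst card_Diff_subset) auto
    moreover have "F \<inter> (\<Union>PP - h ` PP) = {}" using F by blast
    ultimately have cardF: "card ?F = card F + 3 * card PP"
      using finF finUPP by (subst card_Un_disjoint) auto
    have finW: "finite (\<Union>F \<inter> (V - \<Union>(\<Union>PP)))" "finite (\<Union>(\<Union>PP))"
      using V PPK by (auto intro: finite_subset[of _ V])
    have "\<Union>?F \<subseteq> (\<Union>F \<inter> (V - \<Union>(\<Union>PP))) \<union> \<Union>(\<Union>PP)"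
    proof
      fix v assume "v \<in> \<Union>?F"
      then obtain e where e: "v \<in> e" "e \<in> F \<or> e \<in> \<Union>PP" by blast
      then have "v \<in> V" using FK PPK V(2) by blast
      then show "v \<in> (\<Union>F \<inter> (V - \<Union>(\<Union>PP))) \<union> \<Union>(\<Union>PP)" using e by blast
    qed
    then have "card (\<Union>?F) \<le> card ((\<Union>F \<inter> (V - \<Union>(\<Union>PP))) \<union> \<Union>(\<Union>PP))"
      by (rule card_mono[rotated]) (use finW in simp)
    also have "\<dots> \<le> card (\<Union>F \<inter> (V - \<Union>(\<Union>PP))) + card (\<Union>(\<Union>PP))" by (rule card_Un_le)
    also have "\<dots> < 2 * card ?F"
      using less cardF pasch_packing_card[OF pack finK] by linarith
    finally have excess: "card (\<Union>?F) < 2 * card ?F" .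
    have "finite ?F" using finF finUPP by simp
    from minimal_positive_exists[OF this excess]
    obtain T where T: "T \<subseteq> ?F" "minimal_positive T" by (elim exE conjE)
    have "?F \<subseteq> K" using FK PPK by (intro Un_least) (simp_all add: Diff_subset[THEN subset_trans])
    with T(1) have TK: "T \<subseteq> K" by (rule subset_trans)
    then have TP: "T \<in> PP" using K T(2) by (simp add: only_pasch_def PP_def)
    have "h T \<in> ?F" using T(1) h[OF TP] by (rule subsetD)
    moreover have hT: "h T \<in> \<Union>PP" using TP h[OF TP] by (rule UnionI)
    moreover have "h T \<in> h ` PP" using TP by (rule imageI)
    ultimately have "h T \<in> F" by simp
    then show False using F hT by auto
  qed
  with pack show ?thesis
    unfolding avoider_invariant_def live_Pow[OF V(2)] by blast
qed

section \<open>Private points and the local condition\<close>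

definition private_points :: "'a set set \<Rightarrow> 'a set \<Rightarrow> 'a set" where
  "private_points K e = {v\<in>e. \<forall>f\<in>K. v \<in> f \<longrightarrow> f = e}"

text \<open>Asking for \<open>f \<inter> g\<close> alone suffices in the last clause: permuting
  \<open>f\<close>, \<open>g\<close>, \<open>h\<close> gives the other two pairs, so that the four
  edges form a Pasch configuration if all of them are good.\<close>

definition good_edge :: "'a set set \<Rightarrow> 'a set \<Rightarrow> bool" where
  "good_edge K e \<longleftrightarrow> card e = 3 \<and>
     (\<forall>f\<in>K. \<forall>g\<in>K. e \<noteq> f \<and> e \<noteq> g \<and> f \<noteq> g \<longrightarrow> e \<inter> f \<inter> g = {}) \<and>
     (\<forall>f\<in>K. \<forall>g\<in>K. \<forall>h\<in>K. distinct [e, f, g, h] \<and> e \<inter> f \<noteq> {} \<and> e \<inter> g \<noteq> {} \<and> e \<inter> h \<noteq> {} \<longrightarrow> f \<inter> g \<noteq> {})"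

text \<open>With \<open>Y\<close> the points of degree 1, the weight bounds the degrees from below
  in \<open>avoider_invariant_good\<close> and from above in
  \<open>good_avoider_invariant\<close>.\<close>

lemma sum_one_two:
  assumes "finite X" "Y \<subseteq> X"
  shows "(\<Sum>v\<in>X. if v \<in> Y then 1 else 2 :: nat) + card Y = 2 * card X"
proof -
  let ?w = "\<lambda>v. if v \<in> Y then 1 else 2 :: nat"
  have fY: "finite Y" using assms finite_subset by blast
  have "sum ?w X = sum ?w (X - Y) + sum ?w Y" by (rule sum.subset_diff[OF assms(2,1)])
  also have "sum ?w (X - Y) = 2 * (card X - card Y)"
    using assms(2) fY by (simp add: card_Diff_subset)
  also have "sum ?w Y = card Y" by simp
  finally show ?thesis using card_mono[OF assms] by linarith
qed

text \<open>The private points of \<open>e\<close> lie on no edge of \<open>K\<close>, hence outside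
  the packing and outside every other family. Two of them pay for the 2 that \<open>e\<close> adds
  to the left side of Hall's condition, so the old packing still serves.\<close>

lemma avoider_invariant_insert:
  assumes V: "finite V" "insert e K \<subseteq> Pow V" and e: "2 \<le> card (private_points (insert e K) e)"
    and inv: "avoider_invariant K {} V"
  shows "avoider_invariant (insert e K) {} V"
proof (cases "e \<in> K")
  case True
  then show ?thesis using inv by (simp add: insert_absorb)
next
  case False
  have KV: "K \<subseteq> Pow V" and eV: "e \<subseteq> V" using V(2) by blast+
  obtain PP where pack: "pasch_packing PP K V" and hall: "hall (K - \<Union>PP) (V - \<Union>(\<Union>PP))"
    using inv unfolding avoider_invariant_def live_Pow[OF KV] by blast
  let ?W = "V - \<Union>(\<Union>PP)" let ?P = "private_points (insert e K) e"
  have PPK: "\<Union>PP \<subseteq> K" using pack by (auto simp: pasch_packing_def)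
  have pack': "pasch_packing PP (insert e K) V"
    using pack by (auto simp: pasch_packing_def)
  have P: "v \<notin> f" if "v \<in> ?P" "f \<in> K" for v f
    using that False unfolding private_points_def by blast
  have Pe: "?P \<subseteq> e" unfolding private_points_def by blast
  have "hall (insert e K - \<Union>PP) ?W"
    unfolding hall_def
  proof (intro allI impI)
    fix F assume F: "F \<subseteq> insert e K - \<Union>PP"
    show "2 * card F \<le> card (\<Union>F \<inter> ?W)"
    proof (cases "e \<in> F")
      case False
      then have "F \<subseteq> K - \<Union>PP" using F by blast
      then show ?thesis using hall by (simp add: hall_def)
    next
      case True
      let ?G = "F - {e}"
      have G: "?G \<subseteq> K - \<Union>PP" using F by blast
      then have hG: "2 * card ?G \<le> card (\<Union>?G \<inter> ?W)" using hall by (simp add: hall_def)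
      have "finite K" using KV V(1) by (meson finite_Pow_iff finite_subset)
      then have "finite F" using F by (meson Diff_subset finite_insert finite_subset)
      then have cF: "card F = card ?G + 1" using True by (metis Suc_eq_plus1 card_Suc_Diff1)
      have PW: "?P \<subseteq> ?W" using P PPK Pe eV by blast
      have "(\<Union>?G \<inter> ?W) \<inter> ?P = {}" using P G by blast
      moreover have "finite ?P" using PW V(1) finite_subset by (metis finite_Diff)
      ultimately have "card ((\<Union>?G \<inter> ?W) \<union> ?P) = card (\<Union>?G \<inter> ?W) + card ?P"
        using V(1) by (intro card_Un_disjoint) auto
      moreover have "(\<Union>?G \<inter> ?W) \<union> ?P \<subseteq> \<Union>F \<inter> ?W" using PW Pe True by blast
      then have "card ((\<Union>?G \<inter> ?W) \<union> ?P) \<le> card (\<Union>F \<inter> ?W)" using V(1) by (intro card_mono) auto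
      ultimately show ?thesis using hG cF e by linarith
    qed
  qed
  with pack' show ?thesis
    unfolding avoider_invariant_def live_Pow[OF V(2)] by blast
qed

text \<open>In a core the weights \<open>1 / deg v\<close> on the edges outside the packing add up to at most 2 on each edge, so
  the Hall condition forces equality everywhere.\<close>

lemma avoider_invariant_good:
  assumes V: "finite V" "K \<subseteq> Pow V" and lin: "linear_family K"
    and core: "\<And>e. e \<in> K \<Longrightarrow> card (private_points K e) \<le> 1"
    and inv: "avoider_invariant K {} V" and e: "e \<in> K"
  shows "good_edge K e"
proof -
  obtain PP where pack: "pasch_packing PP K V" and hall: "hall (K - \<Union>PP) (V - \<Union>(\<Union>PP))"
    using inv unfolding avoider_invariant_def live_Pow[OF V(2)] by blast
  let ?F = "K - \<Union>PP" let ?F1 = "{e\<in>K - \<Union>PP. private_points K e \<noteq> {}}" let ?W = "V - \<Union>(\<Union>PP)" let ?at = "\<lambda>v. {e\<in>K - \<Union>PP. v \<in> e}"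
  define X where "X = \<Union>?F \<inter> ?W"
  define X1 where "X1 = {v\<in>X. card (?at v) = 1}"
  have finK: "finite K" using V finite_subset by blast
  have fin: "finite ?F" "finite ?W" "finite X" "finite X1" using finK V(1) by (simp_all add: X_def X1_def)
  have same: "?at v = {e\<in>K. v \<in> e}" if "v \<in> X" for v
  proof -
    have "v \<notin> \<Union>(\<Union>PP)" using that by (simp add: X_def)
    then show ?thesis by blast
  qed
  have deg1: "1 \<le> card (?at v)" if "v \<in> X" for v
  proof -
    have "?at v \<noteq> {}" using that unfolding X_def by blast
    moreover have "finite (?at v)" by (rule finite_subset[OF _ fin(1)]) blast
    ultimately show ?thesis by (simp only: One_nat_def Suc_le_eq card_gt_0_iff) simp
  qed
  have card2: "2 * card ?F \<le> card X" using hall unfolding hall_def X_def by blast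
  have size: "finite e" "card (e \<inter> ?W) \<le> card e" "card e \<le> 3" if "e \<in> K" for e
    using lin that by (auto simp: linear_family_def intro: card_mono)
  have X1_private: "\<exists>e\<in>?F. v \<in> private_points K e" if "v \<in> X1" for v
  proof -
    have vX: "v \<in> X" and one: "card (?at v) = 1" using that unfolding X1_def by blast+
    have "card {e\<in>K. v \<in> e} = 1" using one unfolding same[OF vX] .
    then obtain e where e: "{e\<in>K. v \<in> e} = {e}" by (rule card_1_singletonE)
    have eK: "e \<in> {e\<in>K. v \<in> e}" unfolding e by simp
    have "f = e" if "f \<in> K" "v \<in> f" for f
    proof -
      have "f \<in> {e\<in>K. v \<in> e}" using that by simp
      then show ?thesis unfolding e by simp
    qed
    then have "v \<in> private_points K e" using eK by (simp add: private_points_def)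
    moreover have "e \<in> ?at v" using eK unfolding same[OF vX] .
    ultimately show ?thesis by (intro bexI[of _ e]) simp_all
  qed
  \<comment> \<open>A point of degree 1 is private to its edge, and an edge of a core has at most
    one private point.\<close>
  have card_private: "card X1 \<le> card ?F1"
  proof -
    define p where "p v = (SOME e. e \<in> ?F \<and> v \<in> private_points K e)" for v
    have p: "p v \<in> ?F \<and> v \<in> private_points K (p v)" if "v \<in> X1" for v
      unfolding p_def by (rule someI_ex) (use X1_private[OF that] in \<open>unfold Bex_def\<close>)
    have "inj_on p X1"
    proof (rule inj_onI)
      fix v w assume v: "v \<in> X1" "w \<in> X1" "p v = p w"
      let ?P = "private_points K (p v)"
      have "?P \<subseteq> p v" by (auto simp: private_points_def)
      then have "finite ?P" using size(1)[of "p v"] p[OF v(1)] finite_subset by blast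
      moreover have "card ?P \<le> 1" using core p[OF v(1)] by blast
      moreover have "v \<in> ?P" "w \<in> ?P" using p v by metis+
      ultimately show "v = w" using card_le_Suc0_iff_eq[of ?P] by auto
    qed
    moreover have "p ` X1 \<subseteq> ?F1" using p by blast
    moreover have "finite ?F1"
      by (rule finite_subset[OF Collect_restrict fin(1)])
    ultimately show ?thesis by (rule card_inj_on_le)
  qed
  have card_private_le: "card ?F1 \<le> card ?F"
    by (rule card_mono[OF fin(1) Collect_restrict])
  have dc: "(\<Sum>v\<in>X. card (?at v)) = (\<Sum>e\<in>?F. card (e \<inter> ?W))"
    unfolding X_def by (rule double_count[OF fin(1,2)])
  have le3: "card (e \<inter> ?W) \<le> 3" if "e \<in> ?F" for e using size[of e] that by auto
  have upper: "(\<Sum>e\<in>?F. card (e \<inter> ?W)) \<le> 3 * card ?F"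
    using sum_mono[of ?F "\<lambda>e. card (e \<inter> ?W)" "\<lambda>_. 3"] le3 by simp
  \<comment> \<open>The chain is \<open>3 * card ?F \<le> 2 * card X - card X1 \<le>\<close> sum of
    the degrees \<open>\<le> 3 * card ?F\<close>, using \<open>card2\<close> and
    \<open>card_private\<close>. It has no slack: each contradiction below comes from a failing
    property that would make one of its links strict.\<close>
  let ?w = "\<lambda>v. if v \<in> X1 then 1 else 2 :: nat"
  have w_le: "?w v \<le> card (?at v)" if "v \<in> X" for v
    using deg1[OF that] that by (auto simp: X1_def)
  have sum_w: "(\<Sum>v\<in>X. ?w v) + card X1 = 2 * card X"
    by (rule sum_one_two[OF fin(3)]) (simp add: X1_def)
  have lower: "(\<Sum>v\<in>X. ?w v) \<le> (\<Sum>v\<in>X. card (?at v))" by (rule sum_mono) (rule w_le)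
  have inW: "card (e \<inter> ?W) = 3" if eF: "e \<in> ?F" for e
  proof (rule ccontr)
    assume "card (e \<inter> ?W) \<noteq> 3"
    then have "card (e \<inter> ?W) < 3" using le3[OF eF] by simp
    then have "(\<Sum>e\<in>?F. card (e \<inter> ?W)) < (\<Sum>e\<in>?F. 3)"
      by (intro sum_strict_mono_ex1) (use fin(1) le3 eF in auto)
    then show False using lower dc sum_w card2 card_private card_private_le by simp
  qed
  have subW: "e \<subseteq> ?W" if "e \<in> ?F" for e
  proof -
    have "e \<inter> ?W = e" using size[of e] inW[OF that] that by (intro card_seteq) auto
    then show ?thesis by blast
  qed
  show ?thesis
  proof (cases "e \<in> \<Union>PP")
    case True
    then obtain Q where Q: "Q \<in> PP" "e \<in> Q" by blast
    then have pQ: "pasch Q" "Q \<subseteq> K" using pack by (simp_all add: pasch_packing_def)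
    \<comment> \<open>Edges outside the packing have all their points outside it by
      \<open>subW\<close>, and the other packed configurations are disjoint from \<open>Q\<close>.
      Whatever meets \<open>e\<close> is therefore a line of \<open>Q\<close>.\<close>
    have inQ: "f \<in> Q" if f: "f \<in> K" "e \<inter> f \<noteq> {}" for f
    proof -
      obtain v where v: "v \<in> e" "v \<in> f" using f(2) by blast
      have vU: "v \<in> \<Union>(\<Union>PP)" using v(1) Q by blast
      have "f \<notin> ?F"
      proof
        assume "f \<in> ?F"
        then have "v \<in> ?W" using subW v(2) by blast
        then show False using vU by simp
      qed
      then obtain Q' where Q': "Q' \<in> PP" "f \<in> Q'" using f(1) by blast
      have "\<Union>Q \<inter> \<Union>Q' \<noteq> {}" using v Q(2) Q'(2) by blast
      moreover have "Q \<noteq> Q' \<longrightarrow> \<Union>Q \<inter> \<Union>Q' = {}" using pack Q(1) Q'(1) by (simp add: pasch_packing_def)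
      ultimately have "Q = Q'" by argo
      then show ?thesis using Q'(2) by simp
    qed
    have three: "e \<inter> f \<inter> g = {}" if fg: "f \<in> K" "g \<in> K" "e \<noteq> f \<and> e \<noteq> g \<and> f \<noteq> g" for f g
    proof (rule ccontr)
      assume "e \<inter> f \<inter> g \<noteq> {}"
      then obtain v where v: "v \<in> e" "v \<in> f" "v \<in> g" by blast
      then have "f \<in> Q" "g \<in> Q" using inQ fg by blast+
      then have "{e, f, g} \<subseteq> {l\<in>Q. v \<in> l}" using Q(2) v by simp
      moreover have "v \<in> \<Union>Q" using Q(2) v(1) by blast
      from pasch_two_lines[OF pQ(1) this] have "card {l\<in>Q. v \<in> l} = 2" by (elim exE conjE) simp
      moreover have "finite {l\<in>Q. v \<in> l}" using pasch_card(2)[OF pQ(1)] by simp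
      ultimately have "card {e, f, g} \<le> 2" by (metis card_mono)
      then show False using fg(3) by simp
    qed
    have meet: "f \<inter> g \<noteq> {}" if "f \<in> K" "g \<in> K" "e \<inter> f \<noteq> {}" "e \<inter> g \<noteq> {}" for f g
      by (rule pasch_card(7)[OF pQ(1) inQ[OF that(1,3)] inQ[OF that(2,4)]])
    show ?thesis
      unfolding good_edge_def
    proof (intro conjI ballI impI)
      show "card e = 3" by (rule pasch_card(6)[OF pQ(1) Q(2)])
      show "e \<inter> f \<inter> g = {}" if "f \<in> K" "g \<in> K" "e \<noteq> f \<and> e \<noteq> g \<and> f \<noteq> g" for f g
        by (rule three[OF that])
      show "f \<inter> g \<noteq> {}" if "f \<in> K" "g \<in> K" "h \<in> K"
        "distinct [e, f, g, h] \<and> e \<inter> f \<noteq> {} \<and> e \<inter> g \<noteq> {} \<and> e \<inter> h \<noteq> {}" for f g h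
        by (rule meet) (use that in simp_all)
    qed
  next
    case False
    then have eF: "e \<in> ?F" using e by blast
    have "card (e \<inter> ?W) = 3" by (rule inW[OF eF])
    then have e3: "card e = 3" and "e \<inter> ?W = e"
      using size[OF e] card_seteq[of e "e \<inter> ?W"] by auto
    then have eW: "e \<subseteq> ?W" by blast
    have priv: "private_points K e \<noteq> {}"
    proof
      assume "private_points K e = {}"
      then have "e \<notin> ?F1" by simp
      then have "?F1 \<noteq> ?F" using eF by metis
      then have "?F1 \<subset> ?F" by (rule psubsetI[OF Collect_restrict])
      then have "card ?F1 < card ?F" by (rule psubset_card_mono[OF fin(1)])
      then show False using lower dc sum_w card2 card_private upper by linarith
    qed
    have deg2: "card {f\<in>K. v \<in> f} \<le> 2" if "v \<in> e" for v
    proof (rule ccontr)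
      assume gt: "\<not> card {f\<in>K. v \<in> f} \<le> 2"
      have vX: "v \<in> X" using that eF eW unfolding X_def by blast
      have "?w v < card (?at v)" using gt same[OF vX] by simp
      then have "(\<Sum>v\<in>X. ?w v) < (\<Sum>v\<in>X. card (?at v))"
        by (intro sum_strict_mono_ex1[OF fin(3)] ballI w_le bexI[OF _ vX])
      then show False using dc sum_w card2 card_private card_private_le upper by linarith
    qed
    have three: "e \<inter> f \<inter> g = {}" if "f \<in> K" "g \<in> K" "e \<noteq> f \<and> e \<noteq> g \<and> f \<noteq> g" for f g
    proof (rule ccontr)
      assume "e \<inter> f \<inter> g \<noteq> {}"
      then obtain v where v: "v \<in> e" "v \<in> f" "v \<in> g" by blast
      have "card {e, f, g} \<le> card {f\<in>K. v \<in> f}" using finK that v e by (intro card_mono) auto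
      then show False using deg2[OF v(1)] that(3) by simp
    qed
    have meet: "f \<inter> g \<noteq> {}" if "f \<in> K" "g \<in> K" "h \<in> K"
      and *: "distinct [e, f, g, h] \<and> e \<inter> f \<noteq> {} \<and> e \<inter> g \<noteq> {} \<and> e \<inter> h \<noteq> {}" for f g h
    proof -
      obtain x y z where xyz: "x \<in> e" "x \<in> f" "y \<in> e" "y \<in> g" "z \<in> e" "z \<in> h" using * by blast
      have d: "distinct [x, y, z]"
      proof -
        have "e \<inter> f \<inter> g = {}" "e \<inter> f \<inter> h = {}" "e \<inter> g \<inter> h = {}" using three that(1-3) * by auto
        then show ?thesis using xyz by auto
      qed
      \<comment> \<open>Three meeting edges would cover all points of \<open>e\<close>, including
        its private one. The clause about three meeting edges is thus vacuous for an edge outside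
        the packing.\<close>
      have "{x, y, z} = e"
        by (rule card_subset_eq) (use xyz d e3 size(1)[OF e] in auto)
      moreover obtain v where "v \<in> private_points K e" using priv by blast
      ultimately have "v = x \<or> v = y \<or> v = z" "\<And>f. f \<in> K \<Longrightarrow> v \<in> f \<Longrightarrow> f = e"
        by (auto simp: private_points_def)
      then show ?thesis using xyz that(1-3) * by auto
    qed
    show ?thesis
      unfolding good_edge_def
    proof (intro conjI ballI impI)
      show "card e = 3" by (rule e3)
      show "e \<inter> f \<inter> g = {}" if "f \<in> K" "g \<in> K" "e \<noteq> f \<and> e \<noteq> g \<and> f \<noteq> g" for f g
        by (rule three[OF that])
      show "f \<inter> g \<noteq> {}" if "f \<in> K" "g \<in> K" "h \<in> K"
        "distinct [e, f, g, h] \<and> e \<inter> f \<noteq> {} \<and> e \<inter> g \<noteq> {} \<and> e \<inter> h \<noteq> {}" for f g h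
        by (rule meet[OF that])
    qed
  qed
qed

lemma good_edge_card: "good_edge K e \<Longrightarrow> card e = 3"
  by (simp add: good_edge_def)

lemma good_edge_no_triple:
  assumes "good_edge K e" "f \<in> K" "g \<in> K" "e \<noteq> f" "e \<noteq> g" "f \<noteq> g"
  shows "e \<inter> f \<inter> g = {}"
  by (rule assms(1)[unfolded good_edge_def, THEN conjunct2, THEN conjunct1, rule_format, OF assms(2,3)])
    (simp add: assms)

lemma good_edge_meet:
  assumes "good_edge K e" "f \<in> K" "g \<in> K" "h \<in> K" "distinct [e, f, g, h]"
    "e \<inter> f \<noteq> {}" "e \<inter> g \<noteq> {}" "e \<inter> h \<noteq> {}"
  shows "f \<inter> g \<noteq> {}"
  by (rule assms(1)[unfolded good_edge_def, THEN conjunct2, THEN conjunct2, rule_format, OF assms(2,3,4)])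
    (intro conjI assms(5-8))

text \<open>Here all Pasch configurations are packed; they are disjoint because a point of one
  already lies on two of its lines. An edge outside has a private point, as otherwise the edges
  through its three points would meet each other and complete a Pasch configuration. For a family
  \<open>F\<close> of outside edges this gives \<open>3 * card F \<le> 2 * card X - card F\<close>
  on its point set \<open>X\<close>, which is Hall's condition.\<close>

lemma good_avoider_invariant:
  assumes V: "finite V" "K \<subseteq> Pow V" and lin: "linear_family K"
    and good: "\<And>e. e \<in> K \<Longrightarrow> good_edge K e"
  shows "avoider_invariant K {} V"
proof -
  have finK: "finite K" using V finite_subset by blast
  have three: False if "e \<in> K" "f \<in> K" "g \<in> K" "v \<in> e" "v \<in> f" "v \<in> g" "e \<noteq> f" "e \<noteq> g" "f \<noteq> g" for e f g v
  proof -
    have "e \<inter> f \<inter> g = {}" by (rule good_edge_no_triple[OF good[OF that(1)] that(2,3,7,8,9)])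
    then show ?thesis using that by blast
  qed
  define PP where "PP = {Q. Q \<subseteq> K \<and> pasch Q}"
  have sub: "Q \<subseteq> K" "pasch Q" if "Q \<in> PP" for Q using that by (simp_all add: PP_def)
  have share: "l \<in> Q'" if Q: "Q \<in> PP" "Q' \<in> PP" and v: "v \<in> \<Union>Q'" and l: "l \<in> Q" "v \<in> l" for Q Q' v l
  proof (rule ccontr)
    assume "l \<notin> Q'"
    obtain c d where cd: "c \<noteq> d" "{l\<in>Q'. v \<in> l} = {c, d}"
      using pasch_two_lines[OF sub(2)[OF Q(2)] v] by blast
    have "c \<in> {l\<in>Q'. v \<in> l}" "d \<in> {l\<in>Q'. v \<in> l}" unfolding cd(2) by simp_all
    then have c: "c \<in> Q'" "v \<in> c" "d \<in> Q'" "v \<in> d" by simp_all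
    have "l \<noteq> c" "l \<noteq> d" using c \<open>l \<notin> Q'\<close> by auto
    then show False using three[of l c d v] c l cd(1) sub(1)[OF Q(1)] sub(1)[OF Q(2)] by blast
  qed
  have pack: "pasch_packing PP K V"
    unfolding pasch_packing_def
  proof (intro conjI ballI impI)
    fix Q assume "Q \<in> PP"
    then show "pasch Q" "Q \<subseteq> K" by (simp_all add: PP_def)
    then show "\<Union>Q \<subseteq> V" using V(2) by blast
  next
    fix Q Q' assume Q: "Q \<in> PP" "Q' \<in> PP" "Q \<noteq> Q'"
    note c = pasch_card[OF sub(2)[OF Q(1)]] and c' = pasch_card[OF sub(2)[OF Q(2)]]
    show "\<Union>Q \<inter> \<Union>Q' = {}"
    proof (rule ccontr)
      assume "\<Union>Q \<inter> \<Union>Q' \<noteq> {}"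
      then obtain v a where va: "v \<in> \<Union>Q'" "a \<in> Q" "v \<in> a" by blast
      have a: "a \<in> Q'" by (rule share[OF Q(1,2) va])
      have "Q \<subseteq> Q'"
      proof
        fix l assume l: "l \<in> Q"
        then obtain w where w: "w \<in> l" "w \<in> a" using c(7)[OF l va(2)] by blast
        then have "w \<in> \<Union>Q'" using a by blast
        then show "l \<in> Q'" using share[OF Q(1,2) _ l w(1)] by blast
      qed
      then show False using card_subset_eq[OF c'(2)] c(1) c'(1) Q(3) by simp
    qed
  qed
  have priv: "private_points K e \<noteq> {}" if e: "e \<in> K" "e \<notin> \<Union>PP" for e
  proof
    assume none: "private_points K e = {}"
    have other: "\<exists>f\<in>K. v \<in> f \<and> f \<noteq> e" if "v \<in> e" for v
      using none that unfolding private_points_def by blast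
    have "card e = 3" by (rule good_edge_card[OF good[OF e(1)]])
    then obtain x y z where xyz: "e = {x, y, z}" "x \<noteq> y" "x \<noteq> z" "y \<noteq> z" by (metis card_3_iff)
    obtain f where f: "f \<in> K" "x \<in> f" "f \<noteq> e" using other[of x] xyz(1) by blast
    obtain g where g: "g \<in> K" "y \<in> g" "g \<noteq> e" using other[of y] xyz(1) by blast
    obtain h where h: "h \<in> K" "z \<in> h" "h \<noteq> e" using other[of z] xyz(1) by blast
    have mem: "x \<in> e" "y \<in> e" "z \<in> e" using xyz(1) by simp_all
    have fg: "f \<noteq> g" using linear_family_eq[OF lin f(1) e(1) f(2) mem(1) _ mem(2) xyz(2)] f(3) g(2) by blast
    have fh: "f \<noteq> h" using linear_family_eq[OF lin f(1) e(1) f(2) mem(1) _ mem(3) xyz(3)] f(3) h(2) by blast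
    have gh: "g \<noteq> h" using linear_family_eq[OF lin g(1) e(1) g(2) mem(2) _ mem(3) xyz(4)] g(3) h(2) by blast
    have meet: "e \<inter> f \<noteq> {}" "e \<inter> g \<noteq> {}" "e \<inter> h \<noteq> {}" using mem f g h by blast+
    have third: "\<And>f g h. f \<in> K \<Longrightarrow> g \<in> K \<Longrightarrow> h \<in> K \<Longrightarrow> distinct [e, f, g, h] \<Longrightarrow>
        e \<inter> f \<noteq> {} \<Longrightarrow> e \<inter> g \<noteq> {} \<Longrightarrow> e \<inter> h \<noteq> {} \<Longrightarrow> f \<inter> g \<noteq> {}"
      by (rule good_edge_meet[OF good[OF e(1)]])
    have dist: "distinct [e, f, g, h]" "distinct [e, f, h, g]" "distinct [e, g, h, f]"
      using f(3) g(3) h(3) fg fh gh by simp_all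
    have meet': "f \<inter> g \<noteq> {}" "f \<inter> h \<noteq> {}" "g \<inter> h \<noteq> {}"
      by (rule third[OF f(1) g(1) h(1) dist(1) meet(1-3)], rule third[OF f(1) h(1) g(1) dist(2) meet(1,3,2)],
        rule third[OF g(1) h(1) f(1) dist(3) meet(2,3,1)])
    have subK: "{e, f, g, h} \<subseteq> K" using e(1) f(1) g(1) h(1) by simp
    have conc: "k \<inter> l \<inter> p = {}" if "k \<in> K" "l \<in> K" "p \<in> K" "k \<noteq> l" "k \<noteq> p" "l \<noteq> p" for k l p
      using three[OF that(1-3) _ _ _ that(4-6)] by blast
    have "pasch {e, f, g, h}"
    proof (rule pasch_intro)
      show "e \<inter> f \<noteq> {}" "e \<inter> g \<noteq> {}" "e \<inter> h \<noteq> {}" by (fact meet)+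
      show "f \<inter> g \<noteq> {}" "f \<inter> h \<noteq> {}" "g \<inter> h \<noteq> {}" by (fact meet')+
      show "card e = 3" "card f = 3" "card g = 3" "card h = 3"
        by (rule good_edge_card[OF good], rule e f g h)+
      show "e \<inter> f \<inter> g = {}" "e \<inter> f \<inter> h = {}" "e \<inter> g \<inter> h = {}" "f \<inter> g \<inter> h = {}"
        by (rule conc; use e(1) f g h fg fh gh in simp)+
    qed
    then have "{e, f, g, h} \<in> PP" using subK by (simp add: PP_def)
    then show False using e(2) by blast
  qed
  have "hall (K - \<Union>PP) (V - \<Union>(\<Union>PP))"
    unfolding hall_def
  proof (intro allI impI)
    fix F assume F: "F \<subseteq> K - \<Union>PP"
    have FK: "F \<subseteq> K" using F by blast
    have finF: "finite F" using FK finK by (rule finite_subset)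
    have outside: "v \<notin> \<Union>(\<Union>PP)" if e: "e \<in> F" "v \<in> e" for e v
    proof
      assume "v \<in> \<Union>(\<Union>PP)"
      then obtain Q where Q: "Q \<in> PP" "v \<in> \<Union>Q" by blast
      obtain c d where cd: "c \<noteq> d" "{l\<in>Q. v \<in> l} = {c, d}"
        using pasch_two_lines[OF sub(2)[OF Q(1)] Q(2)] by blast
      have "c \<in> {l\<in>Q. v \<in> l}" "d \<in> {l\<in>Q. v \<in> l}" unfolding cd(2) by simp_all
      then have c: "c \<in> Q" "v \<in> c" "d \<in> Q" "v \<in> d" by simp_all
      have "e \<notin> Q" using e(1) F Q(1) by blast
      then have "e \<noteq> c" "e \<noteq> d" using c by auto
      moreover have "e \<in> K" "c \<in> K" "d \<in> K" using FK e(1) c sub(1)[OF Q(1)] by auto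
      ultimately show False using three[of e c d v] c e(2) cd(1) by simp
    qed
    let ?X = "\<Union>F"
    have XV: "?X \<subseteq> V" using FK V(2) by blast
    have finX: "finite ?X" using XV V(1) by (rule finite_subset)
    have W: "?X \<inter> (V - \<Union>(\<Union>PP)) = ?X" using XV outside by blast
    define X1 where "X1 = {v\<in>?X. card {e\<in>F. v \<in> e} = 1}"
    have X1X: "X1 \<subseteq> ?X" by (auto simp: X1_def)
    have finX1: "finite X1" using X1X finX by (rule finite_subset)
    have cardX1: "card F \<le> card X1"
    proof -
      have "\<forall>e\<in>F. \<exists>v. v \<in> private_points K e" using priv F by blast
      then obtain p where p: "\<And>e. e \<in> F \<Longrightarrow> p e \<in> private_points K e" by metis
      have only: "f = e" if "e \<in> F" "f \<in> F" "p e \<in> f" for e f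
      proof -
        have "f \<in> K" using that(2) FK by blast
        then show ?thesis using p[OF that(1)] that(3) by (simp add: private_points_def)
      qed
      have pe: "p e \<in> e" if "e \<in> F" for e using p[OF that] by (simp add: private_points_def)
      have "inj_on p F"
      proof (rule inj_onI)
        fix e f assume ef: "e \<in> F" "f \<in> F" "p e = p f"
        then have "p e \<in> f" using pe[of f] by simp
        then show "e = f" using only[of e f] ef by simp
      qed
      moreover have "p ` F \<subseteq> X1"
      proof
        fix v assume "v \<in> p ` F"
        then obtain e where e: "e \<in> F" "v = p e" by blast
        have "f \<in> {f\<in>F. v \<in> f} \<longleftrightarrow> f \<in> {e}" for f using only[OF e(1)] pe[OF e(1)] e by auto
        then have "{f\<in>F. v \<in> f} = {e}" by (rule set_eqI)
        moreover have "v \<in> ?X" using pe[OF e(1)] e by blast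
        ultimately show "v \<in> X1" by (simp add: X1_def)
      qed
      ultimately show ?thesis using finX1 by (intro card_inj_on_le)
    qed
    let ?w = "\<lambda>v. if v \<in> X1 then 1 else 2 :: nat"
    have le_w: "card {e\<in>F. v \<in> e} \<le> ?w v" if v: "v \<in> ?X" for v
    proof (cases "v \<in> X1")
      case True
      then show ?thesis by (simp add: X1_def)
    next
      case False
      obtain e where e: "e \<in> F" "v \<in> e" using v by blast
      have "\<exists>g. {e\<in>F. v \<in> e} \<subseteq> {e, g}"
      proof (cases "\<exists>g\<in>F. v \<in> g \<and> g \<noteq> e")
        case True
        then obtain g where g: "g \<in> F" "v \<in> g" "g \<noteq> e" by blast
        have "f \<in> {e, g}" if "f \<in> {e\<in>F. v \<in> e}" for f
          using three[of e g f v] e g that FK by auto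
        then show ?thesis by blast
      qed blast
      then obtain g where "{e\<in>F. v \<in> e} \<subseteq> {e, g}" by blast
      then have "card {e\<in>F. v \<in> e} \<le> card {e, g}" by (intro card_mono) simp
      also have "\<dots> \<le> 2" by (simp add: card_insert_if)
      finally show ?thesis using False by simp
    qed
    have sum_w: "(\<Sum>v\<in>?X. ?w v) + card X1 = 2 * card ?X" by (rule sum_one_two[OF finX X1X])
    have XV': "?X \<inter> V = ?X" using XV by blast
    have "(\<Sum>e\<in>F. card (e \<inter> V)) = (\<Sum>e\<in>F. 3)"
    proof (rule sum.cong[OF refl])
      fix e assume "e \<in> F"
      then have "e \<in> K" using FK by blast
      then have "e \<inter> V = e" "card e = 3" using V(2) good_edge_card[OF good] by blast+
      then show "card (e \<inter> V) = 3" by simp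
    qed
    then have "3 * card F = (\<Sum>v\<in>?X. card {e\<in>F. v \<in> e})"
      using double_count[OF finF V(1)] unfolding XV' by simp
    also have "\<dots> \<le> (\<Sum>v\<in>?X. ?w v)" by (rule sum_mono) (rule le_w)
    finally show "2 * card F \<le> card (?X \<inter> (V - \<Union>(\<Union>PP)))"
      unfolding W using sum_w cardX1 by linarith
  qed
  with pack show ?thesis
    unfolding avoider_invariant_def live_Pow[OF V(2)] by blast
qed

section \<open>Pruning and the characterization of the outcome\<close>

definition prune_step :: "'a set set \<Rightarrow> 'a set set \<Rightarrow> bool" where
  "prune_step K K' \<longleftrightarrow> (\<exists>e\<in>K. 2 \<le> card (private_points K e) \<and> K' = K - {e})"

lemma prune_steps_subset: "prune_step\<^sup>*\<^sup>* E K \<Longrightarrow> K \<subseteq> E"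
  by (induction rule: rtranclp_induct) (auto simp: prune_step_def)

lemma prune_steps_avoider_invariant:
  assumes "prune_step\<^sup>*\<^sup>* E K" "finite V" "E \<subseteq> Pow V" "avoider_invariant K {} V"
  shows "avoider_invariant E {} V"
  using assms
proof (induction rule: converse_rtranclp_induct)
  case (step E E')
  obtain e where e: "e \<in> E" "2 \<le> card (private_points E e)" "E' = E - {e}"
    using step(1) by (auto simp: prune_step_def)
  have E: "insert e E' = E" using e by blast
  have "avoider_invariant E' {} V" using step e(3) by blast
  then show ?case using avoider_invariant_insert[of V e E'] E e(2) step.prems by simp
qed

lemma linear_family_edges:
  assumes "hypergraph H" "linear_hypergraph H" "rank3_hypergraph H"
  shows "linear_family (edges H)"
  unfolding linear_family_def
proof (intro conjI ballI impI)
  fix e assume e: "e \<in> edges H"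
  have "finite (verts H)" "e \<subseteq> verts H" using assms(1) e by (auto simp: hypergraph_def)
  then show "finite e" by (rule finite_subset[rotated])
  show "card e \<le> 3" using e assms(3) by (simp add: rank3_hypergraph_def)
next
  fix e f assume "e \<in> edges H" "f \<in> edges H" "e \<noteq> f"
  then show "card (e \<inter> f) \<le> 1" using assms(2) by (simp add: linear_hypergraph_def)
qed

text \<open>The circle closes through \<open>only_pasch\<close>, which passes to subfamilies and so
  descends from the hypergraph to \<open>K\<close>, and through the invariant, which climbs back
  along the pruning steps. Nothing depends on the order of the removals.\<close>

lemma outcome_Avoider_iff_good:
  assumes H: "hypergraph H" "linear_hypergraph H" "rank3_hypergraph H"
    and K: "prune_step\<^sup>*\<^sup>* (edges H) K" and core: "\<And>e. e \<in> K \<Longrightarrow> card (private_points K e) \<le> 1"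
  shows "outcome_Avoider H \<longleftrightarrow> (\<forall>e\<in>K. good_edge K e)"
proof -
  let ?V = "verts H" let ?E = "edges H"
  have V: "finite ?V" "?E \<subseteq> Pow ?V" using H(1) by (simp_all add: hypergraph_def)
  have finE: "finite ?E" using V finite_subset by blast
  have lin: "linear_family ?E" by (rule linear_family_edges[OF H])
  have KE: "K \<subseteq> ?E" using K by (rule prune_steps_subset)
  have KV: "K \<subseteq> Pow ?V" using KE V(2) by blast
  have linK: "linear_family K" using lin KE by (rule linear_family_subset)
  note outcome = outcome_Avoider_iff[OF V(1)]
  show ?thesis
  proof
    assume "outcome_Avoider H"
    then have win: "avoider_wins ?E (card ?V) (if even (card ?V) then Enforcer else Avoider) {} ?V"
      using outcome by (cases "even (card ?V)") simp_all
    have "only_pasch ?E"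
    proof (rule ccontr)
      assume "\<not> only_pasch ?E"
      from only_pasch_or_threat[OF V lin this] have "threat ?E {} ?V" .
      from threat_avoider_loses[OF finE lin V(1) this refl] win show False by blast
    qed
    then have "only_pasch K" using KE by (rule only_pasch_subset)
    then have inv: "avoider_invariant K {} ?V" by (rule only_pasch_invariant[OF V(1) KV])
    show "\<forall>e\<in>K. good_edge K e" using avoider_invariant_good[OF V(1) KV linK core inv] by blast
  next
    assume "\<forall>e\<in>K. good_edge K e"
    then have "avoider_invariant K {} ?V" by (intro good_avoider_invariant[OF V(1) KV linK]) blast
    then have "avoider_invariant ?E {} ?V" by (rule prune_steps_avoider_invariant[OF K V])
    from avoider_invariant_wins[OF finE V(1) _ this refl]
    have "avoider_wins ?E (card ?V) (if even (card ?V) then Enforcer else Avoider) {} ?V" by simp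
    then show "outcome_Avoider H" using outcome by (cases "even (card ?V)") simp_all
  qed
qed

section \<open>Structured programs for Turing machines\<close>

text \<open>The tapes 0 to 4 carry copies of the matrix and the tapes 5 to 19 are registers of one
  cell. Beyond the blank and the input letters, the symbol 4 marks a removed edge.\<close>

definition ntapes :: nat where "ntapes = 20"
definition nsyms :: nat where "nsyms = 6"

type_synonym mem = "nat \<Rightarrow> tape"

definition reads :: "mem \<Rightarrow> nat \<Rightarrow> nat" where
  "reads \<sigma> i = (if i < ntapes then read_tape (\<sigma> i) else 0)"

definition act_mem :: "(nat \<Rightarrow> nat \<times> direction) \<Rightarrow> mem \<Rightarrow> mem" where
  "act_mem g \<sigma> = (\<lambda>i. if i < ntapes then act_tape (g i) (\<sigma> i) else \<sigma> i)"

datatype prog =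
    Act "(nat \<Rightarrow> nat) \<Rightarrow> nat \<Rightarrow> nat \<times> direction"
  | Seq prog prog
  | While "(nat \<Rightarrow> nat) \<Rightarrow> bool" prog

text \<open>The count is exact: an action and each evaluation of a loop test take one machine step,
  so \<open>exec_code\<close> can iterate the step function exactly \<open>t\<close> times.\<close>

inductive exec :: "prog \<Rightarrow> mem \<Rightarrow> nat \<Rightarrow> mem \<Rightarrow> bool" where
  exec_Act: "exec (Act g) \<sigma> 1 (act_mem (g (reads \<sigma>)) \<sigma>)"
| exec_Seq: "exec p \<sigma> s \<sigma>' \<Longrightarrow> exec q \<sigma>' t \<sigma>'' \<Longrightarrow> exec (Seq p q) \<sigma> (s + t) \<sigma>''"
| exec_While_False: "\<not> c (reads \<sigma>) \<Longrightarrow> exec (While c p) \<sigma> 1 \<sigma>"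
| exec_While_True: "c (reads \<sigma>) \<Longrightarrow> exec p \<sigma> s \<sigma>' \<Longrightarrow> exec (While c p) \<sigma>' t \<sigma>'' \<Longrightarrow>
    exec (While c p) \<sigma> (1 + s + t) \<sigma>''"

primrec code_size :: "prog \<Rightarrow> nat" where
  "code_size (Act g) = 1"
| "code_size (Seq p q) = code_size p + code_size q"
| "code_size (While c p) = 1 + code_size p"

definition symbol_at :: "nat list \<Rightarrow> nat \<Rightarrow> nat" where
  "symbol_at ss i = (if i < ntapes then ss ! i else 0)"

definition keep :: "nat list \<Rightarrow> (nat \<times> direction) list" where
  "keep ss = map (\<lambda>s. (s, Stay)) ss"

text \<open>The code of a program occupies the states from \<open>b\<close> on and leaves to the state \<open>x\<close>.\<close>

primrec code :: "prog \<Rightarrow> nat \<Rightarrow> nat \<Rightarrow> nat \<Rightarrow> nat list \<Rightarrow> nat \<times> (nat \<times> direction) list" where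
  "code (Act g) b x q ss = (x, map (g (symbol_at ss)) [0..<ntapes])"
| "code (Seq p p') b x q ss =
     (if q < b + code_size p then code p b (b + code_size p) q ss
      else code p' (b + code_size p) x q ss)"
| "code (While c p) b x q ss =
     (if q = b then (if c (symbol_at ss) then b + 1 else x, keep ss) else code p (b + 1) b q ss)"

abbreviation tapes :: "mem \<Rightarrow> tape list" where
  "tapes \<sigma> \<equiv> map \<sigma> [0..<ntapes]"

lemma symbol_at_tapes: "symbol_at (map read_tape (tapes \<sigma>)) = reads \<sigma>"
  by (auto simp: symbol_at_def reads_def)

lemma act_tape_read: "act_tape (read_tape t, Stay) t = t"
  by (cases t) auto

lemma map2_keep: "map2 act_tape (keep (map read_tape ts)) ts = ts"
  by (induction ts) (auto simp: keep_def act_tape_read)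

lemma map2_act_tapes: "map2 act_tape (map g [0..<ntapes]) (tapes \<sigma>) = tapes (act_mem g \<sigma>)"
  by (rule nth_equalityI) (auto simp: act_mem_def)

lemma funpow_add_eq: "(f ^^ s) a = b \<Longrightarrow> (f ^^ t) b = c \<Longrightarrow> (f ^^ (s + t)) a = c"
  by (subst add.commute) (simp add: funpow_add)

lemma code_size_pos: "code_size p > 0"
  by (induction p) auto

lemma step_transition:
  assumes "3 \<le> q" "transition M q (map read_tape ts) = (q', acts)"
  shows "step M (q, ts) = (q', map2 act_tape acts ts)"
  using assms by simp

text \<open>Start and exit are arbitrary because the pieces are glued along them: the first part of
  a sequence exits to the start of the second, and a loop body exits to the test of its loop.
  \<open>3 \<le> b\<close> keeps the code clear of the halting states.\<close>

lemma exec_code: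
  assumes "exec p \<sigma> t \<sigma>'" "3 \<le> b"
    and "\<And>q ss. b \<le> q \<Longrightarrow> q < b + code_size p \<Longrightarrow> transition M q ss = code p b x q ss"
  shows "(step M ^^ t) (b, tapes \<sigma>) = (x, tapes \<sigma>')"
  using assms
proof (induction arbitrary: b x rule: exec.induct)
  case (exec_Act g \<sigma>)
  have "transition M b (map read_tape (tapes \<sigma>)) = (x, map (g (reads \<sigma>)) [0..<ntapes])"
    using exec_Act(2)[of b "map read_tape (tapes \<sigma>)"] by (simp only: code.simps symbol_at_tapes) simp
  from step_transition[OF exec_Act(1) this] show ?case
    by (simp only: map2_act_tapes) simp
next
  case (exec_Seq p \<sigma> s \<sigma>' q t \<sigma>'')
  have "(step M ^^ s) (b, tapes \<sigma>) = (b + code_size p, tapes \<sigma>')"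
    by (rule exec_Seq.IH(1)) (use exec_Seq.prems in \<open>auto\<close>)
  moreover have "(step M ^^ t) (b + code_size p, tapes \<sigma>') = (x, tapes \<sigma>'')"
    by (rule exec_Seq.IH(2)) (use exec_Seq.prems in \<open>auto\<close>)
  ultimately show ?case by (rule funpow_add_eq)
next
  case (exec_While_False c \<sigma> p)
  have "transition M b (map read_tape (tapes \<sigma>)) = (x, keep (map read_tape (tapes \<sigma>)))"
    using exec_While_False(3)[of b "map read_tape (tapes \<sigma>)"] exec_While_False(1)
    by (simp only: code.simps symbol_at_tapes) simp
  from step_transition[OF exec_While_False(2) this] show ?case
    by (simp only: map2_keep) simp
next
  case (exec_While_True c \<sigma> p s \<sigma>' t \<sigma>'')
  have "transition M b (map read_tape (tapes \<sigma>)) = (b + 1, keep (map read_tape (tapes \<sigma>)))"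
    using exec_While_True.prems(2)[of b "map read_tape (tapes \<sigma>)"] exec_While_True.hyps(1)
    by (simp only: code.simps symbol_at_tapes) simp
  from step_transition[OF exec_While_True.prems(1) this]
  have 1: "(step M ^^ 1) (b, tapes \<sigma>) = (b + 1, tapes \<sigma>)"
    by (simp only: map2_keep) simp
  have 2: "(step M ^^ s) (b + 1, tapes \<sigma>) = (b, tapes \<sigma>')"
    by (rule exec_While_True.IH(1)) (use exec_While_True.prems in \<open>auto\<close>)
  have 3: "(step M ^^ t) (b, tapes \<sigma>') = (x, tapes \<sigma>'')"
    by (rule exec_While_True.IH(2)) (use exec_While_True.prems in \<open>auto\<close>)
  show ?case by (rule funpow_add_eq[OF funpow_add_eq[OF 1 2] 3])
qed

primrec wf_prog :: "prog \<Rightarrow> bool" where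
  "wf_prog (Act g) \<longleftrightarrow> (\<forall>\<rho> i. (\<forall>k. \<rho> k < nsyms) \<longrightarrow> fst (g \<rho> i) < nsyms)"
| "wf_prog (Seq p q) \<longleftrightarrow> wf_prog p \<and> wf_prog q"
| "wf_prog (While c p) \<longleftrightarrow> wf_prog p"

lemma symbol_at_less:
  "length ss = ntapes \<Longrightarrow> \<forall>s\<in>set ss. s < nsyms \<Longrightarrow> symbol_at ss i < nsyms"
  by (auto simp: symbol_at_def nsyms_def)

lemma code_valid:
  assumes "wf_prog p" "b \<le> q" "q < b + code_size p"
    and ss: "length ss = ntapes" "\<forall>s\<in>set ss. s < nsyms"
    and "b + code_size p \<le> Q" "x < Q"
  shows "fst (code p b x q ss) < Q \<and> length (snd (code p b x q ss)) = ntapes \<and>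
    (\<forall>a\<in>set (snd (code p b x q ss)). fst a < nsyms)"
  using assms(1-3,6,7)
proof (induction p arbitrary: b x)
  case (Act g)
  then show ?case using symbol_at_less[OF ss] by auto
next
  case (Seq p1 p2)
  show ?case
  proof (cases "q < b + code_size p1")
    case True
    then show ?thesis using Seq.prems Seq.IH(1)[of b "b + code_size p1"] code_size_pos[of p2] by auto
  next
    case False
    then show ?thesis using Seq.prems Seq.IH(2)[of "b + code_size p1" x] by auto
  qed
next
  case (While c p)
  show ?case
  proof (cases "q = b")
    case True
    then show ?thesis using While.prems ss code_size_pos[of p] by (auto simp: keep_def)
  next
    case False
    then show ?thesis using While.prems While.IH[of "b + 1" b] by auto
  qed
qed

text \<open>The code starts at state 3, and state \<open>3 + code_size p\<close> reads the verdict
  from register \<open>v\<close>, where 0 means acceptance. Entering the code and giving the verdict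
  are the two extra steps in \<open>machine_state_after\<close>.\<close>

definition machine :: "nat \<Rightarrow> prog \<Rightarrow> turing_machine" where
  "machine v p =
    \<lparr>num_tapes = ntapes, num_states = 4 + code_size p, num_symbols = nsyms,
     transition = (\<lambda>q ss. if q < 3 then (3, keep ss)
       else if q < 3 + code_size p then code p 3 (3 + code_size p) q ss
       else (if symbol_at ss v = 0 then accept_state else reject_state, keep ss))\<rparr>"

lemma turing_machine_machine:
  assumes "wf_prog p"
  shows "turing_machine (machine v p)"
proof -
  have *: "fst (transition (machine v p) q ss) < 4 + code_size p \<and>
        length (snd (transition (machine v p) q ss)) = ntapes \<and>
        (\<forall>a\<in>set (snd (transition (machine v p) q ss)). fst a < nsyms)"
    if "length ss = ntapes" "\<forall>s\<in>set ss. s < nsyms" for q ss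
    using code_valid[OF assms, of 3 q ss "4 + code_size p" "3 + code_size p"] that
    by (auto simp: machine_def keep_def)
  have num: "num_tapes (machine v p) = ntapes" "num_states (machine v p) = 4 + code_size p"
    "num_symbols (machine v p) = nsyms"
    by (simp_all add: machine_def)
  have "1 \<le> ntapes" "3 \<le> 4 + code_size p" "4 \<le> nsyms"
    by (simp_all add: ntapes_def nsyms_def)
  then show ?thesis
    unfolding turing_machine_def num using * by blast
qed

definition initial_mem :: "nat list \<Rightarrow> mem" where
  "initial_mem w i = (if i = 0 then input_tape w else blank_tape)"

lemma machine_state_after:
  assumes "exec p (initial_mem w) t \<sigma>" "v < ntapes"
  shows "state_after (machine v p) w (t + 2) =
    (if read_tape (\<sigma> v) = 0 then accept_state else reject_state)"
proof -
  let ?M = "machine v p"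
  have init: "initial_config ?M w = (0, tapes (initial_mem w))"
  proof -
    have "[0..<ntapes] = 0 # [1..<ntapes]" by (simp add: ntapes_def upt_conv_Cons)
    then show ?thesis
      by (auto simp: initial_config_def initial_mem_def machine_def map_replicate_const
          intro!: nth_equalityI)
  qed
  have 1: "(step ?M ^^ 1) (initial_config ?M w) = (3, tapes (initial_mem w))"
    unfolding init by (simp add: machine_def map2_keep del: map_map)
  have 2: "(step ?M ^^ t) (3, tapes (initial_mem w)) = (3 + code_size p, tapes \<sigma>)"
    by (rule exec_code[OF assms(1)]) (auto simp: machine_def)
  have 3: "(step ?M ^^ 1) (3 + code_size p, tapes \<sigma>) =
    (if read_tape (\<sigma> v) = 0 then accept_state else reject_state, tapes \<sigma>)"
  proof -
    have "transition ?M (3 + code_size p) (map read_tape (tapes \<sigma>)) =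
      (if read_tape (\<sigma> v) = 0 then accept_state else reject_state, keep (map read_tape (tapes \<sigma>)))"
      using assms(2) by (simp add: machine_def symbol_at_tapes reads_def del: map_map)
    from step_transition[OF _ this] show ?thesis by (simp only: map2_keep) simp
  qed
  have "(step ?M ^^ (1 + t + 1)) (initial_config ?M w) =
    (if read_tape (\<sigma> v) = 0 then accept_state else reject_state, tapes \<sigma>)"
    by (rule funpow_add_eq[OF funpow_add_eq[OF 1 2] 3])
  then show ?thesis by (simp add: state_after_def)
qed

section \<open>Programs on incidence matrices\<close>

definition runs :: "prog \<Rightarrow> mem \<Rightarrow> nat \<Rightarrow> mem \<Rightarrow> bool" where
  "runs p \<sigma> t \<sigma>' \<longleftrightarrow> (\<exists>s\<le>t. exec p \<sigma> s \<sigma>')"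

lemma runs_Act: "\<sigma>' = act_mem (g (reads \<sigma>)) \<sigma> \<Longrightarrow> runs (Act g) \<sigma> 1 \<sigma>'"
  unfolding runs_def using exec_Act by blast

lemma runs_Seq:
  assumes "runs p \<sigma> s \<sigma>'" "runs q \<sigma>' t \<sigma>''"
  shows "runs (Seq p q) \<sigma> (s + t) \<sigma>''"
proof -
  obtain s' t' where "s' \<le> s" "exec p \<sigma> s' \<sigma>'" "t' \<le> t" "exec q \<sigma>' t' \<sigma>''"
    using assms by (auto simp: runs_def)
  then show ?thesis
    unfolding runs_def by (intro exI[of _ "s' + t'"]) (auto intro: exec_Seq)
qed

lemma runs_mono: "runs p \<sigma> s \<sigma>' \<Longrightarrow> s \<le> t \<Longrightarrow> runs p \<sigma> t \<sigma>'"
  by (auto simp: runs_def intro: order_trans)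

lemma runs_While:
  assumes step: "\<And>i. i < k \<Longrightarrow> c (reads (f i)) \<and> runs p (f i) t (f (Suc i))"
    and stop: "\<not> c (reads (f k))"
  shows "runs (While c p) (f 0) (k * (t + 1) + 1) (f k)"
proof -
  \<comment> \<open>The execution of a loop is built from its end, hence the induction on the number
    \<open>i\<close> of iterations still to come.\<close>
  have "runs (While c p) (f (k - i)) (i * (t + 1) + 1) (f k)" if "i \<le> k" for i
    using that
  proof (induction i)
    case 0
    then show ?case using stop exec_While_False[of c "f k" p] by (auto simp: runs_def)
  next
    case (Suc i)
    have eq: "Suc (k - Suc i) = k - i" using Suc.prems by simp
    have c: "c (reads (f (k - Suc i)))" and "runs p (f (k - Suc i)) t (f (k - i))"
      using step[of "k - Suc i"] Suc.prems eq by auto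
    then obtain s where s: "s \<le> t" "exec p (f (k - Suc i)) s (f (k - i))"
      by (auto simp: runs_def)
    obtain s' where s': "s' \<le> i * (t + 1) + 1" "exec (While c p) (f (k - i)) s' (f k)"
      using Suc by (auto simp: runs_def)
    show ?case
      unfolding runs_def
      by (rule exI[of _ "1 + s + s'"]) (use s s' exec_While_True[OF c s(2) s'(2)] in auto)
  qed
  from this[of k] show ?thesis by simp
qed

section \<open>Row programs and their compilation\<close>

datatype row_prog =
    Upd "(nat \<Rightarrow> nat) \<Rightarrow> nat \<Rightarrow> nat"
  | Pass "(nat \<Rightarrow> nat) \<Rightarrow> nat \<Rightarrow> nat"
  | For nat row_prog
  | RSeq row_prog row_prog

abbreviation matrix_tape :: "nat \<Rightarrow> bool" where "matrix_tape i \<equiv> i < 5"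

text \<open>Cutting off at \<open>ntapes\<close> makes the view of the abstract cells equal to
  \<open>reads\<close>, which is 0 there as well.\<close>

definition mask :: "(nat \<Rightarrow> nat) \<Rightarrow> nat \<Rightarrow> nat" where
  "mask \<rho> = (\<lambda>i. if i < ntapes then \<rho> i else 0)"

definition in_row :: "nat \<Rightarrow> bool" where "in_row s \<longleftrightarrow> s = 1 \<or> s = 2"

definition move_tape :: "nat \<Rightarrow> direction \<Rightarrow> prog" where
  "move_tape i d = Act (\<lambda>\<rho> k. (\<rho> k, if k = i then d else Stay))"

definition move_all :: "direction \<Rightarrow> prog" where
  "move_all d = Act (\<lambda>\<rho> k. (\<rho> k, if matrix_tape k then d else Stay))"

definition next_row :: "nat \<Rightarrow> prog" where
  "next_row i = Seq (move_tape i Move_Right) (While (\<lambda>\<rho>. in_row (\<rho> i)) (move_tape i Move_Right))"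

text \<open>No cell of the word is blank, so the walk to the left ends at position -1. That blank
  counts as the separator of row 0, and \<open>next_row\<close> skips the unary prefix from it to
  row 1.\<close>

definition rewind :: "nat \<Rightarrow> prog" where
  "rewind i = Seq (Seq (move_tape i Move_Left) (While (\<lambda>\<rho>. \<rho> i \<noteq> 0) (move_tape i Move_Left))) (next_row i)"

definition for_rows :: "nat \<Rightarrow> prog \<Rightarrow> prog" where
  "for_rows i p = Seq (While (\<lambda>\<rho>. \<rho> i \<noteq> 0) (Seq p (next_row i))) (rewind i)"

text \<open>All rows have the same length, so the matrix heads sweep in step and tape 0 alone
  decides when to turn back. Nothing is written on the matrix tapes but what was read.\<close>

definition pass_columns :: "((nat \<Rightarrow> nat) \<Rightarrow> nat \<Rightarrow> nat) \<Rightarrow> prog" where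
  "pass_columns u =
     Seq (Seq (move_all Move_Right)
       (While (\<lambda>\<rho>. in_row (\<rho> 0))
         (Act (\<lambda>\<rho> k. if matrix_tape k then (\<rho> k, Move_Right) else (u \<rho> k, Stay)))))
     (Seq (move_all Move_Left) (While (\<lambda>\<rho>. in_row (\<rho> 0)) (move_all Move_Left)))"

text \<open>Every compiled piece leaves each matrix head on the separator where it found it. Between
  pieces the heads are therefore described by row numbers alone.\<close>

primrec compile :: "row_prog \<Rightarrow> prog" where
  "compile (Upd g) = Act (\<lambda>\<rho> k. (g \<rho> k, Stay))"
| "compile (Pass u) = pass_columns u"
| "compile (For i p) = for_rows i (compile p)"
| "compile (RSeq p q) = Seq (compile p) (compile q)"

text \<open>\<open>U\<close> collects the tapes of the surrounding loops. A loop needs its own tape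
  at row 1, hence \<open>i \<notin> U\<close>; a pass needs actual rows under all heads, and being
  inside some loop guarantees that there are any. An update may exchange one separator for another
  but may neither create nor destroy one.\<close>

primrec ok_prog :: "row_prog \<Rightarrow> nat set \<Rightarrow> bool" where
  "ok_prog (Upd g) U \<longleftrightarrow> (\<forall>\<rho> i. matrix_tape i \<longrightarrow> g \<rho> i = \<rho> i \<or> 3 \<le> \<rho> i \<and> 3 \<le> g \<rho> i)"
| "ok_prog (Pass u) U \<longleftrightarrow> U \<noteq> {}"
| "ok_prog (For i p) U \<longleftrightarrow> matrix_tape i \<and> i \<notin> U \<and> ok_prog p (insert i U)"
| "ok_prog (RSeq p q) U \<longleftrightarrow> ok_prog p U \<and> ok_prog q U"

text \<open>The argument is \<open>size_bound\<close>. A pass takes at most \<open>4 * n + 6\<close>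
  steps, an advance to the next row \<open>2 * n + 2\<close>, and a rewind
  \<open>4 * size_bound + 4\<close>.\<close>

primrec time_bound :: "row_prog \<Rightarrow> nat poly" where
  "time_bound (Upd g) = 1"
| "time_bound (Pass u) = [:6, 4:]"
| "time_bound (For i p) = [:0, 1:] * (time_bound p + [:3, 2:]) + [:5, 4:]"
| "time_bound (RSeq p q) = time_bound p + time_bound q"

section \<open>Simulation of row programs on tapes\<close>

lemma fold_invariant_upt:
  assumes "P (l::nat) x" "l \<le> k" "\<And>j x. l \<le> j \<Longrightarrow> j < k \<Longrightarrow> P j x \<Longrightarrow> P (Suc j) (f j x)"
  shows "P k (fold f [l..<k] x)"
  using assms(2,1,3)
proof (induction k rule: dec_induct)
  case base
  then show ?case by simp
next
  case (step k)
  then show ?case by simp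
qed

text \<open>Row 0 of an input is its unary prefix, and the rows from 1 to \<open>m\<close> are the edges. The separator in front of
  row \<open>j\<close> is at position \<open>j * (n + 1) - 1\<close>; it is blank for \<open>j = 0\<close> and \<open>j = m + 1\<close>, and otherwise it records whether
  the edge has been removed. The cell \<open>(i, j)\<close> of the abstract state is this separator on a matrix tape \<open>i\<close>,
  while a register tape \<open>i\<close> has only the cell \<open>(i, 0)\<close>.\<close>

type_synonym cells = "nat \<Rightarrow> nat \<Rightarrow> nat"

locale rows =
  fixes n m :: nat and B :: "nat \<Rightarrow> nat \<Rightarrow> nat"
  assumes bits: "j \<le> m \<Longrightarrow> 1 \<le> r \<Longrightarrow> r \<le> n \<Longrightarrow> in_row (B j r)"
    and bits_outside: "m < j \<Longrightarrow> B j r = 0"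
begin

text \<open>\<open>J i\<close> is the row under the head of a matrix tape \<open>i\<close> and 0 for
  a register, so \<open>a i (J i)\<close> is the visible cell in both cases. Time, head movements
  and the layout of the word have disappeared.\<close>

primrec den :: "row_prog \<Rightarrow> (nat \<Rightarrow> nat) \<Rightarrow> cells \<Rightarrow> cells" where
  "den (Upd g) J a = (\<lambda>i. if i < ntapes then (a i)(J i := g (mask (\<lambda>k. a k (J k))) i) else a i)"
| "den (Pass u) J a = fold (\<lambda>r a i. if 5 \<le> i \<and> i < ntapes
      then (a i)(0 := u (mask (\<lambda>k. if matrix_tape k then B (J k) r else a k 0)) i) else a i) [1..<n + 1] a"
| "den (For i p) J a = fold (\<lambda>j. den p (J(i := j))) [1..<m + 1] a"
| "den (RSeq p q) J a = den q J (den p J a)"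

definition pos :: "nat \<Rightarrow> int" where
  "pos j = int (j * (n + 1)) - 1"

definition cont :: "(nat \<Rightarrow> nat) \<Rightarrow> int \<Rightarrow> nat" where
  "cont \<alpha> p = (if p < -1 then 0 else let q = nat (p + 1) in
     if q mod (n + 1) = 0 then \<alpha> (q div (n + 1)) else B (q div (n + 1)) (q mod (n + 1)))"

text \<open>\<open>d\<close> is the offset of a head from the separator of its row. It differs from
  0 only in the middle of a compiled piece.\<close>

definition conc :: "cells \<Rightarrow> (nat \<Rightarrow> nat) \<Rightarrow> (nat \<Rightarrow> int) \<Rightarrow> mem" where
  "conc a J d = (\<lambda>i. if matrix_tape i then (cont (a i), pos (J i) + d i)
     else ((\<lambda>p. if p = 0 then a i 0 else 0), 0))"

lemma cont_pos:
  assumes "r \<le> n"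
  shows "cont \<alpha> (pos j + int r) = (if r = 0 then \<alpha> j else B j r)"
proof -
  have "nat (pos j + int r + 1) = j * (n + 1) + r" unfolding pos_def by linarith
  moreover have "\<not> pos j + int r < -1" unfolding pos_def by linarith
  ultimately show ?thesis using assms
    by (simp add: cont_def Let_def del: mult_Suc_right)
qed

lemma cont_pos0: "cont \<alpha> (pos j) = \<alpha> j"
  using cont_pos[of 0 \<alpha> j] by simp

lemma cont_upd: "(cont \<alpha>)(pos j := x) = cont (\<alpha>(j := x))"
proof
  fix p
  show "((cont \<alpha>)(pos j := x)) p = cont (\<alpha>(j := x)) p"
  proof (cases "p < -1")
    case True
    then have "p \<noteq> pos j" unfolding pos_def by linarith
    with True show ?thesis by (simp add: cont_def)
  next
    case False
    define q where "q = nat (p + 1)"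
    have "p = pos (q div (n + 1)) + int (q mod (n + 1))"
      using False div_mult_mod_eq[of q "n + 1"] unfolding pos_def q_def by linarith
    moreover have "q mod (n + 1) \<le> n" using mod_less_divisor[of "n + 1" q] by linarith
    ultimately obtain k r where p: "p = pos k + int r" and r: "r \<le> n" by blast
    have "p = pos j \<longleftrightarrow> r = 0 \<and> k = j"
    proof
      assume "p = pos j"
      then have *: "k * (n + 1) + r = j * (n + 1)" using p unfolding pos_def by linarith
      then have "(k * (n + 1) + r) mod (n + 1) = 0" by (metis mod_mult_self2_is_0)
      then have "r mod (n + 1) = 0" by (simp only: mod_mult_self3)
      then have "r = 0" using r by simp
      then show "r = 0 \<and> k = j" using * by (metis Nat.add_0_right Suc_eq_plus1 mult_cancel2 nat.distinct(1))
    qed (use p in auto)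
    then show ?thesis using cont_pos[OF r] p by (auto simp: cont_pos0)
  qed
qed

lemma pos_Suc: "pos (Suc j) = pos j + int (n + 1)"
  unfolding pos_def by simp

lemma reads_conc:
  "reads (conc a J d) i = (if i < ntapes then if matrix_tape i then cont (a i) (pos (J i) + d i) else a i 0 else 0)"
  by (auto simp: reads_def conc_def)

lemma reads_conc0:
  assumes "\<And>i. \<not> matrix_tape i \<Longrightarrow> J i = 0"
  shows "reads (conc a J (\<lambda>_. 0)) = mask (\<lambda>k. a k (J k))"
  using assms by (auto simp: reads_conc mask_def cont_pos0)

lemma ntapes_ge: "5 \<le> ntapes" by (simp add: ntapes_def)

definition ok_cells :: "cells \<Rightarrow> bool" where
  "ok_cells a \<longleftrightarrow> (\<forall>i<5. a i 0 = 0 \<and> (\<forall>j. 1 \<le> j \<and> j \<le> m \<longrightarrow> 3 \<le> a i j) \<and> a i (m + 1) = 0)"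

lemma runs_move_tape:
  assumes "matrix_tape i"
  shows "runs (move_tape i dir) (conc a J d) 1 (conc a J (d(i := move_head dir (d i))))"
  unfolding move_tape_def
proof (rule runs_Act)
  show "conc a J (d(i := move_head dir (d i))) =
    act_mem (\<lambda>k. (reads (conc a J d) k, if k = i then dir else Stay)) (conc a J d)"
    using assms ntapes_ge by (cases dir) (auto simp: act_mem_def conc_def reads_def fun_eq_iff)
qed

lemma runs_move_all:
  shows "runs (move_all dir) (conc a J d) 1 (conc a J (\<lambda>i. move_head dir (d i)))"
  unfolding move_all_def
proof (rule runs_Act)
  show "conc a J (\<lambda>i. move_head dir (d i)) =
    act_mem (\<lambda>k. (reads (conc a J d) k, if matrix_tape k then dir else Stay)) (conc a J d)"
    using ntapes_ge by (cases dir) (auto simp: act_mem_def conc_def reads_def fun_eq_iff)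
qed

lemma runs_next_row:
  assumes "matrix_tape i" "ok_cells a" "J i \<le> m"
  shows "runs (next_row i) (conc a J (\<lambda>_. 0)) (2 * n + 2) (conc a (J(i := Suc (J i))) (\<lambda>_. 0))"
proof -
  define f where "f k = conc a J ((\<lambda>_. 0)(i := int (Suc k)))" for k
  have 1: "runs (move_tape i Move_Right) (conc a J (\<lambda>_. 0)) 1 (f 0)"
    using runs_move_tape[OF assms(1), of Move_Right a J "\<lambda>_. 0"] by (simp add: f_def)
  have 2: "runs (While (\<lambda>\<rho>. in_row (\<rho> i)) (move_tape i Move_Right)) (f 0) (n * (1 + 1) + 1) (f n)"
  proof (rule runs_While)
    fix k assume k: "k < n"
    have "in_row (reads (f k) i)"
      using assms ntapes_ge k cont_pos[of "Suc k" "a i" "J i"] bits[of "J i" "Suc k"]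
      by (simp add: f_def reads_conc)
    moreover have "runs (move_tape i Move_Right) (f k) 1 (f (Suc k))"
      using runs_move_tape[OF assms(1), of Move_Right a J "(\<lambda>_. 0)(i := int (Suc k))"]
      by (simp add: f_def add.commute)
    ultimately show "in_row (reads (f k) i) \<and> runs (move_tape i Move_Right) (f k) 1 (f (Suc k))" ..
  next
    have "pos (J i) + (1 + int n) = pos (Suc (J i))" by (simp add: pos_Suc)
    moreover have "\<not> in_row (a i (Suc (J i)))"
    proof -
      have "a i (Suc (J i)) \<ge> 3 \<or> a i (Suc (J i)) = 0"
        using assms by (cases "J i = m") (auto simp: ok_cells_def)
      then show ?thesis by (auto simp: in_row_def)
    qed
    ultimately show "\<not> in_row (reads (f n) i)"
      using assms by (simp add: f_def reads_conc cont_pos0 in_row_def)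
  qed
  have 3: "f n = conc a (J(i := Suc (J i))) (\<lambda>_. 0)"
    using assms(1) by (auto simp: f_def conc_def pos_Suc)
  show ?thesis
    unfolding next_row_def using runs_mono[OF runs_Seq[OF 1 2]] by (simp add: 3)
qed

lemma cont_nonzero:
  assumes "matrix_tape i" "ok_cells a" "0 \<le> p" "p < pos (m + 1)"
  shows "cont (a i) p \<noteq> 0"
proof -
  define q where "q = nat (p + 1)"
  define j where "j = q div (n + 1)"
  define r where "r = q mod (n + 1)"
  have q: "q = j * (n + 1) + r" unfolding j_def r_def by (simp only: div_mult_mod_eq)
  have r: "r \<le> n" using mod_less_divisor[of "n + 1" q] unfolding r_def by linarith
  have "q < (m + 1) * (n + 1)"
    using assms(3,4) unfolding q_def pos_def by (subst nat_less_iff) linarith+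
  then have j: "j \<le> m" unfolding j_def using less_mult_imp_div_less[of q "m + 1" "n + 1"] by linarith
  have p: "p = pos j + int r" using q assms(3) unfolding q_def pos_def by linarith
  have "r = 0 \<longrightarrow> j \<noteq> 0" using p assms(3) unfolding pos_def by (cases j) auto
  moreover have "3 \<le> a i j" if "j \<noteq> 0"
    using assms(1,2) j that by (auto simp: ok_cells_def)
  ultimately show ?thesis
    unfolding p cont_pos[OF r] using j r bits[of j r] by (auto simp: in_row_def Suc_le_eq)
qed

text \<open>This is one more than the length of the input word, which is
  \<open>pos (m + 1)\<close>.\<close>

definition size_bound :: nat where "size_bound = (m + 1) * (n + 1)"

lemma size_bounds: "n \<le> size_bound" "m \<le> size_bound" "1 \<le> size_bound"
  unfolding size_bound_def by auto

lemma runs_rewind: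
  assumes "matrix_tape i" "ok_cells a" "J i = m + 1"
  shows "runs (rewind i) (conc a J (\<lambda>_. 0)) (4 * size_bound + 4) (conc a (J(i := 1)) (\<lambda>_. 0))"
proof -
  define k where "k = nat (pos (m + 1))"
  have k: "int k = pos (m + 1)" unfolding k_def pos_def by simp
  define f where "f l = conc a J ((\<lambda>_. 0)(i := - int (Suc l)))" for l
  have 1: "runs (move_tape i Move_Left) (conc a J (\<lambda>_. 0)) 1 (f 0)"
    using runs_move_tape[OF assms(1), of Move_Left a J "\<lambda>_. 0"] by (simp add: f_def)
  have 2: "runs (While (\<lambda>\<rho>. \<rho> i \<noteq> 0) (move_tape i Move_Left)) (f 0) (k * (1 + 1) + 1) (f k)"
  proof (rule runs_While)
    fix l assume l: "l < k"
    have "reads (f l) i \<noteq> 0"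
      using assms ntapes_ge l k cont_nonzero[OF assms(1,2), of "pos (m + 1) + (- 1 - int l)"]
      by (simp add: f_def reads_conc)
    moreover have "runs (move_tape i Move_Left) (f l) 1 (f (Suc l))"
      using runs_move_tape[OF assms(1), of Move_Left a J "(\<lambda>_. 0)(i := - int (Suc l))"]
      by (simp add: f_def algebra_simps)
    ultimately show "reads (f l) i \<noteq> 0 \<and> runs (move_tape i Move_Left) (f l) 1 (f (Suc l))" ..
  next
    have "cont (a i) (-1) = 0"
      using cont_pos0[of "a i" 0] assms by (simp add: pos_def ok_cells_def)
    then show "\<not> reads (f k) i \<noteq> 0"
      using assms k by (simp add: f_def reads_conc)
  qed
  have 3: "f k = conc a (J(i := 0)) (\<lambda>_. 0)"
    using assms k by (auto simp: f_def conc_def pos_def fun_eq_iff distrib_right)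
  have 4: "runs (next_row i) (conc a (J(i := 0)) (\<lambda>_. 0)) (2 * n + 2) (conc a (J(i := 1)) (\<lambda>_. 0))"
    using runs_next_row[OF assms(1,2), of "J(i := 0)"] by simp
  have "k < size_bound" using k unfolding pos_def size_bound_def by linarith
  then show ?thesis
    unfolding rewind_def using runs_mono[OF runs_Seq[OF runs_Seq[OF 1 2, unfolded 3] 4]] size_bounds(1) by simp
qed

lemma runs_Upd:
  assumes J: "\<And>i. \<not> matrix_tape i \<Longrightarrow> J i = 0"
  shows "runs (compile (Upd g)) (conc a J (\<lambda>_. 0)) 1 (conc (den (Upd g) J a) J (\<lambda>_. 0))"
  unfolding compile.simps
proof (rule runs_Act)
  have r: "reads (conc a J (\<lambda>_. 0)) = mask (\<lambda>k. a k (J k))"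
    using J by (rule reads_conc0)
  show "conc (den (Upd g) J a) J (\<lambda>_. 0) =
    act_mem (\<lambda>k. (g (reads (conc a J (\<lambda>_. 0))) k, Stay)) (conc a J (\<lambda>_. 0))"
    unfolding r using J by (auto simp: fun_eq_iff act_mem_def conc_def cont_upd[symmetric])
qed

lemma runs_Pass:
  assumes J: "\<And>i. matrix_tape i \<Longrightarrow> 1 \<le> J i \<and> J i \<le> m" and ok: "ok_cells a"
  shows "runs (compile (Pass u)) (conc a J (\<lambda>_. 0)) (4 * n + 6) (conc (den (Pass u) J a) J (\<lambda>_. 0))"
proof -
  let ?sweep = "Act (\<lambda>\<rho> k. if matrix_tape k then (\<rho> k, Move_Right) else (u \<rho> k, Stay))"
  define F :: "nat \<Rightarrow> cells \<Rightarrow> cells" where "F = (\<lambda>r a i. if 5 \<le> i \<and> i < ntapes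
      then (a i)(0 := u (mask (\<lambda>k. if matrix_tape k then B (J k) r else a k 0)) i) else a i)"
  define A where "A k = fold F [1..<k + 1] a" for k
  have A_Suc: "A (Suc k) = F (Suc k) (A k)" for k
    unfolding A_def by simp
  have A_matrix: "A k i = a i" if "matrix_tape i" for k i
  proof (induction k)
    case (Suc k)
    then show ?case using that by (simp add: A_Suc F_def)
  qed (simp add: A_def)
  have read0: "reads (conc a' J (\<lambda>_. int k)) 0 = (if k = 0 then a' 0 (J 0) else B (J 0) k)"
    if "k \<le> n" for a' k
    using cont_pos[OF that] by (auto simp: reads_conc ntapes_def)
  define f where "f k = conc (A k) J (\<lambda>_. int (Suc k))" for k
  define f' where "f' k = conc (A n) J (\<lambda>_. int (n - k))" for k
  have 1: "runs (move_all Move_Right) (conc a J (\<lambda>_. 0)) 1 (f 0)"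
    using runs_move_all[of Move_Right a J "\<lambda>_. 0"] by (simp add: f_def A_def)
  have 2: "runs (While (\<lambda>\<rho>. in_row (\<rho> 0))
         ?sweep) (f 0) (n * (1 + 1) + 1) (f n)"
  proof (rule runs_While)
    fix k assume k: "k < n"
    have row: "in_row (reads (f k) 0)"
      using k J[of 0] bits[of "J 0" "Suc k"] read0[of "Suc k"] by (simp add: f_def)
    have c: "cont \<alpha> (pos j + (1 + int k)) = B j (Suc k)" for \<alpha> j
      using cont_pos[of "Suc k" \<alpha> j] k by simp
    have rd: "reads (f k) = mask (\<lambda>i. if matrix_tape i then B (J i) (Suc k) else A k i 0)"
      by (auto simp: f_def reads_conc mask_def fun_eq_iff c)
    have "runs ?sweep (f k) 1 (f (Suc k))"
    proof (rule runs_Act, rule ext)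
      fix i
      show "f (Suc k) i = act_mem (\<lambda>i. if matrix_tape i then (reads (f k) i, Move_Right) else (u (reads (f k)) i, Stay)) (f k) i"
      proof (cases "matrix_tape i")
        case True
        then show ?thesis using ntapes_ge
          by (auto simp: f_def conc_def act_mem_def reads_def A_matrix)
      next
        case False
        then show ?thesis
          unfolding rd by (auto simp: f_def conc_def act_mem_def A_Suc F_def fun_eq_iff)
      qed
    qed
    with row show "in_row (reads (f k) 0) \<and> runs ?sweep (f k) 1 (f (Suc k))" ..
  next
    have "pos (J 0) + (1 + int n) = pos (Suc (J 0))" by (simp add: pos_Suc)
    moreover have "A n 0 (Suc (J 0)) \<ge> 3 \<or> A n 0 (Suc (J 0)) = 0"
      using ok J[of 0] by (cases "J 0 = m") (auto simp: ok_cells_def A_matrix)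
    ultimately show "\<not> in_row (reads (f n) 0)"
      by (auto simp: f_def reads_conc cont_pos0 in_row_def)
  qed
  have 3: "runs (move_all Move_Left) (f n) 1 (f' 0)"
    using runs_move_all[of Move_Left "A n" J "\<lambda>_. int (Suc n)"] by (simp add: f_def f'_def)
  have 4: "runs (While (\<lambda>\<rho>. in_row (\<rho> 0)) (move_all Move_Left)) (f' 0) (n * (1 + 1) + 1) (f' n)"
  proof (rule runs_While)
    fix k assume k: "k < n"
    have "in_row (reads (f' k) 0)"
      using k J[of 0] bits[of "J 0" "n - k"] read0[of "n - k"] by (simp add: f'_def)
    moreover have "int (n - Suc k) = int (n - k) - 1" using k by linarith
    then have "runs (move_all Move_Left) (f' k) 1 (f' (Suc k))"
      using runs_move_all[of Move_Left "A n" J "\<lambda>_. int (n - k)"] by (simp add: f'_def)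
    ultimately show "in_row (reads (f' k) 0) \<and> runs (move_all Move_Left) (f' k) 1 (f' (Suc k))" ..
  next
    have "a 0 (J 0) \<ge> 3" using ok J[of 0] by (auto simp: ok_cells_def)
    then show "\<not> in_row (reads (f' n) 0)"
      using read0[of 0 "A n"] by (simp add: f'_def A_matrix in_row_def)
  qed
  have "den (Pass u) J a = A n" by (simp add: A_def F_def del: upt_Suc)
  then have "f' n = conc (den (Pass u) J a) J (\<lambda>_. 0)" by (simp only: f'_def) simp
  then show ?thesis
    using runs_mono[OF runs_Seq[OF runs_Seq[OF 1 2] runs_Seq[OF 3 4]]]
    by (simp add: pass_columns_def)
qed

text \<open>Without edges the heads also stand at row 1, which is then the blank
  \<open>m + 1\<close> behind the prefix, so that every loop is skipped. This is why
  \<open>J i \<le> m\<close> is required only for \<open>1 \<le> m\<close>.\<close>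

definition ok_heads :: "(nat \<Rightarrow> nat) \<Rightarrow> nat set \<Rightarrow> bool" where
  "ok_heads J U \<longleftrightarrow> (\<forall>i. (matrix_tape i \<longrightarrow> 1 \<le> J i \<and> (1 \<le> m \<longrightarrow> J i \<le> m)) \<and> (\<not> matrix_tape i \<longrightarrow> J i = 0) \<and>
     (matrix_tape i \<and> i \<notin> U \<longrightarrow> J i = 1)) \<and> (U \<noteq> {} \<longrightarrow> 1 \<le> m)"

lemma ok_cells_upd:
  assumes "ok_cells a" "\<And>i. matrix_tape i \<Longrightarrow> b i = a i \<or> (\<exists>j x. b i = (a i)(j := x) \<and> 3 \<le> a i j \<and> 3 \<le> x)"
  shows "ok_cells b"
  unfolding ok_cells_def
proof (intro allI impI)
  fix i :: nat assume i: "matrix_tape i"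
  have a: "a i 0 = 0" "\<And>j. 1 \<le> j \<Longrightarrow> j \<le> m \<Longrightarrow> 3 \<le> a i j" "a i (m + 1) = 0"
    using assms(1) i by (auto simp: ok_cells_def)
  from assms(2)[OF i] show "b i 0 = 0 \<and> (\<forall>j. 1 \<le> j \<and> j \<le> m \<longrightarrow> 3 \<le> b i j) \<and> b i (m + 1) = 0"
    using a by (auto intro!: gr0I)
qed

lemma den_matrix_Pass: "matrix_tape i \<Longrightarrow> den (Pass u) J a i = a i"
  unfolding den.simps by (rule fold_invariant_upt[where P = "\<lambda>_ b. b i = a i"]) auto

lemma ok_heads_upd:
  "ok_heads J U \<Longrightarrow> matrix_tape i \<Longrightarrow> 1 \<le> j \<Longrightarrow> j \<le> m \<Longrightarrow> ok_heads (J(i := j)) (insert i U)"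
  by (auto simp: ok_heads_def)

lemma ok_cells_den:
  "ok_prog p U \<Longrightarrow> ok_heads J U \<Longrightarrow> ok_cells a \<Longrightarrow> ok_cells (den p J a)"
proof (induction p arbitrary: U J a)
  case (Upd g)
  show ?case
  proof (rule ok_cells_upd[OF Upd.prems(3)])
    fix i :: nat assume i: "matrix_tape i"
    let ?g = "g (mask (\<lambda>k. a k (J k))) i"
    have b: "den (Upd g) J a i = (a i)(J i := ?g)" using i ntapes_ge by simp
    have "?g = a i (J i) \<or> 3 \<le> a i (J i) \<and> 3 \<le> ?g"
      using Upd.prems(1) i ntapes_ge
      by (auto dest!: spec[of _ "mask (\<lambda>k. a k (J k))"] spec[of _ i] simp: mask_def)
    then show "den (Upd g) J a i = a i \<or> (\<exists>j x. den (Upd g) J a i = (a i)(j := x) \<and> 3 \<le> a i j \<and> 3 \<le> x)"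
      unfolding b by auto
  qed
next
  case (Pass u)
  show ?case by (rule ok_cells_upd[OF Pass.prems(3)]) (use den_matrix_Pass in blast)
next
  case (For i p)
  show ?case
    unfolding den.simps
  proof (rule fold_invariant_upt[where P = "\<lambda>_. ok_cells"])
    fix j b assume j: "1 \<le> j" "j < m + 1" and b: "ok_cells b"
    have "ok_heads (J(i := j)) (insert i U)"
      by (rule ok_heads_upd) (use For.prems j in auto)
    then show "ok_cells (den p (J(i := j)) b)"
      using For.IH[of "insert i U"] For.prems(1) b unfolding ok_prog.simps by blast
  qed (use For.prems in auto)
next
  case (RSeq p q)
  then show ?case using RSeq.IH(1)[of U J a] RSeq.IH(2)[of U J "den p J a"] by simp
qed

lemma runs_compile:
  "ok_prog p U \<Longrightarrow> ok_heads J U \<Longrightarrow> ok_cells a \<Longrightarrow>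
    runs (compile p) (conc a J (\<lambda>_. 0)) (poly (time_bound p) size_bound) (conc (den p J a) J (\<lambda>_. 0))"
proof (induction p arbitrary: U J a)
  case (Upd g)
  then show ?case using runs_Upd[of J g a] by (simp add: ok_heads_def)
next
  case (Pass u)
  have "runs (compile (Pass u)) (conc a J (\<lambda>_. 0)) (4 * n + 6) (conc (den (Pass u) J a) J (\<lambda>_. 0))"
    using Pass by (intro runs_Pass) (auto simp: ok_heads_def)
  then show ?case by (rule runs_mono) (use size_bounds(1) in simp)
next
  case (For i p)
  have i: "matrix_tape i" "i \<notin> U" and p: "ok_prog p (insert i U)" using For.prems by auto
  have Ji: "J i = 1" using For.prems i by (auto simp: ok_heads_def)
  define A where "A k = fold (\<lambda>j. den p (J(i := j))) [1..<k + 1] a" for k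
  have A_Suc: "A (Suc k) = den p (J(i := Suc k)) (A k)" for k
    unfolding A_def by simp
  have ok_A: "ok_cells (A k)" if "k \<le> m" for k
    using that
  proof (induction k)
    case 0
    then show ?case using For.prems by (simp add: A_def)
  next
    case (Suc k)
    then show ?case
      unfolding A_Suc by (intro ok_cells_den[OF p ok_heads_upd[OF For.prems(2) i(1)]]) auto
  qed
  define f where "f k = conc (A k) (J(i := Suc k)) (\<lambda>_. 0)" for k
  have "runs (While (\<lambda>\<rho>. \<rho> i \<noteq> 0) (Seq (compile p) (next_row i))) (f 0)
      (m * (poly (time_bound p) size_bound + (2 * n + 2) + 1) + 1) (f m)"
  proof (rule runs_While)
    fix k assume k: "k < m"
    have J': "ok_heads (J(i := Suc k)) (insert i U)"
      by (rule ok_heads_upd) (use For.prems i k in auto)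
    have "3 \<le> A k i (Suc k)" using ok_A[of k] i k by (auto simp: ok_cells_def)
    then have "reads (f k) i \<noteq> 0"
      using i ntapes_ge by (simp add: f_def reads_conc cont_pos0)
    moreover have "runs (compile p) (f k) (poly (time_bound p) size_bound) (conc (A (Suc k)) (J(i := Suc k)) (\<lambda>_. 0))"
      unfolding f_def A_Suc by (rule For.IH[OF p J' ok_A]) (use k in simp)
    moreover have "runs (next_row i) (conc (A (Suc k)) (J(i := Suc k)) (\<lambda>_. 0)) (2 * n + 2) (f (Suc k))"
      using runs_next_row[OF i(1) ok_A[of "Suc k"], of "J(i := Suc k)"] k by (simp add: f_def)
    ultimately show "reads (f k) i \<noteq> 0 \<and> runs (Seq (compile p) (next_row i)) (f k) (poly (time_bound p) size_bound + (2 * n + 2)) (f (Suc k))"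
      using runs_Seq by blast
  next
    have "A m i (Suc m) = 0" using ok_A[of m] i by (auto simp: ok_cells_def)
    then show "\<not> reads (f m) i \<noteq> 0" using i by (simp add: f_def reads_conc cont_pos0)
  qed
  moreover have "runs (rewind i) (f m) (4 * size_bound + 4) (conc (A m) J (\<lambda>_. 0))"
    using runs_rewind[OF i(1) ok_A[of m], of "J(i := Suc m)"] Ji
    by (simp add: f_def fun_upd_idem)
  ultimately have "runs (compile (For i p)) (f 0)
      (m * (poly (time_bound p) size_bound + (2 * n + 2) + 1) + 1 + (4 * size_bound + 4)) (conc (A m) J (\<lambda>_. 0))"
    unfolding compile.simps for_rows_def by (rule runs_Seq)
  moreover have "f 0 = conc a J (\<lambda>_. 0)" using Ji by (simp add: f_def A_def fun_upd_idem)
  moreover have "A m = den (For i p) J a" by (simp add: A_def)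
  moreover have "m * (poly (time_bound p) size_bound + (2 * n + 2) + 1) + 1 + (4 * size_bound + 4)
     \<le> size_bound * (poly (time_bound p) size_bound + (2 * size_bound + 2) + 1) + 1 + (4 * size_bound + 4)"
    using size_bounds by (intro add_mono mult_mono) auto
  ultimately show ?case by (auto intro: runs_mono simp: algebra_simps)
next
  case (RSeq p q)
  have "runs (compile p) (conc a J (\<lambda>_. 0)) (poly (time_bound p) size_bound) (conc (den p J a) J (\<lambda>_. 0))"
    using RSeq by auto
  moreover have "runs (compile q) (conc (den p J a) J (\<lambda>_. 0)) (poly (time_bound q) size_bound) (conc (den q J (den p J a)) J (\<lambda>_. 0))"
    using RSeq ok_cells_den[of p U J a] by auto
  ultimately show ?case using runs_Seq by simp
qed

end

section \<open>Preparation of the tapes\<close>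

definition copy_input :: prog where
  "copy_input = While (\<lambda>\<rho>. \<rho> 0 \<noteq> 0)
     (Act (\<lambda>\<rho> k. if matrix_tape k then (\<rho> 0, Move_Right) else (\<rho> k, Stay)))"

text \<open>The copy stops at the first blank with all five heads just behind the word. This is the
  separator position of row \<open>m + 1\<close>, from which a rewind may start.\<close>

definition setup_tapes :: prog where
  "setup_tapes = Seq copy_input
     (Seq (rewind 0) (Seq (rewind 1) (Seq (rewind 2) (Seq (rewind 3) (rewind 4)))))"

context rows
begin

definition initial_cells :: cells where
  "initial_cells i j = (if matrix_tape i \<and> 1 \<le> j \<and> j \<le> m then 3 else 0)"

definition heads :: "nat \<Rightarrow> nat \<Rightarrow> nat" where
  "heads j i = (if matrix_tape i then j else 0)"

lemma ok_initial_cells: "ok_cells initial_cells"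
  by (simp add: ok_cells_def initial_cells_def)

lemma ok_heads_1: "ok_heads (heads 1) {}"
  by (simp add: ok_heads_def heads_def)

lemma cont_outside:
  assumes "matrix_tape i" "p < 0 \<or> pos (m + 1) \<le> p"
  shows "cont (initial_cells i) p = 0"
proof (cases "p < -1")
  case False
  define q where "q = nat (p + 1)"
  define j where "j = q div (n + 1)"
  define r where "r = q mod (n + 1)"
  have q: "q = j * (n + 1) + r" unfolding j_def r_def by (simp only: div_mult_mod_eq)
  have r: "r \<le> n" using mod_less_divisor[of "n + 1" q] unfolding r_def by linarith
  have p: "p = pos j + int r" using q False unfolding q_def pos_def by linarith
  show ?thesis
  proof (cases "p < 0")
    case True
    with False have "q = 0" unfolding q_def by simp
    then show ?thesis unfolding p cont_pos[OF r] by (simp add: j_def r_def initial_cells_def)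
  next
    case False
    with assms have "(m + 1) * (n + 1) \<le> q" unfolding q_def pos_def by linarith
    then have "m + 1 \<le> j" unfolding j_def by (metis div_le_mono div_mult_self_is_m zero_less_Suc Suc_eq_plus1)
    then show ?thesis unfolding p cont_pos[OF r] by (simp add: bits_outside initial_cells_def)
  qed
qed (simp add: cont_def)

text \<open>The bound consists of \<open>2 * length w + 1\<close> steps for the copy and five
  rewinds of \<open>4 * size_bound + 4\<close> steps each.\<close>

lemma runs_setup:
  assumes len: "int (length w) = pos (m + 1)"
    and nth: "\<And>p. p < length w \<Longrightarrow> w ! p = cont (initial_cells 0) (int p)"
  shows "runs setup_tapes (initial_mem w) (22 * size_bound + 21) (conc initial_cells (heads 1) (\<lambda>_. 0))"
proof -
  let ?copy = "Act (\<lambda>\<rho> k. if matrix_tape k then (\<rho> 0, Move_Right) else (\<rho> k, Stay))"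
  define C where "C = cont (initial_cells 0)"
  have C: "cont (initial_cells i) = C" if "matrix_tape i" for i
    using that unfolding C_def by (intro ext) (simp add: cont_def initial_cells_def Let_def)
  define f :: "nat \<Rightarrow> mem" where "f k = (\<lambda>i. if matrix_tape i
    then ((\<lambda>p. if i = 0 \<or> p < int k then C p else 0), int k) else ((\<lambda>_. 0), 0))" for k
  have out: "C p = 0" if "p < 0 \<or> int (length w) \<le> p" for p
    using cont_outside[of 0 p] that unfolding C_def len by simp
  have "input_tape w = (C, 0)"
  proof -
    have "(if 0 \<le> p \<and> p < int (length w) then w ! nat p else 0) = C p" for p
      using out[of p] nth[of "nat p"] unfolding C_def by auto
    then show ?thesis by (auto simp: input_tape_def)
  qed
  then have 0: "initial_mem w = f 0"
    by (auto simp: initial_mem_def blank_tape_def f_def fun_eq_iff out)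
  have 1: "runs copy_input (f 0) (length w * (1 + 1) + 1) (f (length w))"
    unfolding copy_input_def
  proof (rule runs_While)
    fix k assume k: "k < length w"
    have "C (int k) \<noteq> 0"
      using cont_nonzero[OF _ ok_initial_cells, of 0 "int k"] k len unfolding C_def by simp
    moreover have rd: "reads (f k) 0 = C (int k)"
      by (simp add: reads_def f_def ntapes_def)
    moreover have "runs ?copy (f k) 1 (f (Suc k))"
    proof (rule runs_Act, rule ext)
      fix i
      have "C p = 0" if "\<not> p < int k" "p \<noteq> int k" "p < 1 + int k" for p
        using that by simp
      then show "f (Suc k) i = act_mem (\<lambda>i. if matrix_tape i then (reads (f k) 0, Move_Right) else (reads (f k) i, Stay)) (f k) i"
        unfolding rd using ntapes_ge
        by (cases "matrix_tape i") (auto simp: f_def act_mem_def reads_def fun_eq_iff)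
    qed
    ultimately show "reads (f k) 0 \<noteq> 0 \<and>
      runs ?copy (f k) 1 (f (Suc k))" by simp
  next
    show "\<not> reads (f (length w)) 0 \<noteq> 0"
      by (simp add: reads_def f_def out)
  qed
  have f: "f (length w) = conc initial_cells (heads (m + 1)) (\<lambda>_. 0)"
    using out by (auto simp: f_def conc_def heads_def fun_eq_iff len C initial_cells_def)
  have rw: "runs (rewind i) (conc initial_cells J (\<lambda>_. 0)) (4 * size_bound + 4) (conc initial_cells (J(i := 1)) (\<lambda>_. 0))"
    if "matrix_tape i" "J i = m + 1" for i J
    using runs_rewind[of i initial_cells J] that ok_initial_cells by simp
  let ?J = "heads (m + 1)"
  have 2: "runs (Seq (rewind 0) (Seq (rewind 1) (Seq (rewind 2) (Seq (rewind 3) (rewind 4)))))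
    (f (length w)) (5 * (4 * size_bound + 4)) (conc initial_cells (heads 1) (\<lambda>_. 0))"
  proof -
    let ?J1 = "?J(0 := 1)" let ?J2 = "?J1(1 := 1)" let ?J3 = "?J2(2 := 1)" let ?J4 = "?J3(3 := 1)"
    have J: "?J4(4 := 1) = heads 1"
      by (auto simp: heads_def fun_eq_iff)
    show ?thesis
      using runs_Seq[OF rw[of 0 ?J] runs_Seq[OF rw[of 1 ?J1] runs_Seq[OF rw[of 2 ?J2] runs_Seq[OF rw[of 3 ?J3] rw[of 4 ?J4, unfolded J]]]]]
      unfolding f by (simp add: heads_def)
  qed
  have "length w < size_bound" using len unfolding pos_def size_bound_def by linarith
  then show ?thesis
    unfolding 0 setup_tapes_def using runs_mono[OF runs_Seq[OF 1 2]] by simp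
qed

lemma machine_row_prog:
  assumes "int (length w) = pos (m + 1)" "\<And>p. p < length w \<Longrightarrow> w ! p = cont (initial_cells 0) (int p)"
    and "ok_prog p {}" "5 \<le> v" "v < ntapes"
  shows "\<exists>t \<le> poly ([:23, 22:] + time_bound p) (length w + 1). state_after (machine v (Seq setup_tapes (compile p))) w t =
    (if den p (heads 1) initial_cells v 0 = 0 then accept_state else reject_state)"
proof -
  have sb: "size_bound = length w + 1" using assms(1) unfolding pos_def size_bound_def by linarith
  from runs_Seq[OF runs_setup[OF assms(1,2)] runs_compile[OF assms(3) ok_heads_1 ok_initial_cells]]
  obtain t where t: "t \<le> 22 * size_bound + 21 + poly (time_bound p) size_bound"
    and e: "exec (Seq setup_tapes (compile p)) (initial_mem w) t (conc (den p (heads 1) initial_cells) (heads 1) (\<lambda>_. 0))"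
    by (auto simp: runs_def)
  show ?thesis
    by (rule exI[of _ "t + 2"])
      (use t machine_state_after[OF e assms(5)] assms(4) in \<open>auto simp: sb conc_def algebra_simps\<close>)
qed

end

lemma wf_setup_tapes: "wf_prog setup_tapes"
  by (simp add: setup_tapes_def copy_input_def rewind_def next_row_def move_tape_def)

primrec wf_row_prog :: "row_prog \<Rightarrow> bool" where
  "wf_row_prog (Upd g) \<longleftrightarrow> (\<forall>\<rho> i. (\<forall>k. \<rho> k < nsyms) \<longrightarrow> g \<rho> i < nsyms)"
| "wf_row_prog (Pass u) \<longleftrightarrow> (\<forall>\<rho> i. (\<forall>k. \<rho> k < nsyms) \<longrightarrow> u \<rho> i < nsyms)"
| "wf_row_prog (For i p) \<longleftrightarrow> wf_row_prog p"
| "wf_row_prog (RSeq p q) \<longleftrightarrow> wf_row_prog p \<and> wf_row_prog q"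

lemma wf_compile: "wf_row_prog p \<Longrightarrow> wf_prog (compile p)"
  by (induction p)
    (simp_all add: pass_columns_def move_all_def for_rows_def rewind_def next_row_def move_tape_def)

section \<open>Incidence words as matrices\<close>

lemma nth_concat_uniform:
  assumes "\<And>x. x \<in> set xs \<Longrightarrow> length x = l" "j < length xs" "r < l"
  shows "concat xs ! (j * l + r) = xs ! j ! r"
  using assms
proof (induction xs arbitrary: j)
  case (Cons x xs)
  then show ?case by (cases j) (auto simp: nth_append add.assoc)
qed simp

lemma length_concat_uniform:
  assumes "\<And>x. x \<in> set xs \<Longrightarrow> length x = l"
  shows "length (concat xs) = length xs * l"
  using assms by (induction xs) auto

definition row_bits :: "'a list \<Rightarrow> 'a set list \<Rightarrow> nat \<Rightarrow> nat \<Rightarrow> nat" where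
  "row_bits vs es j r = (if j = 0 then 2 else if j \<le> length es
     then if vs ! (r - 1) \<in> es ! (j - 1) then 2 else 1 else 0)"

lemma rows_row_bits: "rows (length vs) (length es) (row_bits vs es)"
  by unfold_locales (auto simp: row_bits_def in_row_def)

lemma length_incidence_word:
  "length (incidence_word vs es) = length vs + length es * (length vs + 1)"
  unfolding incidence_word_def
  by (simp, subst length_concat_uniform[where l = "length vs + 1"]) auto

text \<open>Shifting positions by 1 puts an imaginary separator before the unary prefix, which makes
  the prefix a row of length \<open>n + 1\<close> like all others. Quotient and remainder modulo
  \<open>n + 1\<close> are then row and column.\<close>

lemma incidence_word_nth:
  fixes vs :: "'a list" and es
  defines "n \<equiv> length vs" and "m \<equiv> length es"
  assumes "p < length (incidence_word vs es)"
  shows "incidence_word vs es ! p =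
    rows.cont n (row_bits vs es) (rows.initial_cells m 0) (int p)"
proof -
  interpret rows n m "row_bits vs es" unfolding n_def m_def by (rule rows_row_bits)
  define q where "q = p + 1"
  define j where "j = q div (n + 1)"
  define r where "r = q mod (n + 1)"
  have q: "q = j * (n + 1) + r" unfolding j_def r_def by (simp only: div_mult_mod_eq)
  have r: "r \<le> n" using mod_less_divisor[of "n + 1" q] unfolding r_def by linarith
  have p: "int p = pos j + int r" using q unfolding q_def pos_def by linarith
  have "q < (m + 1) * (n + 1)"
    using assms(3) length_incidence_word[of vs es] unfolding q_def n_def m_def by simp
  then have jm: "j \<le> m" unfolding j_def using less_mult_imp_div_less[of q "m + 1" "n + 1"] by linarith
  show ?thesis
  proof (cases j)
    case 0
    then have "q = r" "r \<noteq> 0" using q unfolding q_def by auto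
    then have "p < n" using r unfolding q_def by linarith
    then show ?thesis
      unfolding p cont_pos[OF r] using 0 \<open>r \<noteq> 0\<close>
      by (simp add: incidence_word_def nth_append n_def row_bits_def)
  next
    case (Suc k)
    let ?rows = "map (\<lambda>e. letter_sep # map (\<lambda>v. if v \<in> e then letter_one else letter_zero) vs) es"
    have "p = n + (k * (n + 1) + r)" using q Suc unfolding q_def by simp
    then have "incidence_word vs es ! p = concat ?rows ! (k * (n + 1) + r)"
      by (simp add: incidence_word_def nth_append n_def)
    also have "\<dots> = ?rows ! k ! r"
      by (rule nth_concat_uniform) (use jm Suc r in \<open>auto simp: n_def m_def\<close>)
    finally show ?thesis
      unfolding p cont_pos[OF r] using jm Suc r
      by (cases r) (auto simp: row_bits_def initial_cells_def m_def[symmetric] n_def)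
  qed
qed

section \<open>The decision program\<close>

text \<open>The rows of an edge \<open>e\<close> and up to three other edges \<open>f\<close>, \<open>g\<close>, \<open>h\<close> are on the tapes 0 to 3, and tape 4 counts the
  rounds of pruning. Register 5 counts the points of \<open>e\<close> (up to 3), the registers 6 to 16 hold the atoms, 17 tells
  first that \<open>e\<close> has to stay and then that it has to go, and 19 is set when a bad edge is found.\<close>

definition atom :: "nat \<Rightarrow> bool \<Rightarrow> bool \<Rightarrow> bool \<Rightarrow> bool \<Rightarrow> bool" where
  "atom i e f g h \<longleftrightarrow>
     (if i = 6 then e \<noteq> f else if i = 7 then e \<noteq> g else if i = 8 then e \<noteq> h
      else if i = 9 then f \<noteq> g else if i = 10 then f \<noteq> h else if i = 11 then g \<noteq> h
      else if i = 12 then e \<and> f else if i = 13 then e \<and> g else if i = 14 then e \<and> h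
      else if i = 15 then f \<and> g else e \<and> f \<and> g)"

text \<open>A cell holds one of finitely many symbols, so the counter saturates at 3; by rank 3 it
  still gives the exact size of an edge.\<close>

definition sweep :: "(nat \<Rightarrow> nat) \<Rightarrow> nat \<Rightarrow> nat" where
  "sweep \<rho> i = (if i = 5 then if \<rho> 0 = 2 then min 3 (\<rho> 5 + 1) else \<rho> 5
     else if 6 \<le> i \<and> i \<le> 16 \<and> atom i (\<rho> 0 = 2) (\<rho> 1 = 2) (\<rho> 2 = 2) (\<rho> 3 = 2) then 1 else \<rho> i)"

definition scan :: row_prog where
  "scan = RSeq (Upd (\<lambda>\<rho> i. if 5 \<le> i \<and> i \<le> 16 then 0 else \<rho> i)) (Pass sweep)"

definition note_pair :: "(nat \<Rightarrow> nat) \<Rightarrow> nat \<Rightarrow> nat" where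
  "note_pair \<rho> i = (
     if i = 17 then if \<rho> 17 = 1 \<or> \<rho> 1 = 3 \<and> \<rho> 2 = 3 \<and> \<rho> 6 = 1 \<and> \<rho> 7 = 1 \<and> \<rho> 12 = 1 \<and> \<rho> 13 = 1 \<and>
         (\<rho> 5 = 2 \<or> \<rho> 16 = 0) then 1 else 0
     else \<rho> i)"

definition pair_test :: row_prog where
  "pair_test = For 1 (For 2 (RSeq scan (Upd note_pair)))"

text \<open>The row of tape 0 is recognized on tape \<open>t\<close> by its columns: register \<open>q = t + 5\<close> tells whether the two rows differ.\<close>

definition kill :: "nat \<Rightarrow> nat \<Rightarrow> row_prog" where
  "kill t q = For t (RSeq scan (Upd (\<lambda>\<rho> i. if i = t \<and> \<rho> 17 = 1 \<and> \<rho> q = 0 \<and> \<rho> t = 3 then 4 else \<rho> i)))"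

text \<open>Head 0 already stands on the row to be marked, whereas on the tapes 1 to 3 this row has
  to be found by \<open>kill\<close>.\<close>

definition prune_edge :: row_prog where
  "prune_edge =
     RSeq (Upd (\<lambda>\<rho> i. if i = 17 then 0 else \<rho> i))
    (RSeq pair_test
    (RSeq scan
    (RSeq (Upd (\<lambda>\<rho> i. if i = 17 then if \<rho> 0 = 3 \<and> (\<rho> 5 = 2 \<or> \<rho> 5 = 3) \<and> \<rho> 17 \<noteq> 1 then 1 else 0 else \<rho> i))
    (RSeq (kill 1 6) (RSeq (kill 2 7) (RSeq (kill 3 8)
      (Upd (\<lambda>\<rho> i. if i = 0 \<and> \<rho> 17 = 1 \<and> \<rho> 0 = 3 then 4 else \<rho> i))))))))"

definition note_bad :: "(nat \<Rightarrow> nat) \<Rightarrow> nat \<Rightarrow> nat" where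
  "note_bad \<rho> i = (
     if i = 19 then if \<rho> 19 = 1 \<or> \<rho> 0 = 3 \<and> (\<rho> 5 \<noteq> 3 \<or>
         \<rho> 1 = 3 \<and> \<rho> 2 = 3 \<and> \<rho> 6 = 1 \<and> \<rho> 7 = 1 \<and> \<rho> 9 = 1 \<and> \<rho> 16 = 1 \<or>
         \<rho> 1 = 3 \<and> \<rho> 2 = 3 \<and> \<rho> 3 = 3 \<and> \<rho> 6 = 1 \<and> \<rho> 7 = 1 \<and> \<rho> 8 = 1 \<and> \<rho> 9 = 1 \<and> \<rho> 10 = 1 \<and> \<rho> 11 = 1 \<and>
           \<rho> 12 = 1 \<and> \<rho> 13 = 1 \<and> \<rho> 14 = 1 \<and> \<rho> 15 = 0) then 1 else 0
     else \<rho> i)"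

definition check_edges :: row_prog where
  "check_edges = For 0 (For 1 (For 2 (For 3 (RSeq scan (Upd note_bad)))))"

definition decider :: row_prog where
  "decider = RSeq (For 4 (For 0 prune_edge)) check_edges"

lemma wf_decider: "wf_row_prog decider"
  by (auto simp: decider_def check_edges_def prune_edge_def kill_def pair_test_def scan_def note_pair_def note_bad_def sweep_def nsyms_def)

context rows
begin

lemma ok_decider: "ok_prog decider {}"
  by (auto simp: decider_def check_edges_def prune_edge_def kill_def pair_test_def scan_def note_pair_def note_bad_def)

lemma den_Upd_at:
  assumes "i < ntapes"
  shows "den (Upd g) J a i = (a i)(J i := g (mask (\<lambda>k. a k (J k))) i)"
  using assms by simp

text \<open>A loop whose body only ever raises a flag computes a disjunction over the rows, so
  nested loops become nested existential quantifiers. \<open>I\<close> carries what the body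
  preserves.\<close>

lemma den_For_flag:
  assumes "I a"
    and body: "\<And>j a. 1 \<le> j \<Longrightarrow> j \<le> m \<Longrightarrow> I a \<Longrightarrow>
      I (den p (J(i := j)) a) \<and> (fl (den p (J(i := j)) a) \<longleftrightarrow> fl a \<or> R j)"
  shows "I (den (For i p) J a) \<and> (fl (den (For i p) J a) \<longleftrightarrow> fl a \<or> (\<exists>j. 1 \<le> j \<and> j \<le> m \<and> R j))"
proof -
  have "I (den (For i p) J a) \<and> (fl (den (For i p) J a) \<longleftrightarrow> fl a \<or> (\<exists>j. 1 \<le> j \<and> j < m + 1 \<and> R j))"
    unfolding den.simps
  proof (rule fold_invariant_upt[where P = "\<lambda>l b. I b \<and> (fl b \<longleftrightarrow> fl a \<or> (\<exists>j. 1 \<le> j \<and> j < l \<and> R j))"])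
    fix l b
    assume l: "1 \<le> l" "l < m + 1" and b: "I b \<and> (fl b \<longleftrightarrow> fl a \<or> (\<exists>j. 1 \<le> j \<and> j < l \<and> R j))"
    have "j < Suc l \<longleftrightarrow> j < l \<or> j = l" for j by auto
    then show "I (den p (J(i := l)) b) \<and> (fl (den p (J(i := l)) b) \<longleftrightarrow> fl a \<or> (\<exists>j. 1 \<le> j \<and> j < Suc l \<and> R j))"
      using body[of l b] l b by auto
  qed (use assms(1) in auto)
  then show ?thesis by (simp add: less_Suc_eq_le)
qed

lemma den_scan:
  assumes J: "\<forall>i. \<not> matrix_tape i \<longrightarrow> J i = 0"
  shows "den scan J a 5 0 = min 3 (card {r. 1 \<le> r \<and> r \<le> n \<and> B (J 0) r = 2})"
    and "6 \<le> i \<Longrightarrow> i \<le> 16 \<Longrightarrow> den scan J a i 0 =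
      of_bool (\<exists>r. 1 \<le> r \<and> r \<le> n \<and> atom i (B (J 0) r = 2) (B (J 1) r = 2) (B (J 2) r = 2) (B (J 3) r = 2))"
    and "i < 5 \<or> 16 < i \<Longrightarrow> den scan J a i = a i"
proof -
  let ?at = "\<lambda>i r. atom i (B (J 0) r = 2) (B (J 1) r = 2) (B (J 2) r = 2) (B (J 3) r = 2)"
  define b where "b = den (Upd (\<lambda>\<rho> i. if 5 \<le> i \<and> i \<le> 16 then 0 else \<rho> i)) J a"
  have b: "b i 0 = 0" if "5 \<le> i" "i \<le> 16" for i
    using that J by (simp add: b_def ntapes_def)
  have b': "b i = a i" if "i < 5 \<or> 16 < i" for i
    using that J by (auto simp: b_def ntapes_def mask_def)
  have s: "den scan J a = den (Pass sweep) J b" by (simp add: scan_def b_def)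
  let ?P = "\<lambda>l c. c 5 0 = min 3 (card {r. 1 \<le> r \<and> r < l \<and> B (J 0) r = 2}) \<and>
    (\<forall>i. 6 \<le> i \<and> i \<le> 16 \<longrightarrow> c i 0 = of_bool (\<exists>r. 1 \<le> r \<and> r < l \<and> ?at i r)) \<and>
    (\<forall>i. i < 5 \<or> 16 < i \<longrightarrow> c i = a i)"
  have "?P (n + 1) (den (Pass sweep) J b)"
    unfolding den.simps
  proof (rule fold_invariant_upt[where P = ?P])
    have e: "{r. 1 \<le> r \<and> r < 1 \<and> B (J 0) r = 2} = {}" by auto
    show "?P 1 b" unfolding e using b b' by simp
  next
    fix l c assume l: "1 \<le> l" "l < n + 1" and P: "?P l c"
    let ?\<rho> = "mask (\<lambda>k. if matrix_tape k then B (J k) l else c k 0)"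
    let ?c = "\<lambda>i. if 5 \<le> i \<and> i < ntapes then (c i)(0 := sweep ?\<rho> i) else c i"
    have \<rho>: "?\<rho> 0 = B (J 0) l" "?\<rho> 1 = B (J 1) l" "?\<rho> 2 = B (J 2) l" "?\<rho> 3 = B (J 3) l"
      "\<And>i. 5 \<le> i \<Longrightarrow> i < ntapes \<Longrightarrow> ?\<rho> i = c i 0"
      by (simp_all add: mask_def ntapes_def)
    have "{r. 1 \<le> r \<and> r < Suc l \<and> B (J 0) r = 2} =
      (if B (J 0) l = 2 then insert l {r. 1 \<le> r \<and> r < l \<and> B (J 0) r = 2} else {r. 1 \<le> r \<and> r < l \<and> B (J 0) r = 2})"
      using l by (auto simp: less_Suc_eq)
    then have "card {r. 1 \<le> r \<and> r < Suc l \<and> B (J 0) r = 2} =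
      card {r. 1 \<le> r \<and> r < l \<and> B (J 0) r = 2} + (if B (J 0) l = 2 then 1 else 0)" by simp
    moreover have "?c 5 0 = (if B (J 0) l = 2 then min 3 (c 5 0 + 1) else c 5 0)"
      using \<rho>(1) \<rho>(5)[of 5] by (simp add: sweep_def ntapes_def)
    ultimately have 1: "?c 5 0 = min 3 (card {r. 1 \<le> r \<and> r < Suc l \<and> B (J 0) r = 2})"
      using P by auto
    have 2: "?c i 0 = of_bool (\<exists>r. 1 \<le> r \<and> r < Suc l \<and> ?at i r)" if i: "6 \<le> i" "i \<le> 16" for i
    proof -
      have "?c i 0 = (if ?at i l then 1 else c i 0)"
        using i \<rho>(1-4) \<rho>(5)[of i] by (simp add: sweep_def ntapes_def)
      moreover have "(\<exists>r. 1 \<le> r \<and> r < Suc l \<and> ?at i r) \<longleftrightarrow> (\<exists>r. 1 \<le> r \<and> r < l \<and> ?at i r) \<or> ?at i l"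
        using l by (auto simp: less_Suc_eq)
      moreover have "c i 0 = of_bool (\<exists>r. 1 \<le> r \<and> r < l \<and> ?at i r)" using P i by blast
      ultimately show ?thesis by simp
    qed
    have 3: "?c i = a i" if i: "i < 5 \<or> 16 < i" for i
    proof -
      have "c i = a i" using P i by blast
      moreover have "sweep ?\<rho> i = c i 0" if "5 \<le> i" "i < ntapes"
        using \<rho>(5)[OF that] i that by (auto simp: sweep_def)
      ultimately show ?thesis by auto
    qed
    show "?P (Suc l) ?c" using 1 2 3 by blast
  qed simp
  then have P: "?P (n + 1) (den scan J a)" unfolding s .
  have lt: "r < n + 1 \<longleftrightarrow> r \<le> n" for r by auto
  show "den scan J a 5 0 = min 3 (card {r. 1 \<le> r \<and> r \<le> n \<and> B (J 0) r = 2})"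
    using P unfolding lt by blast
  show "6 \<le> i \<Longrightarrow> i \<le> 16 \<Longrightarrow> den scan J a i 0 = of_bool (\<exists>r. 1 \<le> r \<and> r \<le> n \<and> ?at i r)"
    using P unfolding lt by blast
  show "i < 5 \<or> 16 < i \<Longrightarrow> den scan J a i = a i" using P by blast
qed

end

section \<open>Scans in terms of edges\<close>

locale incidence =
  fixes vs :: "'a list" and es :: "'a set list" and V :: "'a set"
  assumes vs: "distinct vs" "set vs = V"
    and es: "distinct es" "set es \<subseteq> Pow V"
    and lin: "linear_family (set es)"
begin

sublocale rows "length vs" "length es" "row_bits vs es"
  by (rule rows_row_bits)

abbreviation n where "n \<equiv> length vs"
abbreviation m where "m \<equiv> length es"

definition edge :: "nat \<Rightarrow> 'a set" where "edge j = es ! (j - 1)"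

definition row :: "nat \<Rightarrow> bool" where "row j \<longleftrightarrow> 1 \<le> j \<and> j \<le> m"

lemma edge_mem: "row j \<Longrightarrow> edge j \<in> set es"
  by (auto simp: edge_def row_def)

lemma edge_subset: "row j \<Longrightarrow> edge j \<subseteq> V"
  using edge_mem es(2) by blast

lemma edge_inj: "row j \<Longrightarrow> row k \<Longrightarrow> edge j = edge k \<longleftrightarrow> j = k"
  using es(1) by (auto simp: edge_def row_def nth_eq_iff_index_eq)

lemma edge_image: "edge ` {j. row j} = set es"
proof -
  have "e \<in> edge ` {j. row j}" if e: "e \<in> set es" for e
  proof -
    obtain i where i: "i < m" "es ! i = e" using e by (auto simp: in_set_conv_nth)
    then have "row (Suc i)" "edge (Suc i) = e" by (simp_all add: row_def edge_def)
    then show ?thesis by (intro image_eqI[of _ _ "Suc i"]) simp_all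
  qed
  then show ?thesis using edge_mem by blast
qed

lemma bit_iff: "row j \<Longrightarrow> row_bits vs es j r = 2 \<longleftrightarrow> vs ! (r - 1) \<in> edge j"
  by (auto simp: row_bits_def row_def edge_def)

lemma card_columns:
  assumes "row j"
  shows "card {r. 1 \<le> r \<and> r \<le> n \<and> row_bits vs es j r = 2} = card (edge j)"
proof (rule bij_betw_same_card[of "\<lambda>r. vs ! (r - 1)"])
  have "inj_on (\<lambda>r. vs ! (r - 1)) {r. 1 \<le> r \<and> r \<le> n \<and> row_bits vs es j r = 2}"
    by (rule inj_onI) (use vs(1) in \<open>auto simp: nth_eq_iff_index_eq\<close>)
  moreover have "v \<in> (\<lambda>r. vs ! (r - 1)) ` {r. 1 \<le> r \<and> r \<le> n \<and> row_bits vs es j r = 2}" if v: "v \<in> edge j" for v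
  proof -
    have "v \<in> set vs" using edge_subset[OF assms] v vs(2) by blast
    then obtain i where i: "i < n" "vs ! i = v" by (auto simp: in_set_conv_nth)
    then have "Suc i \<in> {r. 1 \<le> r \<and> r \<le> n \<and> row_bits vs es j r = 2}"
      using v by (simp add: bit_iff[OF assms])
    then show ?thesis using i by (intro image_eqI[of _ _ "Suc i"]) simp_all
  qed
  ultimately show "bij_betw (\<lambda>r. vs ! (r - 1)) {r. 1 \<le> r \<and> r \<le> n \<and> row_bits vs es j r = 2} (edge j)"
    unfolding bij_betw_def using bit_iff[OF assms] by blast
qed

lemma ex_column:
  assumes "row j0" "row j1" "row j2" "row j3"
  shows "(\<exists>r. 1 \<le> r \<and> r \<le> n \<and> Q (row_bits vs es j0 r = 2) (row_bits vs es j1 r = 2) (row_bits vs es j2 r = 2) (row_bits vs es j3 r = 2))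
    \<longleftrightarrow> (\<exists>v\<in>V. Q (v \<in> edge j0) (v \<in> edge j1) (v \<in> edge j2) (v \<in> edge j3))" (is "?L \<longleftrightarrow> ?R")
proof
  assume ?L
  then obtain r where r: "1 \<le> r" "r \<le> n"
    "Q (vs ! (r - 1) \<in> edge j0) (vs ! (r - 1) \<in> edge j1) (vs ! (r - 1) \<in> edge j2) (vs ! (r - 1) \<in> edge j3)"
    using assms by (auto simp: bit_iff)
  moreover have "vs ! (r - 1) \<in> V" using r(1,2) vs(2) nth_mem[of "r - 1" vs] by auto
  ultimately show ?R by blast
next
  assume ?R
  then obtain v where v: "v \<in> V" "Q (v \<in> edge j0) (v \<in> edge j1) (v \<in> edge j2) (v \<in> edge j3)" by blast
  then obtain i where i: "i < n" "vs ! i = v" using vs(2) by (auto simp: in_set_conv_nth)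
  show ?L by (rule exI[of _ "Suc i"]) (use v i assms in \<open>simp add: bit_iff\<close>)
qed

definition scanning :: "(nat \<Rightarrow> nat) \<Rightarrow> bool" where
  "scanning J \<longleftrightarrow> (\<forall>i. \<not> matrix_tape i \<longrightarrow> J i = 0) \<and> row (J 0) \<and> row (J 1) \<and> row (J 2) \<and> row (J 3)"

lemma scan_atom:
  assumes J: "scanning J" and i: "6 \<le> i" "i \<le> 16"
  shows "den scan J a i 0 = of_bool (\<exists>v\<in>V. atom i (v \<in> edge (J 0)) (v \<in> edge (J 1)) (v \<in> edge (J 2)) (v \<in> edge (J 3)))"
proof -
  have r: "row (J 0)" "row (J 1)" "row (J 2)" "row (J 3)" and "\<forall>i. \<not> matrix_tape i \<longrightarrow> J i = 0"
    using J by (simp_all add: scanning_def)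
  from den_scan(2)[OF this(5) i] ex_column[OF r, of "atom i"] show ?thesis by simp
qed

lemma edge_eq_iff:
  assumes "row j" "row k"
  shows "(\<forall>v\<in>V. (v \<in> edge j) = (v \<in> edge k)) \<longleftrightarrow> j = k"
proof -
  have "(\<forall>v\<in>V. (v \<in> edge j) = (v \<in> edge k)) \<longleftrightarrow> edge j = edge k"
    using edge_subset[OF assms(1)] edge_subset[OF assms(2)] by blast
  then show ?thesis using edge_inj[OF assms] by simp
qed

lemma edge_meet:
  "row j \<Longrightarrow> (\<exists>v\<in>V. v \<in> edge j \<and> v \<in> X) \<longleftrightarrow> edge j \<inter> X \<noteq> {}"
  "row j \<Longrightarrow> (\<exists>v\<in>V. v \<in> edge j \<and> v \<in> X \<and> v \<in> Y) \<longleftrightarrow> edge j \<inter> X \<inter> Y \<noteq> {}"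
  using edge_subset[of j] by blast+

lemma scan_results:
  assumes J: "scanning J"
  shows "den scan J a 5 0 = min 3 (card (edge (J 0)))"
    "den scan J a 6 0 = of_bool (J 0 \<noteq> J 1)" "den scan J a 7 0 = of_bool (J 0 \<noteq> J 2)"
    "den scan J a 8 0 = of_bool (J 0 \<noteq> J 3)" "den scan J a 9 0 = of_bool (J 1 \<noteq> J 2)"
    "den scan J a 10 0 = of_bool (J 1 \<noteq> J 3)" "den scan J a 11 0 = of_bool (J 2 \<noteq> J 3)"
    "den scan J a 12 0 = of_bool (edge (J 0) \<inter> edge (J 1) \<noteq> {})"
    "den scan J a 13 0 = of_bool (edge (J 0) \<inter> edge (J 2) \<noteq> {})"
    "den scan J a 14 0 = of_bool (edge (J 0) \<inter> edge (J 3) \<noteq> {})"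
    "den scan J a 15 0 = of_bool (edge (J 1) \<inter> edge (J 2) \<noteq> {})"
    "den scan J a 16 0 = of_bool (edge (J 0) \<inter> edge (J 1) \<inter> edge (J 2) \<noteq> {})"
    "i < 5 \<or> 16 < i \<Longrightarrow> den scan J a i = a i"
  using J den_scan(1,3)[of J] card_columns[of "J 0"]
  by (simp_all add: scan_atom[OF J] atom_def scanning_def edge_eq_iff edge_meet del: den.simps)

section \<open>Simulation of the pruning rounds\<close>

definition alive_on :: "cells \<Rightarrow> nat \<Rightarrow> nat set \<Rightarrow> bool" where
  "alive_on a t K \<longleftrightarrow> (\<forall>j. row j \<longrightarrow> a t j = (if j \<in> K then 3 else 4))"

text \<open>Tape 4 is left out: it only counts the rounds, and its separators are never
  marked.\<close>

definition alive :: "cells \<Rightarrow> nat set \<Rightarrow> bool" where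
  "alive a K \<longleftrightarrow> (\<forall>t<4. alive_on a t K)"

lemma alive_cong: "alive a K \<Longrightarrow> (\<And>t. t < 4 \<Longrightarrow> b t = a t) \<Longrightarrow> alive b K"
  by (simp add: alive_def alive_on_def)

lemma alive_three: "alive a K \<Longrightarrow> row (J t) \<Longrightarrow> t < 4 \<Longrightarrow> a t (J t) = 3 \<longleftrightarrow> J t \<in> K"
  by (simp add: alive_def alive_on_def)

text \<open>If \<open>e\<close> has two points, then \<open>f = g\<close> may be any edge that meets it.\<close>

definition pair_found :: "nat set \<Rightarrow> nat \<Rightarrow> nat \<Rightarrow> nat \<Rightarrow> bool" where
  "pair_found K e f g \<longleftrightarrow> f \<in> K \<and> g \<in> K \<and> f \<noteq> e \<and> g \<noteq> e \<and> edge e \<inter> edge f \<noteq> {} \<and> edge e \<inter> edge g \<noteq> {} \<and>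
     (card (edge e) = 2 \<or> edge e \<inter> edge f \<inter> edge g = {})"

definition prunable :: "nat set \<Rightarrow> nat \<Rightarrow> bool" where
  "prunable K e \<longleftrightarrow> (card (edge e) = 2 \<or> card (edge e) = 3) \<and> \<not> (\<exists>f g. row f \<and> row g \<and> pair_found K e f g)"

definition pruned :: "nat set \<Rightarrow> nat \<Rightarrow> nat set" where
  "pruned K e = (if e \<in> K \<and> prunable K e then K - {e} else K)"

lemma card_edge_le: "row j \<Longrightarrow> card (edge j) \<le> 3"
  using lin edge_mem by (auto simp: linear_family_def)

lemma mask_at: "i < 20 \<Longrightarrow> mask \<rho> i = \<rho> i"
  by (simp add: mask_def ntapes_def)

lemma den_pair_test:
  assumes J: "scanning J" and K: "alive a K"
  shows "(\<forall>t. t < 5 \<or> 17 < t \<longrightarrow> den pair_test J a t = a t) \<and>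
     (den pair_test J a 17 0 = 1 \<longleftrightarrow> a 17 0 = 1 \<or> (\<exists>f. row f \<and> (\<exists>g. row g \<and> pair_found K (J 0) f g)))"
proof -
  let ?I = "\<lambda>b :: cells. \<forall>t. t < 5 \<or> 17 < t \<longrightarrow> b t = a t"
  let ?fl = "\<lambda>b :: cells. b 17 0 = 1"
  define body where "body = RSeq scan (Upd note_pair)"
  have step: "?I (den body J b) \<and> (?fl (den body J b) \<longleftrightarrow> ?fl b \<or> pair_found K (J 0) (J 1) (J 2))"
    if J: "scanning J" and b: "?I b" for J b
  proof -
    define c where "c = den scan J b"
    have J0: "J i = 0" if "5 \<le> i" for i using J that by (simp add: scanning_def)
    note s = scan_results[OF J, where a = b, folded c_def]
    have "alive b K" using K by (rule alive_cong) (use b in simp)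
    from alive_three[OF this, of J] have al: "b 1 (J 1) = 3 \<longleftrightarrow> J 1 \<in> K" "b 2 (J 2) = 3 \<longleftrightarrow> J 2 \<in> K"
      using J by (simp_all add: scanning_def)
    have cb: "c 1 = b 1" "c 2 = b 2" "c 17 = b 17" by (rule s(13), simp)+
    have size: "c 5 0 = card (edge (J 0))"
      using s(1) card_edge_le[of "J 0"] J by (simp add: scanning_def)
    have of_bool: "(of_bool P = (1::nat)) = P" "(of_bool P = (0::nat)) = (\<not> P)" for P by simp_all
    have "den body J b 17 0 = (if c 17 0 = 1 \<or> c 1 (J 1) = 3 \<and> c 2 (J 2) = 3 \<and> c 6 0 = 1 \<and> c 7 0 = 1 \<and>
        c 12 0 = 1 \<and> c 13 0 = 1 \<and> (c 5 0 = 2 \<or> c 16 0 = 0) then 1 else 0)"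
      unfolding body_def den.simps(4) c_def[symmetric]
      by (subst den_Upd_at) (simp_all add: ntapes_def mask_at J0 note_pair_def)
    also have "\<dots> = of_bool (b 17 0 = 1 \<or> pair_found K (J 0) (J 1) (J 2))"
      unfolding cb al size s(2,3,8,9,12) of_bool pair_found_def by (auto simp: eq_commute[of "J 0"])
    finally have val: "den body J b 17 0 = of_bool (b 17 0 = 1 \<or> pair_found K (J 0) (J 1) (J 2))" .
    have "den body J b t = a t" if t: "t < 5 \<or> 17 < t" for t
    proof -
      have "den body J b t = c t"
        unfolding body_def den.simps(4) c_def[symmetric]
        using t by (cases "t < 20"; cases "t = 17") (simp_all add: den_Upd_at ntapes_def mask_at note_pair_def fun_upd_idem)
      then show ?thesis using s(13)[of t] b t by auto
    qed
    then show ?thesis unfolding val by simp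
  qed
  have upd: "scanning (J'(i := j))" if "scanning J'" "matrix_tape i" "row j" for J' i j
    using that by (auto simp: scanning_def)
  have eq: "pair_test = For 1 (For 2 body)" by (simp add: pair_test_def body_def)
  have inner: "?I (den (For 2 body) (J(1 := f)) b) \<and>
      (?fl (den (For 2 body) (J(1 := f)) b) \<longleftrightarrow> ?fl b \<or> (\<exists>g. 1 \<le> g \<and> g \<le> m \<and> pair_found K (J 0) f g))"
    if "1 \<le> f" "f \<le> m" "?I b" for f b
  proof (rule den_For_flag[where I = ?I and fl = ?fl, OF that(3)])
    fix g and b :: cells
    assume g: "1 \<le> g" "g \<le> m" and b: "?I b"
    have "scanning (J(1 := f, 2 := g))"
      by (intro upd J) (use g that(1,2) in \<open>simp_all add: row_def\<close>)
    from step[OF this b]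
    show "?I (den body (J(1 := f, 2 := g)) b) \<and>
      (?fl (den body (J(1 := f, 2 := g)) b) \<longleftrightarrow> ?fl b \<or> pair_found K (J 0) f g)"
      by simp
  qed
  have Ia: "?I a" by simp
  show ?thesis
    unfolding eq row_def conj_assoc
    by (rule den_For_flag[where I = ?I and fl = ?fl, OF Ia]) (rule inner)
qed

lemma den_kill:
  assumes J: "scanning J" and t: "1 \<le> t" "t < 4" "q = t + 5" and K: "alive_on a t K"
    and c: "c \<longleftrightarrow> a 17 0 = 1"
  shows "alive_on (den (kill t q) J a) t (if c then K - {J 0} else K)"
    and "i \<noteq> t \<Longrightarrow> i < 5 \<or> 16 < i \<Longrightarrow> den (kill t q) J a i = a i"
proof -
  \<comment> \<open>When the loop is about to visit row \<open>l\<close>, the mark has been set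
    exactly if it was ordered and row \<open>J 0\<close> has been passed.\<close>
  let ?P = "\<lambda>l b. alive_on b t (if c \<and> J 0 < l then K - {J 0} else K) \<and> (\<forall>i. i \<noteq> t \<and> (i < 5 \<or> 16 < i) \<longrightarrow> b i = a i)"
  have "?P (m + 1) (den (kill t q) J a)"
    unfolding kill_def den.simps(3)
  proof (rule fold_invariant_upt[where P = ?P])
    show "?P 1 a" using K J by (auto simp: scanning_def row_def)
  next
    fix l b assume l: "1 \<le> l" "l < m + 1" and P: "?P l b"
    let ?J = "J(t := l)"
    define d where "d = den scan ?J b"
    let ?b = "den (RSeq scan (Upd (\<lambda>\<rho> i. if i = t \<and> \<rho> 17 = 1 \<and> \<rho> q = 0 \<and> \<rho> t = 3 then 4 else \<rho> i))) ?J b"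
    have J': "scanning ?J" using J t l by (auto simp: scanning_def row_def)
    have J0: "?J i = 0" if "5 \<le> i" for i using J' that by (simp only: scanning_def)
    note s = scan_results[OF J', where a = b, folded d_def]
    have b': "?b i = (d i)(?J i := (if i = t \<and> d 17 (?J 17) = 1 \<and> d q (?J q) = 0 \<and> d t (?J t) = 3 then 4 else d i (?J i)))" if "i < 20" for i
      using that t unfolding den.simps(4) d_def[symmetric]
      by (subst den_Upd_at) (simp_all add: ntapes_def mask_at)
    have big: "?b i = d i" if "20 \<le> i" for i
      using that by (simp add: d_def ntapes_def)
    have "t = 1 \<or> t = 2 \<or> t = 3" using t by auto
    then have q: "d q 0 = of_bool (J 0 \<noteq> l)" using s(2,3,4) t(3) by auto
    have flag: "d 17 0 = 1 \<longleftrightarrow> c" using s(13)[of 17] P t c by simp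
    have dt: "d t = b t" using s(13)[of t] t by simp
    have "?b t = (b t)(l := (if c \<and> J 0 = l \<and> b t l = 3 then 4 else b t l))"
      using b'[of t] t J0[of 17] J0[of q] flag q dt by (simp add: fun_eq_iff)
    moreover have "alive_on b t (if c \<and> J 0 < l then K - {J 0} else K)" using P by blast
    ultimately have "alive_on ?b t (if c \<and> J 0 < Suc l then K - {J 0} else K)"
      by (auto simp: alive_on_def less_Suc_eq)
    moreover have "?b i = a i" if "i \<noteq> t" "i < 5 \<or> 16 < i" for i
    proof -
      have "?b i = d i" using b'[of i] big[of i] that(1) by (cases "i < 20") auto
      then show ?thesis using s(13)[of i] P that by simp
    qed
    ultimately show "?P (Suc l) ?b" by blast
  qed simp
  moreover have "J 0 < m + 1" using J by (simp add: scanning_def row_def)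
  ultimately show "alive_on (den (kill t q) J a) t (if c then K - {J 0} else K)"
    and "i \<noteq> t \<Longrightarrow> i < 5 \<or> 16 < i \<Longrightarrow> den (kill t q) J a i = a i" by simp_all
qed

lemma den_prune_edge:
  assumes J: "scanning J" and K: "alive a K"
  shows "alive (den prune_edge J a) (pruned K (J 0)) \<and> den prune_edge J a 19 = a 19"
proof -
  define a1 where "a1 = den (Upd (\<lambda>\<rho> i. if i = 17 then 0 else \<rho> i)) J a"
  define a2 where "a2 = den pair_test J a1"
  define a3 where "a3 = den scan J a2"
  define a4 where "a4 = den (Upd (\<lambda>\<rho> i. if i = 17 then if \<rho> 0 = 3 \<and> (\<rho> 5 = 2 \<or> \<rho> 5 = 3) \<and> \<rho> 17 \<noteq> 1 then 1 else 0 else \<rho> i)) J a3"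
  define a5 where "a5 = den (kill 1 6) J a4"
  define a6 where "a6 = den (kill 2 7) J a5"
  define a7 where "a7 = den (kill 3 8) J a6"
  define a8 where "a8 = den (Upd (\<lambda>\<rho> i. if i = 0 \<and> \<rho> 17 = 1 \<and> \<rho> 0 = 3 then 4 else \<rho> i)) J a7"
  have a8_eq: "den prune_edge J a = a8"
    by (simp only: prune_edge_def den.simps(4) a1_def a2_def a3_def a4_def a5_def a6_def a7_def a8_def)
  have J0: "J i = 0" if "5 \<le> i" for i using J that by (simp add: scanning_def)
  have a1: "a1 17 0 = 0" "\<And>i. i \<noteq> 17 \<Longrightarrow> a1 i = a i"
    using J0 by (auto simp: a1_def ntapes_def mask_def)
  have K1: "alive a1 K" using K by (rule alive_cong) (simp add: a1)
  note pt = den_pair_test[OF J K1, folded a2_def]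
  have K2: "alive a2 K" using K1 by (rule alive_cong) (use pt in simp)
  note s = scan_results[OF J, where a = a2, folded a3_def]
  have K3: "alive a3 K" using K2 by (rule alive_cong) (use s(13) in simp)
  let ?e = "J 0"
  have re: "row ?e" using J by (simp add: scanning_def)
  define c where "c \<longleftrightarrow> ?e \<in> K \<and> prunable K ?e"
  define K' where "K' = (if c then K - {?e} else K)"
  have found: "a3 17 0 = 1 \<longleftrightarrow> (\<exists>f g. row f \<and> row g \<and> pair_found K ?e f g)"
    using pt a1 s(13)[of 17] by auto
  have size: "a3 5 0 = card (edge ?e)" using s(1) card_edge_le[OF re] by simp
  have here: "a3 0 ?e = 3 \<longleftrightarrow> ?e \<in> K" using alive_three[OF K3, of J 0] re by simp
  have a4_17: "a4 17 0 = 1 \<longleftrightarrow> c"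
  proof -
    have "a4 17 0 = (if a3 0 ?e = 3 \<and> (a3 5 0 = 2 \<or> a3 5 0 = 3) \<and> a3 17 0 \<noteq> 1 then 1 else 0)"
      unfolding a4_def by (subst den_Upd_at) (simp_all add: ntapes_def mask_at J0)
    then show ?thesis unfolding c_def prunable_def found[symmetric] by (simp add: size here)
  qed
  have a4: "a4 i = a3 i" if "i \<noteq> 17" for i
    using that by (auto simp: a4_def mask_def)
  have on3: "alive_on a3 t K" if "t < 4" for t using K3 that by (simp add: alive_def)
  have on: "alive_on a4 1 K" "alive_on a4 2 K" "alive_on a4 3 K" "alive_on a4 0 K"
    using on3[of 1] on3[of 2] on3[of 3] on3[of 0] a4 by (simp_all add: alive_on_def)
  note k5 = den_kill[OF J, where t = 1 and q = 6 and a = a4 and K = K and c = c, folded a5_def]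
  have a5: "alive_on a5 1 K'" "\<And>i. i \<noteq> 1 \<Longrightarrow> i < 5 \<or> 16 < i \<Longrightarrow> a5 i = a4 i"
    using k5 on a4_17 by (simp_all add: K'_def)
  note k6 = den_kill[OF J, where t = 2 and q = 7 and a = a5 and K = K and c = c, folded a6_def]
  have on5: "alive_on a5 2 K" using on a5(2) by (simp add: alive_on_def)
  have a6: "alive_on a6 2 K'" "\<And>i. i \<noteq> 2 \<Longrightarrow> i < 5 \<or> 16 < i \<Longrightarrow> a6 i = a5 i"
    using k6 on5 a4_17 a5(2) by (simp_all add: K'_def)
  note k7 = den_kill[OF J, where t = 3 and q = 8 and a = a6 and K = K and c = c, folded a7_def]
  have on6: "alive_on a6 3 K" using on a5(2) a6(2) by (simp add: alive_on_def)
  have a7: "alive_on a7 3 K'" "\<And>i. i \<noteq> 3 \<Longrightarrow> i < 5 \<or> 16 < i \<Longrightarrow> a7 i = a6 i"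
    using k7 on6 a4_17 a5(2) a6(2) by (simp_all add: K'_def)
  have a7_17: "a7 17 0 = 1 \<longleftrightarrow> c" using a4_17 a5(2) a6(2) a7(2) by simp
  have a7_0: "alive_on a7 0 K" using on(4) a5(2) a6(2) a7(2) by (simp add: alive_on_def)
  have a8_0: "a8 0 = (a7 0)(?e := (if c \<and> a7 0 ?e = 3 then 4 else a7 0 ?e))"
    unfolding a8_def by (subst den_Upd_at) (simp_all add: ntapes_def mask_at J0 a7_17[unfolded One_nat_def])
  have a8_other: "a8 i = a7 i" if "i \<noteq> 0" for i
    using that by (auto simp: a8_def mask_def)
  have "alive_on a8 0 K'"
    using a7_0 re unfolding alive_on_def a8_0 K'_def by auto
  moreover have "alive_on a8 1 K'" "alive_on a8 2 K'" "alive_on a8 3 K'"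
    using a5 a6 a7 a8_other by (simp_all add: alive_on_def)
  ultimately have "alive a8 K'"
    unfolding alive_def by (auto simp: numeral_eq_Suc less_Suc_eq)
  moreover have "K' = pruned K ?e" by (simp add: K'_def c_def pruned_def)
  moreover have "a8 19 = a 19"
  proof -
    have "a8 19 = a4 19" using a8_other[of 19] a7(2)[of 19] a6(2)[of 19] a5(2)[of 19] by simp
    also have "\<dots> = a2 19" using a4[of 19] s(13)[of 19] by simp
    also have "\<dots> = a 19" using pt a1(2)[of 19] by simp
    finally show ?thesis .
  qed
  ultimately show ?thesis unfolding a8_eq by simp
qed

lemma fold_simulation:
  assumes "R x y" "\<And>j x y. j \<in> set js \<Longrightarrow> R x y \<Longrightarrow> R (f j x) (g j y)"
  shows "R (fold f js x) (fold g js y)"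
  using assms by (induction js arbitrary: x y) auto

lemma den_round:
  assumes J: "row l" and K: "alive a K"
  shows "alive (den (For 0 prune_edge) ((heads 1)(4 := l)) a) (fold (\<lambda>j K. pruned K j) [1..<m + 1] K) \<and>
    den (For 0 prune_edge) ((heads 1)(4 := l)) a 19 = a 19"
  unfolding den.simps(3)
proof (rule fold_simulation[where R = "\<lambda>b K. alive b K \<and> b 19 = a 19"])
  fix j b K'
  assume j: "j \<in> set [1..<m + 1]" and b: "alive b K' \<and> b 19 = a 19"
  let ?J = "(heads 1)(4 := l, 0 := j)"
  have "scanning ?J" using J j by (auto simp: scanning_def heads_def row_def)
  from den_prune_edge[OF this conjunct1[OF b]] b
  show "alive (den prune_edge ?J b) (pruned K' j) \<and> den prune_edge ?J b 19 = a 19" by simp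
qed (use K in simp)

definition prune_round :: "nat set \<Rightarrow> nat set" where
  "prune_round K = fold (\<lambda>j K. pruned K j) [1..<m + 1] K"

definition core :: "nat set" where
  "core = (prune_round ^^ m) {j. row j}"

lemma den_rounds:
  "alive (den (For 4 (For 0 prune_edge)) (heads 1) initial_cells) core \<and>
    den (For 4 (For 0 prune_edge)) (heads 1) initial_cells 19 0 = 0"
proof -
  have "alive (den (For 4 (For 0 prune_edge)) (heads 1) initial_cells) (fold (\<lambda>_. prune_round) [1..<m + 1] {j. row j}) \<and>
    den (For 4 (For 0 prune_edge)) (heads 1) initial_cells 19 = initial_cells 19"
    unfolding den.simps(3)[of 4]
  proof (rule fold_simulation[where R = "\<lambda>b K. alive b K \<and> b 19 = initial_cells 19"])
    show "alive initial_cells {j. row j} \<and> initial_cells 19 = initial_cells 19"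
      by (auto simp: alive_def alive_on_def initial_cells_def row_def)
    fix j b K
    assume "j \<in> set [1..<m + 1]" and b: "alive b K \<and> b 19 = initial_cells 19"
    then have "row j" by (auto simp: row_def)
    from den_round[OF this conjunct1[OF b]] b
    show "alive (den (For 0 prune_edge) ((heads 1)(4 := j)) b) (prune_round K) \<and>
      den (For 0 prune_edge) ((heads 1)(4 := j)) b 19 = initial_cells 19"
      by (simp only: prune_round_def)
  qed
  moreover have "fold (\<lambda>_. prune_round) js K = (prune_round ^^ length js) K" for js :: "nat list" and K
    by (induction js arbitrary: K) (simp_all add: funpow_swap1)
  from this[of "[1..<m + 1]"] have "fold (\<lambda>_. prune_round) [1..<m + 1] {j. row j} = core"
    by (simp only: core_def length_upt) simp
  ultimately show ?thesis by (simp only: initial_cells_def) simp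
qed

section \<open>The test of the core\<close>

definition bad :: "nat set \<Rightarrow> nat \<Rightarrow> nat \<Rightarrow> nat \<Rightarrow> nat \<Rightarrow> bool" where
  "bad K e f g h \<longleftrightarrow> e \<in> K \<and> (card (edge e) \<noteq> 3 \<or>
     f \<in> K \<and> g \<in> K \<and> e \<noteq> f \<and> e \<noteq> g \<and> f \<noteq> g \<and> edge e \<inter> edge f \<inter> edge g \<noteq> {} \<or>
     f \<in> K \<and> g \<in> K \<and> h \<in> K \<and> distinct [e, f, g, h] \<and>
       edge e \<inter> edge f \<noteq> {} \<and> edge e \<inter> edge g \<noteq> {} \<and> edge e \<inter> edge h \<noteq> {} \<and> edge f \<inter> edge g = {})"

lemma den_check_edges:
  assumes K: "alive a K" and v: "a 19 0 = 0"
  shows "den check_edges (heads 1) a 19 0 = 1 \<longleftrightarrow> (\<exists>e f g h. row e \<and> row f \<and> row g \<and> row h \<and> bad K e f g h)"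
    "den check_edges (heads 1) a 19 0 \<le> 1"
proof -
  let ?I = "\<lambda>b :: cells. (\<forall>t<4. b t = a t) \<and> b 19 0 \<le> 1"
  let ?fl = "\<lambda>b :: cells. b 19 0 = 1"
  define body where "body = RSeq scan (Upd note_bad)"
  have step: "?I (den body J b) \<and> (?fl (den body J b) \<longleftrightarrow> ?fl b \<or> bad K (J 0) (J 1) (J 2) (J 3))"
    if J: "scanning J" and b: "?I b" for J b
  proof -
    define c where "c = den scan J b"
    have J0: "J i = 0" if "5 \<le> i" for i using J that by (simp add: scanning_def)
    note s = scan_results[OF J, where a = b, folded c_def]
    have "alive b K" using K by (rule alive_cong) (use b in simp)
    from alive_three[OF this, of J] have al: "b 0 (J 0) = 3 \<longleftrightarrow> J 0 \<in> K" "b 1 (J 1) = 3 \<longleftrightarrow> J 1 \<in> K"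
      "b 2 (J 2) = 3 \<longleftrightarrow> J 2 \<in> K" "b 3 (J 3) = 3 \<longleftrightarrow> J 3 \<in> K"
      using J by (simp_all add: scanning_def)
    have cb: "c 0 = b 0" "c 1 = b 1" "c 2 = b 2" "c 3 = b 3" "c 19 = b 19"
      by (rule s(13), simp)+
    have size: "c 5 0 = card (edge (J 0))"
      using s(1) card_edge_le[of "J 0"] J by (simp add: scanning_def)
    have of_bool: "(of_bool P = (1::nat)) = P" "(of_bool P = (0::nat)) = (\<not> P)" for P by simp_all
    have "den body J b 19 0 = (if c 19 0 = 1 \<or> c 0 (J 0) = 3 \<and> (c 5 0 \<noteq> 3 \<or>
         c 1 (J 1) = 3 \<and> c 2 (J 2) = 3 \<and> c 6 0 = 1 \<and> c 7 0 = 1 \<and> c 9 0 = 1 \<and> c 16 0 = 1 \<or>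
         c 1 (J 1) = 3 \<and> c 2 (J 2) = 3 \<and> c 3 (J 3) = 3 \<and> c 6 0 = 1 \<and> c 7 0 = 1 \<and> c 8 0 = 1 \<and> c 9 0 = 1 \<and> c 10 0 = 1 \<and> c 11 0 = 1 \<and>
           c 12 0 = 1 \<and> c 13 0 = 1 \<and> c 14 0 = 1 \<and> c 15 0 = 0) then 1 else 0)"
      unfolding body_def den.simps(4) c_def[symmetric]
      by (subst den_Upd_at) (simp_all add: ntapes_def mask_at J0 note_bad_def)
    also have "\<dots> = of_bool (b 19 0 = 1 \<or> bad K (J 0) (J 1) (J 2) (J 3))"
      unfolding cb al size s(2-12) of_bool bad_def by (simp add: conj_ac)
    finally have val: "den body J b 19 0 = of_bool (b 19 0 = 1 \<or> bad K (J 0) (J 1) (J 2) (J 3))" .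
    have "den body J b t = a t" if "t < 4" for t
    proof -
      have "den body J b t = c t"
        unfolding body_def den.simps(4) c_def[symmetric]
        using that by (subst den_Upd_at) (simp_all add: ntapes_def mask_at note_bad_def)
      then show ?thesis using s(13)[of t] b that by simp
    qed
    then show ?thesis unfolding val by simp
  qed
  have eq: "check_edges = For 0 (For 1 (For 2 (For 3 body)))" by (simp add: check_edges_def body_def)
  let ?J = "\<lambda>e f g h. (heads 1)(0 := e, 1 := f, 2 := g, 3 := h)"
  have sc: "scanning (?J e f g h)" if "row e" "row f" "row g" "row h" for e f g h
    using that by (auto simp: scanning_def heads_def row_def)
  have l3: "?I (den (For 3 body) ((heads 1)(0 := e, 1 := f, 2 := g)) b) \<and>
      (?fl (den (For 3 body) ((heads 1)(0 := e, 1 := f, 2 := g)) b) \<longleftrightarrow> ?fl b \<or> (\<exists>h. 1 \<le> h \<and> h \<le> m \<and> bad K e f g h))"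
    if "row e" "row f" "row g" "?I b" for e f g b
    by (rule den_For_flag[where I = ?I and fl = ?fl, OF that(4)])
      (use step[OF sc[OF that(1-3)]] in \<open>simp add: row_def\<close>)
  have l2: "?I (den (For 2 (For 3 body)) ((heads 1)(0 := e, 1 := f)) b) \<and>
      (?fl (den (For 2 (For 3 body)) ((heads 1)(0 := e, 1 := f)) b) \<longleftrightarrow> ?fl b \<or> (\<exists>g. 1 \<le> g \<and> g \<le> m \<and> (\<exists>h. 1 \<le> h \<and> h \<le> m \<and> bad K e f g h)))"
    if "row e" "row f" "?I b" for e f b
    by (rule den_For_flag[where I = ?I and fl = ?fl, OF that(3)])
      (use l3[OF that(1,2)] in \<open>simp add: row_def del: den.simps\<close>)
  have l1: "?I (den (For 1 (For 2 (For 3 body))) ((heads 1)(0 := e)) b) \<and>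
      (?fl (den (For 1 (For 2 (For 3 body))) ((heads 1)(0 := e)) b) \<longleftrightarrow> ?fl b \<or>
        (\<exists>f. 1 \<le> f \<and> f \<le> m \<and> (\<exists>g. 1 \<le> g \<and> g \<le> m \<and> (\<exists>h. 1 \<le> h \<and> h \<le> m \<and> bad K e f g h))))"
    if "row e" "?I b" for e b
    by (rule den_For_flag[where I = ?I and fl = ?fl, OF that(2)])
      (use l2[OF that(1)] in \<open>simp add: row_def del: den.simps\<close>)
  have l0: "?I (den check_edges (heads 1) a) \<and>
      (?fl (den check_edges (heads 1) a) \<longleftrightarrow> ?fl a \<or> (\<exists>e. 1 \<le> e \<and> e \<le> m \<and>
        (\<exists>f. 1 \<le> f \<and> f \<le> m \<and> (\<exists>g. 1 \<le> g \<and> g \<le> m \<and> (\<exists>h. 1 \<le> h \<and> h \<le> m \<and> bad K e f g h)))))"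
    unfolding eq
    by (rule den_For_flag[where I = ?I and fl = ?fl])
      (use l1 v in \<open>simp_all add: row_def del: den.simps\<close>)
  show "den check_edges (heads 1) a 19 0 \<le> 1" using l0 by blast
  show "den check_edges (heads 1) a 19 0 = 1 \<longleftrightarrow> (\<exists>e f g h. row e \<and> row f \<and> row g \<and> row h \<and> bad K e f g h)"
    using l0 v unfolding row_def by auto
qed

end

text \<open>Let \<open>N\<close> be the points of \<open>e\<close> on other edges. An edge with two
  points needs \<open>N\<close> empty, that is, no other edge meets it; an edge with three points
  needs \<open>card N \<le> 1\<close>. By linearity another edge meets \<open>e\<close> in at most
  one point, so two points of \<open>N\<close> show up as two meeting edges with
  \<open>e \<inter> f \<inter> g = {}\<close>.\<close>

lemma two_private_points_iff:
  assumes lin: "linear_family F" and e: "e \<in> F"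
  shows "2 \<le> card (private_points F e) \<longleftrightarrow>
    (card e = 2 \<or> card e = 3) \<and> \<not> (\<exists>f\<in>F. \<exists>g\<in>F. f \<noteq> e \<and> g \<noteq> e \<and> e \<inter> f \<noteq> {} \<and> e \<inter> g \<noteq> {} \<and>
      (card e = 2 \<or> e \<inter> f \<inter> g = {}))"
proof -
  define N where "N = {v\<in>e. \<exists>f\<in>F. v \<in> f \<and> f \<noteq> e}"
  have fe: "finite e" "card e \<le> 3" using lin e by (simp_all add: linear_family_def)
  have fN: "finite N" using fe(1) by (simp add: N_def)
  have "private_points F e = e - N" by (auto simp: private_points_def N_def)
  then have card: "card (private_points F e) + card N = card e"
    using card_Diff_subset[OF fN, of e] card_mono[OF fe(1), of N] by (auto simp: N_def)
  have zero: "card N = 0 \<longleftrightarrow> \<not> (\<exists>f\<in>F. f \<noteq> e \<and> e \<inter> f \<noteq> {})"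
    using fN by (auto simp: N_def)
  have two: "card N \<le> 1 \<longleftrightarrow>
    \<not> (\<exists>f\<in>F. \<exists>g\<in>F. f \<noteq> e \<and> g \<noteq> e \<and> e \<inter> f \<noteq> {} \<and> e \<inter> g \<noteq> {} \<and> e \<inter> f \<inter> g = {})"
  proof
    assume le: "card N \<le> 1"
    show "\<not> (\<exists>f\<in>F. \<exists>g\<in>F. f \<noteq> e \<and> g \<noteq> e \<and> e \<inter> f \<noteq> {} \<and> e \<inter> g \<noteq> {} \<and> e \<inter> f \<inter> g = {})"
    proof (intro notI, elim bexE conjE)
      fix f g
      assume fg: "f \<in> F" "g \<in> F" "f \<noteq> e" "g \<noteq> e" "e \<inter> f \<noteq> {}" "e \<inter> g \<noteq> {}" "e \<inter> f \<inter> g = {}"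
      obtain v where v: "v \<in> e" "v \<in> f" using fg(5) by blast
      obtain w where w: "w \<in> e" "w \<in> g" using fg(6) by blast
      have "v \<noteq> w" using v w fg(7) by blast
      moreover have "v \<in> N" "w \<in> N" using v w fg(1-4) unfolding N_def by blast+
      ultimately show False using le fN card_le_Suc0_iff_eq[of N] by auto
    qed
  next
    assume none: "\<not> (\<exists>f\<in>F. \<exists>g\<in>F. f \<noteq> e \<and> g \<noteq> e \<and> e \<inter> f \<noteq> {} \<and> e \<inter> g \<noteq> {} \<and> e \<inter> f \<inter> g = {})"
    have "v = w" if vw: "v \<in> N" "w \<in> N" for v w
    proof (rule ccontr)
      assume neq: "v \<noteq> w"
      obtain f where f: "f \<in> F" "v \<in> f" "f \<noteq> e" and v: "v \<in> e" using vw(1) unfolding N_def by blast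
      obtain g where g: "g \<in> F" "w \<in> g" "g \<noteq> e" and w: "w \<in> e" using vw(2) unfolding N_def by blast
      have only: "u = x" if "u \<in> e" "u \<in> k" "x \<in> e" "x \<in> k" "k \<in> F" "k \<noteq> e" for u x k
        using linear_family_eq[OF lin e that(5) that(1,2,3,4)] that(6) by blast
      have "e \<inter> f \<inter> g = {}"
      proof (rule ccontr)
        assume "e \<inter> f \<inter> g \<noteq> {}"
        then obtain u where u: "u \<in> e" "u \<in> f" "u \<in> g" by blast
        have "u = v" by (rule only[OF u(1,2) v f(2) f(1,3)])
        moreover have "u = w" by (rule only[OF u(1,3) w g(2) g(1,3)])
        ultimately show False using neq by simp
      qed
      moreover have "e \<inter> f \<noteq> {}" "e \<inter> g \<noteq> {}" using v w f g by blast+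
      ultimately show False using none f(1,3) g(1,3) by metis
    qed
    then show "card N \<le> 1" using fN card_le_Suc0_iff_eq[of N] by auto
  qed
  show ?thesis
  proof (cases "card e = 2")
    case True
    have "2 \<le> card (private_points F e) \<longleftrightarrow> card N = 0" using card True by linarith
    then show ?thesis using True unfolding zero by auto
  next
    case False
    have "2 \<le> card (private_points F e) \<longleftrightarrow> card e = 3 \<and> card N \<le> 1" using card fe(2) False by linarith
    then show ?thesis using False unfolding two by simp
  qed
qed

section \<open>Correctness of pruning and of the test\<close>

context incidence
begin

lemma edge_Diff:
  assumes "K \<subseteq> {j. row j}" "e \<in> K"
  shows "edge ` (K - {e}) = edge ` K - {edge e}"
proof -
  have "inj_on edge {j. row j}" by (rule inj_onI) (simp add: edge_inj)
  then have "edge ` (K - {e}) = edge ` K - edge ` {e}"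
    by (rule inj_on_image_set_diff) (use assms in auto)
  then show ?thesis by simp
qed

lemma linear_edges: "K \<subseteq> {j. row j} \<Longrightarrow> linear_family (edge ` K)"
  by (rule linear_family_subset[OF lin]) (use edge_mem in blast)

lemma prunable_iff:
  assumes K: "K \<subseteq> {j. row j}" and e: "e \<in> K"
  shows "prunable K e \<longleftrightarrow> 2 \<le> card (private_points (edge ` K) (edge e))"
proof -
  have eq: "edge f = edge e \<longleftrightarrow> f = e" if "f \<in> K" for f
    using edge_inj[of f e] that K e by blast
  have row: "row f \<and> f \<in> K \<longleftrightarrow> f \<in> K" for f using K by blast
  have pair: "(\<exists>f g. row f \<and> row g \<and> pair_found K e f g) \<longleftrightarrow>
    (\<exists>f\<in>edge ` K. \<exists>g\<in>edge ` K. f \<noteq> edge e \<and> g \<noteq> edge e \<and> edge e \<inter> f \<noteq> {} \<and> edge e \<inter> g \<noteq> {} \<and>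
      (card (edge e) = 2 \<or> edge e \<inter> f \<inter> g = {}))"
    (is "?L \<longleftrightarrow> ?R")
  proof
    assume ?L
    then obtain f g where "pair_found K e f g" by blast
    then show ?R unfolding pair_found_def
      by (intro bexI[of _ "edge f"] bexI[of _ "edge g"]) (simp_all add: eq)
  next
    assume ?R
    then obtain f g where fg: "f \<in> K" "g \<in> K" "edge f \<noteq> edge e" "edge g \<noteq> edge e" "edge e \<inter> edge f \<noteq> {}"
      "edge e \<inter> edge g \<noteq> {}" "card (edge e) = 2 \<or> edge e \<inter> edge f \<inter> edge g = {}" by (elim bexE imageE conjE) simp
    then show ?L using K by (intro exI[of _ f] exI[of _ g]) (auto simp: pair_found_def)
  qed
  have "edge e \<in> edge ` K" using e by (rule imageI)
  from two_private_points_iff[OF linear_edges[OF K] this]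
  show ?thesis unfolding prunable_def pair ..
qed

lemma pruned_subset: "pruned K e \<subseteq> K"
  by (auto simp: pruned_def)

lemma fold_pruned_subset: "fold (\<lambda>j K. pruned K j) js K \<subseteq> K"
  by (induction js arbitrary: K) (auto dest: subsetD[OF pruned_subset] subsetD)

lemma prune_round_subset: "prune_round K \<subseteq> K"
  unfolding prune_round_def by (rule fold_pruned_subset)

lemma funpow_prune_round_subset: "(prune_round ^^ i) K \<subseteq> K"
proof (induction i)
  case (Suc i)
  then show ?case using prune_round_subset[of "(prune_round ^^ i) K"] by simp
qed simp

lemma fold_pruned_steps:
  "K \<subseteq> {j. row j} \<Longrightarrow> prune_step\<^sup>*\<^sup>* (edge ` K) (edge ` fold (\<lambda>j K. pruned K j) js K)"
proof (induction js arbitrary: K)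
  case (Cons j js)
  have sub: "pruned K j \<subseteq> {j. row j}" using pruned_subset Cons.prems by blast
  have "prune_step\<^sup>*\<^sup>* (edge ` K) (edge ` pruned K j)"
  proof (cases "j \<in> K \<and> prunable K j")
    case True
    then have "prune_step (edge ` K) (edge ` K - {edge j})"
      using prunable_iff[OF Cons.prems, of j] by (auto simp: prune_step_def)
    then show ?thesis using True edge_Diff[OF Cons.prems] by (simp add: pruned_def)
  next
    case False
    then show ?thesis by (auto simp: pruned_def)
  qed
  then show ?case using Cons.IH[OF sub] by simp
qed simp

lemma core_steps: "prune_step\<^sup>*\<^sup>* (set es) (edge ` core)"
proof -
  have "prune_step\<^sup>*\<^sup>* (edge ` {j. row j}) (edge ` (prune_round ^^ i) {j. row j})" for i
  proof (induction i)
    case (Suc i)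
    have "prune_step\<^sup>*\<^sup>* (edge ` (prune_round ^^ i) {j. row j}) (edge ` prune_round ((prune_round ^^ i) {j. row j}))"
      unfolding prune_round_def[of "(prune_round ^^ i) {j. row j}"]
      by (rule fold_pruned_steps[OF funpow_prune_round_subset])
    with Suc show ?case by simp
  qed simp
  then show ?thesis unfolding core_def edge_image[symmetric] .
qed

lemma core_rows: "core \<subseteq> {j. row j}"
  unfolding core_def by (rule funpow_prune_round_subset)

text \<open>A round that changes nothing finds no prunable edge, and each other round removes an edge, so that
  \<open>m\<close> rounds suffice.\<close>

lemma fold_pruned_fixed:
  assumes "fold (\<lambda>j K. pruned K j) js K = K" "e \<in> set js" "e \<in> K"
  shows "\<not> prunable K e"
  using assms
proof (induction js)
  case (Cons j js)
  have "K \<subseteq> pruned K j" using fold_pruned_subset[of js "pruned K j"] Cons.prems(1) by simp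
  then have fixed: "pruned K j = K" using pruned_subset by blast
  show ?case
  proof (cases "e = j")
    case True
    then show ?thesis using fixed Cons.prems(3) by (auto simp: pruned_def split: if_splits)
  next
    case False
    then show ?thesis using Cons fixed by simp
  qed
qed simp

lemma core_fixed: "prune_round core = core"
proof -
  let ?K = "\<lambda>i. (prune_round ^^ i) {j. row j}"
  have rows: "{j. row j} = {1..m}" by (auto simp: row_def)
  have fin: "finite (?K i)" for i
    by (rule finite_subset[OF funpow_prune_round_subset]) (simp add: rows)
  have "prune_round (?K i) = ?K i \<or> card (?K i) + i \<le> m" for i
  proof (induction i)
    case 0
    then show ?case by (simp add: rows)
  next
    case (Suc i)
    show ?case
    proof (cases "prune_round (?K i) = ?K i")
      case True
      then show ?thesis by simp
    next
      case False
      then have "?K (Suc i) \<subset> ?K i" using prune_round_subset[of "?K i"] by auto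
      then have "card (?K (Suc i)) < card (?K i)" using fin by (intro psubset_card_mono)
      then show ?thesis using Suc False by linarith
    qed
  qed
  \<comment> \<open>After \<open>m\<close> rounds the second alternative leaves no edge at all, and
    the empty set is fixed too.\<close>
  from this[of m] have "prune_round (?K m) = ?K m \<or> ?K m = {}" using fin[of m] by auto
  then show ?thesis unfolding core_def using prune_round_subset[of "{}"] by auto
qed

lemma core_not_prunable: "e \<in> core \<Longrightarrow> \<not> prunable core e"
proof (rule fold_pruned_fixed)
  show "fold (\<lambda>j K. pruned K j) [1..<m + 1] core = core"
    using core_fixed unfolding prune_round_def .
  assume e: "e \<in> core"
  then have "row e" using core_rows by blast
  then show "e \<in> set [1..<m + 1]" unfolding set_upt by (simp add: row_def)
  show "e \<in> core" by (rule e)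
qed

lemma bad_iff:
  assumes K: "K \<subseteq> {j. row j}"
  shows "(\<exists>e f g h. row e \<and> row f \<and> row g \<and> row h \<and> bad K e f g h) \<longleftrightarrow> \<not> (\<forall>e\<in>edge ` K. good_edge (edge ` K) e)"
proof -
  have eq: "edge f = edge e \<longleftrightarrow> f = e" if "f \<in> K" "e \<in> K" for e f
    using edge_inj[of f e] that K by blast
  define Bad where "Bad e \<longleftrightarrow> (\<exists>f g h. row f \<and> row g \<and> row h \<and> bad K e f g h)" for e
  have good: "good_edge (edge ` K) (edge e) \<longleftrightarrow> \<not> Bad e" if e: "e \<in> K" for e
    unfolding Bad_def
  proof
    assume good: "good_edge (edge ` K) (edge e)"
    show "\<not> (\<exists>f g h. row f \<and> row g \<and> row h \<and> bad K e f g h)"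
    proof (intro notI, elim exE conjE)
      fix f g h assume b: "bad K e f g h"
      consider "card (edge e) \<noteq> 3"
        | "f \<in> K" "g \<in> K" "e \<noteq> f" "e \<noteq> g" "f \<noteq> g" "edge e \<inter> edge f \<inter> edge g \<noteq> {}"
        | "f \<in> K" "g \<in> K" "h \<in> K" "distinct [e, f, g, h]" "edge e \<inter> edge f \<noteq> {}" "edge e \<inter> edge g \<noteq> {}"
          "edge e \<inter> edge h \<noteq> {}" "edge f \<inter> edge g = {}"
        using b unfolding bad_def by (elim conjE disjE)
      then show False
      proof cases
        case 1
        then show False using good_edge_card[OF good] by simp
      next
        case 2
        have "edge e \<inter> edge f \<inter> edge g = {}"
          by (rule good_edge_no_triple[OF good]) (use 2 e eq in simp_all)
        then show False using 2(6) by simp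
      next
        case 3
        have "edge f \<inter> edge g \<noteq> {}"
          by (rule good_edge_meet[OF good, of _ _ "edge h"]) (use 3 e eq in simp_all)
        then show False using 3(8) by simp
      qed
    qed
  next
    assume none: "\<not> (\<exists>f g h. row f \<and> row g \<and> row h \<and> bad K e f g h)"
    have re: "row e" using e K by blast
    show "good_edge (edge ` K) (edge e)"
      unfolding good_edge_def
    proof (intro conjI ballI impI)
      show "card (edge e) = 3"
      proof (rule ccontr)
        assume "card (edge e) \<noteq> 3"
        \<comment> \<open>The loops run over quadruples of rows without excluding repetitions. A
          defect that shows on fewer edges is witnessed by filling the remaining places with
          \<open>e\<close>.\<close>
        then have "bad K e e e e" using e by (simp add: bad_def)
        then show False using none re by blast
      qed
    next
      fix f' g' assume "f' \<in> edge ` K" "g' \<in> edge ` K" and neq: "edge e \<noteq> f' \<and> edge e \<noteq> g' \<and> f' \<noteq> g'"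
      then obtain f g where fg: "f \<in> K" "f' = edge f" "g \<in> K" "g' = edge g" by (elim imageE) simp
      show "edge e \<inter> f' \<inter> g' = {}"
      proof (rule ccontr)
        assume "edge e \<inter> f' \<inter> g' \<noteq> {}"
        then have "bad K e f g e" using e fg neq by (auto simp only: bad_def simp_thms)
        moreover have "row f" "row g" using fg K by blast+
        ultimately show False using none re by blast
      qed
    next
      fix f' g' h' assume "f' \<in> edge ` K" "g' \<in> edge ` K" "h' \<in> edge ` K"
        and *: "distinct [edge e, f', g', h'] \<and> edge e \<inter> f' \<noteq> {} \<and> edge e \<inter> g' \<noteq> {} \<and> edge e \<inter> h' \<noteq> {}"
      then obtain f g h where fgh: "f \<in> K" "f' = edge f" "g \<in> K" "g' = edge g" "h \<in> K" "h' = edge h"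
        by (elim imageE) simp
      show "f' \<inter> g' \<noteq> {}"
      proof
        assume empty: "f' \<inter> g' = {}"
        have "distinct [e, f, g, h]" using * fgh by auto
        then have "bad K e f g h" using e fgh * empty by (simp only: bad_def simp_thms)
        moreover have "row f" "row g" "row h" using fgh K by blast+
        ultimately show False using none by blast
      qed
    qed
  qed
  have "(\<exists>e f g h. row e \<and> row f \<and> row g \<and> row h \<and> bad K e f g h) \<longleftrightarrow> (\<exists>e. row e \<and> Bad e)"
    unfolding Bad_def by blast
  also have "\<dots> \<longleftrightarrow> (\<exists>e\<in>K. Bad e)"
  proof -
    have "e \<in> K" if "Bad e" for e using that by (auto simp: Bad_def bad_def)
    then show ?thesis using K by blast
  qed
  also have "\<dots> \<longleftrightarrow> \<not> (\<forall>e\<in>edge ` K. good_edge (edge ` K) e)"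
    using good by (simp only: ball_simps) blast
  finally show ?thesis .
qed

end

theorem corollary4p8:
  "\<exists>M. turing_machine M \<and>
       poly_time_decides M
         (\<lambda>H. hypergraph H \<and> linear_hypergraph H \<and> rank3_hypergraph H)
         outcome_Avoider"
proof (intro exI conjI)
  let ?M = "machine 19 (Seq setup_tapes (compile decider))"
  show "turing_machine ?M"
    by (rule turing_machine_machine) (simp add: wf_setup_tapes wf_compile wf_decider)
  \<comment> \<open>The time bound is a polynomial in \<open>length w + 1\<close>, hence the
    composition with \<open>[:1, 1:]\<close>.\<close>
  let ?p = "pcompose ([:23, 22:] + time_bound decider) [:1, 1:]"
  show "poly_time_decides ?M (\<lambda>H. hypergraph H \<and> linear_hypergraph H \<and> rank3_hypergraph H) outcome_Avoider"
    unfolding poly_time_decides_def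
  proof (rule exI, intro allI impI)
    fix H :: "nat hypergraph" and w
    assume promise: "(hypergraph H \<and> linear_hypergraph H \<and> rank3_hypergraph H) \<and> encodes w H"
    then have H: "hypergraph H" "linear_hypergraph H" "rank3_hypergraph H" by blast+
    from promise obtain vs es where enc: "distinct vs" "set vs = verts H" "distinct es" "set es = edges H"
      "w = incidence_word vs es" by (auto simp: encodes_def)
    have lin: "linear_family (edges H)" by (rule linear_family_edges[OF H])
    interpret incidence vs es "verts H"
      by unfold_locales (use enc lin H(1) in \<open>auto simp: hypergraph_def\<close>)
    have "outcome_Avoider H \<longleftrightarrow> (\<forall>e\<in>edge ` core. good_edge (edge ` core) e)"
    proof (rule outcome_Avoider_iff_good[OF H])
      show "prune_step\<^sup>*\<^sup>* (edges H) (edge ` core)" using core_steps enc(4) by simp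
      fix e assume "e \<in> edge ` core"
      then obtain j where j: "j \<in> core" "e = edge j" by blast
      show "card (private_points (edge ` core) e) \<le> 1"
        using core_not_prunable[OF j(1)] prunable_iff[OF core_rows j(1)] j(2) by simp
    qed
    also have "\<dots> \<longleftrightarrow> den decider (heads 1) initial_cells 19 0 = 0"
    proof -
      let ?a = "den (For 4 (For 0 prune_edge)) (heads 1) initial_cells"
      have "den decider (heads 1) initial_cells = den check_edges (heads 1) ?a" by (simp only: decider_def den.simps(4))
      then show ?thesis
        using den_check_edges[OF conjunct1[OF den_rounds] conjunct2[OF den_rounds]] bad_iff[OF core_rows] by auto
    qed
    finally have correct: "outcome_Avoider H \<longleftrightarrow> den decider (heads 1) initial_cells 19 0 = 0" .
    have len: "int (length w) = pos (m + 1)"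
      unfolding enc(5) length_incidence_word by (simp add: pos_def)
    have "\<exists>t\<le>poly ([:23, 22:] + time_bound decider) (length w + 1). state_after ?M w t =
      (if den decider (heads 1) initial_cells 19 0 = 0 then accept_state else reject_state)"
      by (rule machine_row_prog[OF len _ ok_decider])
        (simp_all add: enc(5) incidence_word_nth ntapes_def)
    then show "\<exists>t\<le>poly ?p (length w). state_after ?M w t = (if outcome_Avoider H then accept_state else reject_state)"
      unfolding correct by (simp add: poly_pcompose add.commute)
  qed
qed

end
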